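(* Let $\mathbb{F}\in\{\mathbb{R},\mathbb{C},\mathbb{H}\}$ and let $f\in\mathrm{C}_{\mathrm{sing}}([-1,1])$. Then $f$ is positive definite on all projective spaces $\mathbb{FP}^{d-1}$ with $d$ large enough to ensure integrability of $f$ (i.e. $f\in L^1(\mu_{\alpha,\beta})$ for the parameters $\alpha,\beta$ of $\mathbb{FP}^{d-1}$) if and only if there are non-negative numbers $a_n$, $n\in\mathbb{N}_0$, such that $$f(\cos 2\vartheta)=\sum_{n=0}^\infty a_n\cos^{2n}\vartheta\qquad\text{for }\vartheta\in\left(0,\tfrac{\pi}{2}\right].$$
   Context: Singular functions: $\mathrm{C}_{\mathrm{sing}}([-1,1])$ is the set of all $f\in \mathrm{C}([-1,1))$ for which there exists a real $s>0$ such that $(1-t)^sf(t)\in \mathrm{C}([-1,1])$ (i.e. extends continuously to $t=1$). Spaces: for $\mathbb{F}\in\{\mathbb{R},\mathbb{C},\mathbb{H}\}$ and $d\ge2$ the projective space $X_{\alpha,\beta}=\mathbb{FP}^{d-1}$ has parameters $\alpha=\frac{d-1}{2}\dim_{\mathbb{R}}(\mathbb{F})-1$, $\beta=\frac{\dim_{\mathbb{R}}(\mathbb{F})}{2}-1$. Its geodesic distance $\vartheta(x,y)$ is normalized so that the diameter is $\frac{\pi}{2}$. $\mu_{\alpha,\beta}$ is the probability measure on $[-1,1]$ with density proportional to $(1-t)^\alpha(1+t)^\beta$. Every $f\in \mathrm{C}_{\mathrm{sing}}([-1,1])$ lies in $L^1(\mu_{\alpha,\beta})$ for all $\alpha$ large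 enough. Positive definiteness: $f$ is positive definite on $X_{\alpha,\beta}$ if for all (finite) signed Borel measures $\mu$ on $X_{\alpha,\beta}$ such that $f(\cos 2\vartheta(\cdot,y))\in L^1(|\mu|)$ for all $y\in X_{\alpha,\beta}$, $$\iint_{X_{\alpha,\beta}\times X_{\alpha,\beta}}f(\cos 2\vartheta(x,y))\,d\mu(x)\,d\mu(y)\ge 0.$$ Convention at $t=1$: if $f$ extends continuously to $[-1,1]$, $f(1)$ is the value of this extension; otherwise $f(1)=+\infty$, so that the measures $\mu$ admitted in the definition have no atoms. *)

theory Defs
  imports "HOL-Analysis.Analysis"
begin

datatype quat = Quat (q0: real) (q1: real) (q2: real) (q3: real)

lemma quat_eq_iff: "x = y \<longleftrightarrow> q0 x = q0 y \<and> q1 x = q1 y \<and> q2 x = q2 y \<and> q3 x = q3 y"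
  by (cases x; cases y) simp

instantiation quat :: ring_1
begin

definition "0 = Quat 0 0 0 0"
definition "1 = Quat 1 0 0 0"
definition "x + y = Quat (q0 x + q0 y) (q1 x + q1 y) (q2 x + q2 y) (q3 x + q3 y)"
definition "- x = Quat (- q0 x) (- q1 x) (- q2 x) (- q3 x)"
definition "x - y = Quat (q0 x - q0 y) (q1 x - q1 y) (q2 x - q2 y) (q3 x - q3 y)"
definition "x * y = Quat
  (q0 x * q0 y - q1 x * q1 y - q2 x * q2 y - q3 x * q3 y)
  (q0 x * q1 y + q1 x * q0 y + q2 x * q3 y - q3 x * q2 y)
  (q0 x * q2 y - q1 x * q3 y + q2 x * q0 y + q3 x * q1 y)
  (q0 x * q3 y + q1 x * q2 y - q2 x * q1 y + q3 x * q0 y)"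

instance
  by standard
    (auto simp: quat_eq_iff zero_quat_def one_quat_def plus_quat_def uminus_quat_def
      minus_quat_def times_quat_def algebra_simps)

end

instantiation quat :: real_vector
begin

definition "scaleR r x = Quat (r * q0 x) (r * q1 x) (r * q2 x) (r * q3 x)"

instance
  by standard (simp_all add: quat_eq_iff plus_quat_def scaleR_quat_def algebra_simps)

end

instantiation quat :: real_inner
begin

definition "inner x y = q0 x * q0 y + q1 x * q1 y + q2 x * q2 y + q3 x * q3 y" for x y :: quat
definition "norm x = sqrt (inner x x)" for x :: quat
definition "sgn x = x /\<^sub>R norm x" for x :: quat
definition "dist x y = norm (x - y)" for x y :: quat
definition [code del]:
  "(uniformity :: (quat \<times> quat) filter) = (INF e\<in>{0<..}. principal {(x, y). dist x y < e})"
definition [code del]: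
  "open (U :: quat set) \<longleftrightarrow> (\<forall>x\<in>U. \<forall>\<^sub>F (x', y) in uniformity. x' = x \<longrightarrow> y \<in> U)"

instance
proof
  fix x :: quat
  show "inner x x = 0 \<longleftrightarrow> x = 0"
    by (simp add: inner_quat_def quat_eq_iff zero_quat_def add_nonneg_eq_0_iff)
  show "0 \<le> inner x x"
    by (simp add: inner_quat_def)
qed (simp_all add: quat_eq_iff plus_quat_def scaleR_quat_def inner_quat_def norm_quat_def
    sgn_quat_def dist_quat_def uniformity_quat_def open_quat_def algebra_simps)

end

definition quat_cnj :: "quat \<Rightarrow> quat" where
  "quat_cnj x = Quat (q0 x) (- q1 x) (- q2 x) (- q3 x)"

lemmas quat_defs = quat_eq_iff zero_quat_def one_quat_def plus_quat_def uminus_quat_def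
  minus_quat_def times_quat_def scaleR_quat_def inner_quat_def quat_cnj_def

lemma quat_norm_sq: "(norm x)\<^sup>2 = (q0 x)\<^sup>2 + (q1 x)\<^sup>2 + (q2 x)\<^sup>2 + (q3 x)\<^sup>2"
  by (simp add: norm_eq_sqrt_inner inner_quat_def power2_eq_square)

instantiation quat :: real_normed_div_algebra
begin

definition "inverse x = quat_cnj x /\<^sub>R (norm x)\<^sup>2"
definition "x div y = x * inverse y" for x y :: quat

instance
proof
  fix x y :: quat and r :: real
  show "r *\<^sub>R x * y = r *\<^sub>R (x * y)" "x * r *\<^sub>R y = r *\<^sub>R (x * y)"
    by (simp_all add: quat_defs algebra_simps)
  show "x div y = x * inverse y"
    by (rule divide_quat_def)
  show "inverse 0 = (0::quat)"
    by (simp add: inverse_quat_def quat_defs)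
  have "(norm (x * y))\<^sup>2 = (norm x * norm y)\<^sup>2"
    unfolding power_mult_distrib quat_norm_sq
    by (simp add: times_quat_def power2_eq_square algebra_simps)
  then show "norm (x * y) = norm x * norm y"
    by (simp add: power2_eq_iff_nonneg)
  assume "x \<noteq> 0"
  then have nz: "(norm x)\<^sup>2 \<noteq> 0"
    by simp
  have "quat_cnj x * x = (norm x)\<^sup>2 *\<^sub>R 1" "x * quat_cnj x = (norm x)\<^sup>2 *\<^sub>R 1"
    unfolding quat_norm_sq by (simp_all add: quat_defs power2_eq_square algebra_simps)
  moreover have "(r *\<^sub>R x) * y = r *\<^sub>R (x * y)" "x * (r *\<^sub>R y) = r *\<^sub>R (x * y)" for r and x y :: quat
    by (simp_all add: quat_defs algebra_simps)
  ultimately show "inverse x * x = 1" "x * inverse x = 1"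
    using nz by (simp_all add: inverse_quat_def)
qed

end

instantiation quat :: euclidean_space
begin

definition "Basis = {Quat 1 0 0 0, Quat 0 1 0 0, Quat 0 0 1 0, Quat 0 0 0 1}"

instance
proof
  fix u v x :: quat
  show "u \<in> Basis \<Longrightarrow> v \<in> Basis \<Longrightarrow> inner u v = (if u = v then 1 else 0)"
    unfolding Basis_quat_def by (elim insertE emptyE; simp add: inner_quat_def)
  show "(\<forall>u\<in>Basis. inner x u = 0) \<longleftrightarrow> x = 0"
    unfolding quat_eq_iff [of x] by (simp add: Basis_quat_def inner_quat_def zero_quat_def)
qed (simp_all add: Basis_quat_def)

end

lemma DIM_quat: "DIM(quat) = 4"
  by (simp add: Basis_quat_def)

class scalar = real_normed_div_algebra + euclidean_space +
  fixes conj :: "'a \<Rightarrow> 'a"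
  assumes conj_add: "conj (x + y) = conj x + conj y"
    and conj_mult: "conj (x * y) = conj y * conj x"
    and conj_mult_self: "conj x * x = (norm x)\<^sup>2 *\<^sub>R 1"

instantiation real :: scalar
begin
definition "conj x = x" for x :: real
instance by standard (simp_all add: conj_real_def power2_eq_square)
end

instantiation complex :: scalar
begin
definition "conj x = cnj x"
instance
proof
  fix x :: complex
  show "conj x * x = (norm x)\<^sup>2 *\<^sub>R 1"
    by (simp add: conj_complex_def scaleR_conv_of_real mult.commute [of "cnj x"]
        flip: complex_norm_square)
qed (simp_all add: conj_complex_def)
end

instantiation quat :: scalar
begin
definition "conj x = quat_cnj x"
instance
proof
  fix x :: quat
  show "conj x * x = (norm x)\<^sup>2 *\<^sub>R 1"
    unfolding quat_norm_sq
    by (simp add: conj_quat_def quat_defs power2_eq_square algebra_simps)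
qed (simp_all add: conj_quat_def quat_defs algebra_simps)
end

text \<open>
  The dimension is a natural number rather than a type, so vectors of length \<open>d\<close> are functions
  on \<open>nat\<close> that vanish from \<open>d\<close> on. Points of the projective space are one-dimensional
  subspaces, scalars acting from the right; the Hermitian form is conjugate linear on the left.
\<close>

definition coord_space :: "nat \<Rightarrow> (nat \<Rightarrow> 'a::scalar) set" where
  "coord_space d = {x. \<forall>i\<ge>d. x i = 0}"

definition line :: "(nat \<Rightarrow> 'a::scalar) \<Rightarrow> (nat \<Rightarrow> 'a) set" where
  "line x = range (\<lambda>c i. x i * c)"

definition proj_space :: "nat \<Rightarrow> (nat \<Rightarrow> 'a::scalar) set set" where
  "proj_space d = line ` (coord_space d - {\<lambda>i. 0})"

definition herm :: "nat \<Rightarrow> (nat \<Rightarrow> 'a::scalar) \<Rightarrow> (nat \<Rightarrow> 'a) \<Rightarrow> 'a" where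
  "herm d x y = (\<Sum>i<d. conj (x i) * y i)"

definition vec_norm :: "nat \<Rightarrow> (nat \<Rightarrow> 'a::scalar) \<Rightarrow> real" where
  "vec_norm d x = L2_set (\<lambda>i. norm (x i)) {..<d}"

definition proj_rep :: "(nat \<Rightarrow> 'a::scalar) set \<Rightarrow> nat \<Rightarrow> 'a" where
  "proj_rep L = (SOME x. x \<in> L \<and> x \<noteq> (\<lambda>i. 0))"

text \<open>
  The geodesic (Fubini--Study) distance with diameter \<open>pi / 2\<close>. The value does not
  depend on the representatives, see \<open>proj_dist_line\<close> below.
\<close>

definition proj_dist :: "nat \<Rightarrow> (nat \<Rightarrow> 'a::scalar) set \<Rightarrow> (nat \<Rightarrow> 'a) set \<Rightarrow> real" where
  "proj_dist d L M =
    (let x = proj_rep L; y = proj_rep M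
     in arccos (norm (herm d x y) / (vec_norm d x * vec_norm d y)))"

lemma conj_0 [simp]: "conj 0 = (0 :: 'a::scalar)"
  using conj_add [of "0 :: 'a" 0] by simp

lemma mult_conj_self: "x * conj x = (norm x)\<^sup>2 *\<^sub>R (1 :: 'a::scalar)"
proof (cases "x = 0")
  case False
  have "conj x = conj x * x * inverse x"
    using False by (simp add: mult.assoc)
  then show ?thesis
    using False by (simp add: conj_mult_self)
qed simp

lemma norm_conj [simp]: "norm (conj x) = norm (x :: 'a::scalar)"
proof (cases "x = 0")
  case False
  have "norm (conj x * x) = (norm x)\<^sup>2"
    by (simp add: conj_mult_self)
  then have "norm (conj x) * norm x = norm x * norm x"
    by (simp only: norm_mult power2_eq_square)
  with False show ?thesis
    by simp
qed simp

lemma conj_conj [simp]: "conj (conj x) = (x :: 'a::scalar)"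
proof (cases "x = 0")
  case False
  then have "conj x \<noteq> 0"
    by (metis norm_conj norm_eq_zero)
  moreover have "conj (conj x) * conj x = x * conj x"
    by (simp add: conj_mult_self mult_conj_self)
  ultimately show ?thesis
    by simp
qed simp

lemma conj_diff: "conj (x - y) = conj x - conj (y :: 'a::scalar)"
  using conj_add [of "x - y" y] by simp

lemma conj_sum: "conj (\<Sum>i\<in>A. g i) = (\<Sum>i\<in>A. conj (g i :: 'a::scalar))"
  by (induction A rule: infinite_finite_induct) (simp_all add: conj_add)

lemma conj_herm: "conj (herm d x y) = herm d y x"
  by (simp add: herm_def conj_sum conj_mult)

lemma norm_herm_commute: "norm (herm d x y) = norm (herm d y x)"
  by (metis conj_herm norm_conj)

lemma herm_scale_right: "herm d x (\<lambda>i. y i * c) = herm d x y * c"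
  by (simp add: herm_def sum_distrib_right mult.assoc)

lemma herm_scale_left: "herm d (\<lambda>i. x i * c) y = conj c * herm d x y"
  by (simp add: herm_def sum_distrib_left mult.assoc conj_mult)

lemma herm_diff_right: "herm d x (\<lambda>i. y i - z i) = herm d x y - herm d x z"
  by (simp add: herm_def sum_subtractf right_diff_distrib)

lemma herm_diff_left: "herm d (\<lambda>i. x i - z i) y = herm d x y - herm d z y"
  by (simp add: herm_def sum_subtractf left_diff_distrib conj_diff)

lemma vec_norm_nonneg [simp]: "0 \<le> vec_norm d x"
  by (simp add: vec_norm_def L2_set_nonneg)

lemma herm_self: "herm d x x = (vec_norm d x)\<^sup>2 *\<^sub>R 1"
  by (simp add: herm_def vec_norm_def L2_set_def sum_nonneg conj_mult_self scaleR_sum_left)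

lemma vec_norm_scale: "vec_norm d (\<lambda>i. x i * c) = vec_norm d x * norm c"
  by (simp add: vec_norm_def norm_mult L2_set_left_distrib)

lemma herm_Cauchy_Schwarz: "norm (herm d x y) \<le> vec_norm d x * vec_norm d y"
proof -
  have "norm (herm d x y) \<le> (\<Sum>i<d. \<bar>norm (x i)\<bar> * \<bar>norm (y i)\<bar>)"
    unfolding herm_def by (rule order_trans [OF norm_sum]) (simp add: norm_mult)
  also have "\<dots> \<le> vec_norm d x * vec_norm d y"
    unfolding vec_norm_def by (rule L2_set_mult_ineq)
  finally show ?thesis .
qed

lemma vec_norm_eq_0:
  assumes "x \<in> coord_space d" "vec_norm d x = 0"
  shows "x = (\<lambda>i. 0)"
proof
  fix i
  show "x i = 0"
    using assms by (cases "i < d") (auto simp: coord_space_def vec_norm_def L2_set_eq_0_iff)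
qed

lemma line_scale:
  assumes "c \<noteq> (0 :: 'a::scalar)"
  shows "line (\<lambda>i. x i * c) = line x"
proof -
  have "c * (inverse c * b) = b" for b
    using assms by (simp flip: mult.assoc)
  then have "(\<lambda>i. x i * b) = (\<lambda>i. x i * c * (inverse c * b))" for b
    by (simp add: mult.assoc)
  moreover have "(\<lambda>i. x i * c * b) = (\<lambda>i. x i * (c * b))" for b
    by (simp add: mult.assoc)
  ultimately show ?thesis
    unfolding line_def by (intro equalityI image_subsetI) (metis rangeI)+
qed

lemma unit_vector:
  assumes "x \<in> coord_space d" "x \<noteq> (\<lambda>i. 0 :: 'a::scalar)"
  obtains c where "c \<noteq> 0" "vec_norm d (\<lambda>i. x i * c) = 1" "(\<lambda>i. x i * c) \<in> coord_space d"
proof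
  have nz: "vec_norm d x \<noteq> 0"
    using vec_norm_eq_0 assms by blast
  let ?c = "inverse (vec_norm d x) *\<^sub>R (1 :: 'a)"
  show "?c \<noteq> 0" "vec_norm d (\<lambda>i. x i * ?c) = 1" "(\<lambda>i. x i * ?c) \<in> coord_space d"
    using nz assms by (simp_all only: vec_norm_scale) (auto simp: coord_space_def)
qed

lemma proj_dist_line:
  assumes "x \<noteq> (\<lambda>i. 0)" "y \<noteq> (\<lambda>i. 0)"
  shows "proj_dist d (line x) (line y) =
    arccos (norm (herm d x y) / (vec_norm d x * vec_norm d y))"
proof -
  have rep: "\<exists>c. c \<noteq> 0 \<and> proj_rep (line x) = (\<lambda>i. x i * c)" if "x \<noteq> (\<lambda>i. 0)"
    for x :: "nat \<Rightarrow> 'a"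
  proof -
    have "x \<in> line x \<and> x \<noteq> (\<lambda>i. 0)"
      using that by (auto simp: line_def intro: range_eqI [of _ _ 1])
    then have "proj_rep (line x) \<in> line x \<and> proj_rep (line x) \<noteq> (\<lambda>i. 0)"
      unfolding proj_rep_def by (rule someI [where P = "\<lambda>z. z \<in> line x \<and> z \<noteq> (\<lambda>i. 0)"])
    then obtain c where c: "proj_rep (line x) = (\<lambda>i. x i * c)" "proj_rep (line x) \<noteq> (\<lambda>i. 0)"
      by (auto simp: line_def)
    then have "c \<noteq> 0"
      by auto
    with c show ?thesis
      by blast
  qed
  obtain b c where "b \<noteq> 0" "c \<noteq> 0"
    "proj_rep (line x) = (\<lambda>i. x i * b)" "proj_rep (line y) = (\<lambda>i. y i * c)"
    using rep assms by metis
  then show ?thesis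
    by (simp add: proj_dist_def vec_norm_scale herm_scale_left herm_scale_right norm_mult)
qed

lemma proj_space_unit:
  assumes "L \<in> proj_space d"
  obtains x where "x \<in> coord_space d" "vec_norm d x = 1" "L = line x" "x \<noteq> (\<lambda>i. 0)"
proof -
  obtain x where x: "x \<in> coord_space d" "x \<noteq> (\<lambda>i. 0)" "L = line x"
    using assms by (auto simp: proj_space_def)
  then obtain c where "c \<noteq> 0" "vec_norm d (\<lambda>i. x i * c) = 1" "(\<lambda>i. x i * c) \<in> coord_space d"
    using unit_vector by blast
  moreover from this have "(\<lambda>i. x i * c) \<noteq> (\<lambda>i. 0)"
    by (metis vec_norm_def L2_set_eq_0_iff finite_lessThan norm_zero zero_neq_one)
  ultimately show ?thesis
    using x line_scale that by metis
qed

lemma vec_norm_residual: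
  assumes "vec_norm d x = 1" "vec_norm d y = 1"
  shows "vec_norm d (\<lambda>i. x i - y i * herm d y x) = sqrt (1 - (norm (herm d x y))\<^sup>2)"
    (is "vec_norm d ?u = _")
proof -
  have "(vec_norm d ?u)\<^sup>2 *\<^sub>R (1 :: 'a) = herm d x x - herm d x y * herm d y x"
    using assms
    by (simp flip: herm_self add: herm_diff_left herm_diff_right herm_scale_left herm_scale_right
        conj_herm) (simp add: herm_self)
  also have "herm d x y * herm d y x = (norm (herm d x y))\<^sup>2 *\<^sub>R 1"
    by (metis conj_herm mult_conj_self)
  also have "herm d x x - \<dots> = (1 - (norm (herm d x y))\<^sup>2) *\<^sub>R 1"
    using assms by (simp add: herm_self scaleR_diff_left)
  finally show ?thesis
    by (simp add: real_sqrt_unique)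
qed

lemma Metric_space_proj_dist:
  "Metric_space (proj_space d :: (nat \<Rightarrow> 'a::scalar) set set) (proj_dist d)"
proof
  fix L M :: "(nat \<Rightarrow> 'a) set"
  let ?q = "\<lambda>x y :: nat \<Rightarrow> 'a. norm (herm d x y) / (vec_norm d x * vec_norm d y)"
  have "?q x y \<le> 1" for x y
    using herm_Cauchy_Schwarz [of d x y] by (auto simp: divide_le_eq_1 less_le)
  moreover have "- 1 \<le> ?q x y" for x y
    by (rule order_trans [of _ 0]) simp_all
  ultimately have "0 \<le> arccos (?q x y)" for x y
    by (rule arccos_lbound [rotated])
  then show "0 \<le> proj_dist d L M"
    unfolding proj_dist_def Let_def .
  have "?q x y = ?q y x" for x y
    by (metis norm_herm_commute mult.commute)
  then show "proj_dist d L M = proj_dist d M L"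
    unfolding proj_dist_def Let_def by metis
next
  fix L M :: "(nat \<Rightarrow> 'a) set"
  assume L: "L \<in> proj_space d" and M: "M \<in> proj_space d"
  obtain x where
    x: "x \<in> coord_space d" "vec_norm d x = 1" "L = line x" "x \<noteq> (\<lambda>i. 0)"
    by (rule proj_space_unit [OF L])
  obtain y where
    y: "y \<in> coord_space d" "vec_norm d y = 1" "M = line y" "y \<noteq> (\<lambda>i. 0)"
    by (rule proj_space_unit [OF M])
  have le1: "norm (herm d x y) \<le> 1"
    using herm_Cauchy_Schwarz [of d x y] x y by simp
  have dist: "proj_dist d L M = arccos (norm (herm d x y))"
    using x y by (simp add: proj_dist_line)
  show "proj_dist d L M = 0 \<longleftrightarrow> L = M"
  proof
    assume "proj_dist d L M = 0"
    then have one: "norm (herm d x y) = 1"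
      using dist le1 by (metis arccos_eq_iff arccos_1 abs_norm_cancel abs_one order_refl)
    let ?u = "\<lambda>i. x i - y i * herm d y x"
    have "?u = (\<lambda>i. 0)"
      by (rule vec_norm_eq_0 [of _ d]) (use x y one in \<open>auto simp: vec_norm_residual coord_space_def\<close>)
    then have "x = (\<lambda>i. y i * herm d y x)"
      by (metis eq_iff_diff_eq_0)
    moreover have "herm d y x \<noteq> 0"
      using one norm_herm_commute [of d x y] by auto
    ultimately show "L = M"
      using x y by (metis line_scale)
  next
    have "proj_dist d (line x) (line x) = 0"
      using x by (simp add: proj_dist_line herm_self)
    moreover assume "L = M"
    ultimately show "proj_dist d L M = 0"
      using x by simp
  qed
next
  fix L M N :: "(nat \<Rightarrow> 'a) set"
  assume L: "L \<in> proj_space d" and M: "M \<in> proj_space d" and N: "N \<in> proj_space d"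
  obtain x where x: "vec_norm d x = 1" "L = line x" "x \<noteq> (\<lambda>i. 0)"
    by (rule proj_space_unit [OF L])
  obtain y where y: "vec_norm d y = 1" "M = line y" "y \<noteq> (\<lambda>i. 0)"
    by (rule proj_space_unit [OF M])
  obtain z where z: "vec_norm d z = 1" "N = line z" "z \<noteq> (\<lambda>i. 0)"
    by (rule proj_space_unit [OF N])
  define p q r where "p = norm (herm d x y)" and "q = norm (herm d y z)" and "r = norm (herm d x z)"
  have bounds: "0 \<le> p" "p \<le> 1" "0 \<le> q" "q \<le> 1" "0 \<le> r" "r \<le> 1"
    using herm_Cauchy_Schwarz [of d x y] herm_Cauchy_Schwarz [of d y z]
      herm_Cauchy_Schwarz [of d x z] x y z by (simp_all add: p_def q_def r_def)
  let ?u = "\<lambda>i. x i - y i * herm d y x" and ?v = "\<lambda>i. z i - y i * herm d y z"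
  have "herm d ?u ?v = herm d x z - herm d x y * herm d y z"
    using y by (simp add: herm_diff_left herm_diff_right herm_scale_left herm_scale_right conj_herm)
      (simp add: herm_self)
  moreover have "norm (herm d ?u ?v) \<le> sqrt (1 - p\<^sup>2) * sqrt (1 - q\<^sup>2)"
    using herm_Cauchy_Schwarz [of d ?u ?v] x y z
    by (simp add: vec_norm_residual p_def q_def norm_herm_commute [of d z y])
  ultimately have "norm (herm d x y * herm d y z) - r \<le> sqrt (1 - p\<^sup>2) * sqrt (1 - q\<^sup>2)"
    unfolding r_def by (metis norm_minus_commute norm_triangle_ineq2 order_trans)
  then have "p * q - sqrt (1 - p\<^sup>2) * sqrt (1 - q\<^sup>2) \<le> r"
    by (simp add: norm_mult p_def q_def)
  moreover have ge: "- 1 \<le> p" "- 1 \<le> q"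
    using bounds by linarith+
  ultimately have "cos (arccos p + arccos q) \<le> r"
    using bounds by (simp add: cos_add cos_arccos sin_arccos)
  then have "arccos r \<le> arccos (cos (arccos p + arccos q))"
    using bounds by (intro arccos_le_arccos) simp_all
  also have "\<dots> = arccos p + arccos q"
    using arccos_le_pi2 [of p] arccos_le_pi2 [of q] arccos_lbound [of p] arccos_lbound [of q]
      bounds ge by (intro arccos_cos) linarith+
  finally have "arccos r \<le> arccos p + arccos q" .
  then show "proj_dist d L N \<le> proj_dist d L M + proj_dist d M N"
    using x y z by (simp add: proj_dist_line p_def q_def r_def)
qed

definition proj_borel :: "nat \<Rightarrow> (nat \<Rightarrow> 'a::scalar) set measure" where
  "proj_borel d = sigma (proj_space d)
    {U. openin (Metric_space.mtopology (proj_space d) (proj_dist d)) U}"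

definition signed_measure :: "'p measure \<Rightarrow> ('p set \<Rightarrow> real) \<Rightarrow> bool" where
  "signed_measure X \<mu> \<longleftrightarrow>
    (\<forall>A. range A \<subseteq> sets X \<longrightarrow> disjoint_family A \<longrightarrow> (\<lambda>n. \<mu> (A n)) sums \<mu> (\<Union>n. A n))"

text \<open>
  The Jordan decomposition: \<open>ennreal\<close> truncates negative values to 0, and the empty set
  contributes 0 to the supremum anyway.
\<close>

definition pos_part :: "'p measure \<Rightarrow> ('p set \<Rightarrow> real) \<Rightarrow> 'p measure" where
  "pos_part X \<mu> = measure_of (space X) (sets X) (\<lambda>A. SUP B\<in>{B\<in>sets X. B \<subseteq> A}. ennreal (\<mu> B))"

definition neg_part :: "'p measure \<Rightarrow> ('p set \<Rightarrow> real) \<Rightarrow> 'p measure" where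
  "neg_part X \<mu> = pos_part X (\<lambda>A. - \<mu> A)"

definition total_variation :: "'p measure \<Rightarrow> ('p set \<Rightarrow> real) \<Rightarrow> 'p measure" where
  "total_variation X \<mu> = measure_of (space X) (sets X)
    (\<lambda>A. emeasure (pos_part X \<mu>) A + emeasure (neg_part X \<mu>) A)"

lemma signed_measure_uminus: "signed_measure X \<mu> \<Longrightarrow> signed_measure X (\<lambda>A. - \<mu> A)"
  by (simp add: signed_measure_def sums_minus)

lemma signed_measure_empty:
  assumes "signed_measure X \<mu>"
  shows "\<mu> {} = 0"
proof -
  have "(\<lambda>n::nat. \<mu> {}) sums \<mu> (\<Union>n::nat. {})"
    using assms unfolding signed_measure_def by (auto simp: disjoint_family_on_def)
  then show ?thesis
    using sums_summable summable_const_iff by blast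
qed

lemma signed_measure_Un:
  assumes "signed_measure X \<mu>" "A \<in> sets X" "B \<in> sets X" "A \<inter> B = {}"
  shows "\<mu> (A \<union> B) = \<mu> A + \<mu> B"
proof -
  have "range (binaryset A B) \<subseteq> sets X" "disjoint_family (binaryset A B)"
    using assms by (auto simp: range_binaryset_eq disjoint_family_on_def binaryset_def)
  then have "(\<lambda>n. \<mu> (binaryset A B n)) sums \<mu> (\<Union>n. binaryset A B n)"
    using assms(1) by (simp add: signed_measure_def)
  moreover have "(\<lambda>n. \<mu> (binaryset A B n)) sums (\<mu> A + \<mu> B)"
    using signed_measure_empty [OF assms(1)] by (intro binaryset_sums) auto
  ultimately show ?thesis
    using sums_unique2 by (metis UN_binaryset_eq)
qed

lemma emeasure_pos_part:
  assumes \<mu>: "signed_measure X \<mu>" and A: "A \<in> sets X"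
  shows "emeasure (pos_part X \<mu>) A = (SUP B\<in>{B\<in>sets X. B \<subseteq> A}. ennreal (\<mu> B))"
proof -
  define f where "f A = (SUP B\<in>{B\<in>sets X. B \<subseteq> A}. ennreal (\<mu> B))" for A
  have upper: "ennreal (\<mu> B) \<le> f A" if "B \<in> sets X" "B \<subseteq> A" for A B
    unfolding f_def using that by (intro SUP_upper) auto
  have pair: "ennreal (\<mu> B) + ennreal (\<mu> C) \<le> f (A \<union> A')"
    if "B \<in> sets X" "B \<subseteq> A" "C \<in> sets X" "C \<subseteq> A'" "A \<inter> A' = {}" for A A' B C
  proof (cases "0 \<le> \<mu> B \<and> 0 \<le> \<mu> C")
    case True
    have "\<mu> (B \<union> C) = \<mu> B + \<mu> C"
      using that by (intro signed_measure_Un [OF \<mu>]) auto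
    then show ?thesis
      using True upper [of "B \<union> C" "A \<union> A'"] that by (auto simp flip: ennreal_plus)
  next
    case False
    moreover have "B \<subseteq> A \<union> A'" "C \<subseteq> A \<union> A'"
      using that by auto
    ultimately show ?thesis
      using upper [of B "A \<union> A'"] upper [of C "A \<union> A'"] that
      by (auto simp: not_le ennreal_neg less_imp_le)
  qed
  have super: "f A + f A' \<le> f (A \<union> A')" if "A \<inter> A' = {}" for A A'
  proof -
    have "ennreal (\<mu> B) + f A' \<le> f (A \<union> A')" if "B \<in> sets X" "B \<subseteq> A" for B
    proof -
      have "ennreal (\<mu> B) + f A' = (SUP C\<in>{C\<in>sets X. C \<subseteq> A'}. ennreal (\<mu> B) + ennreal (\<mu> C))"
        unfolding f_def by (rule ennreal_SUP_add_right) auto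
      also have "\<dots> \<le> f (A \<union> A')"
        using pair that \<open>A \<inter> A' = {}\<close> by (intro SUP_least) auto
      finally show ?thesis .
    qed
    moreover have "f A + f A' = (SUP B\<in>{B\<in>sets X. B \<subseteq> A}. ennreal (\<mu> B) + f A')"
      unfolding f_def [of A] by (rule ennreal_SUP_add_left [symmetric]) auto
    ultimately show ?thesis
      by (auto intro: SUP_least)
  qed
  have "countably_additive (sets X) f"
  proof (rule countably_additiveI)
    fix A :: "nat \<Rightarrow> 'a set"
    assume A: "range A \<subseteq> sets X" "disjoint_family A"
    have le_f: "(\<Sum>i<n. f (A i)) \<le> f (\<Union>i<n. A i)" for n
    proof (induction n)
      case (Suc n)
      have "A i \<inter> A n = {}" if "i < n" for i
        using disjoint_family_onD [OF A(2), of i n] that by simp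
      then have "(\<Union>i<n. A i) \<inter> A n = {}"
        by auto
      then have super_n: "f (\<Union>i<n. A i) + f (A n) \<le> f ((\<Union>i<n. A i) \<union> A n)"
        by (rule super)
      have "(\<Sum>i<Suc n. f (A i)) \<le> f (\<Union>i<n. A i) + f (A n)"
        using Suc.IH by (simp add: add_right_mono)
      also note super_n
      also have "(\<Union>i<n. A i) \<union> A n = (\<Union>i<Suc n. A i)"
        by (auto simp: lessThan_Suc)
      finally show ?case .
    qed simp
    have mono: "f (\<Union>i<n. A i) \<le> f (\<Union>i. A i)" for n
      unfolding f_def by (rule SUP_subset_mono) auto
    have "(\<Sum>i. f (A i)) \<le> f (\<Union>i. A i)"
      by (rule suminf_le_const) (auto intro: summableI order_trans [OF le_f mono])
    moreover have "f (\<Union>i. A i) \<le> (\<Sum>i. f (A i))"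
      unfolding f_def [of "\<Union>i. A i"]
    proof (rule SUP_least)
      fix B
      assume "B \<in> {B \<in> sets X. B \<subseteq> (\<Union>i. A i)}"
      then have B: "B \<in> sets X" "B \<subseteq> (\<Union>i. A i)"
        by simp_all
      have "(\<lambda>n. \<mu> (B \<inter> A n)) sums \<mu> (\<Union>n. B \<inter> A n)"
      proof -
        have "range (\<lambda>n. B \<inter> A n) \<subseteq> sets X" "disjoint_family (\<lambda>n. B \<inter> A n)"
          using A B by (auto simp: disjoint_family_on_def)
        with \<mu> show ?thesis
          unfolding signed_measure_def by blast
      qed
      moreover have "(\<Union>n. B \<inter> A n) = B"
        using B by auto
      ultimately have "(\<lambda>n. ennreal (\<Sum>i<n. \<mu> (B \<inter> A i))) \<longlonglongrightarrow> ennreal (\<mu> B)"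
        by (intro tendsto_ennrealI) (simp add: sums_def)
      moreover have "ennreal (\<Sum>i<n. \<mu> (B \<inter> A i)) \<le> (\<Sum>i. f (A i))" for n
      proof -
        have "ennreal (\<Sum>i<n. \<mu> (B \<inter> A i)) \<le> (\<Sum>i<n. ennreal (\<mu> (B \<inter> A i)))"
        proof (induction n)
          case (Suc n)
          have "ennreal (a + b) \<le> ennreal a + ennreal b" for a b
            by (cases "0 \<le> a"; cases "0 \<le> b")
              (simp_all add: ennreal_neg ennreal_leI flip: ennreal_plus)
          with Suc show ?case
            by (simp add: add.commute) (meson add_left_mono order_trans)
        qed simp
        also have "\<dots> \<le> (\<Sum>i<n. f (A i))"
          using A B by (intro sum_mono upper) auto
        also have "\<dots> \<le> (\<Sum>i. f (A i))"
          by (rule sum_le_suminf) (auto intro: summableI)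
        finally show ?thesis .
      qed
      ultimately show "ennreal (\<mu> B) \<le> (\<Sum>i. f (A i))"
        by (intro LIMSEQ_le_const2) auto
    qed
    ultimately show "(\<Sum>i. f (A i)) = f (\<Union>i. A i)"
      by (rule antisym)
  qed
  moreover have "positive (sets X) f"
    by (simp add: positive_def f_def signed_measure_empty [OF \<mu>] cong: conj_cong)
  ultimately show ?thesis
    using emeasure_measure_of_sigma [OF sets.sigma_algebra_axioms, of X f A] A
    unfolding pos_part_def f_def by simp
qed

lemma sets_parts [simp]:
  "sets (pos_part X \<mu>) = sets X" "sets (neg_part X \<mu>) = sets X"
  "sets (total_variation X \<mu>) = sets X"
  by (simp_all add: pos_part_def neg_part_def total_variation_def)

lemma emeasure_total_variation:
  assumes "A \<in> sets X"
  shows "emeasure (total_variation X \<mu>) A =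
    emeasure (pos_part X \<mu>) A + emeasure (neg_part X \<mu>) A"
proof -
  let ?f = "\<lambda>A. emeasure (pos_part X \<mu>) A + emeasure (neg_part X \<mu>) A"
  have "countably_additive (sets X) ?f"
    by (intro countably_additiveI) (simp add: suminf_add [symmetric] summableI suminf_emeasure)
  moreover have "positive (sets X) ?f"
    by (simp add: positive_def)
  ultimately show ?thesis
    using emeasure_measure_of_sigma [OF sets.sigma_algebra_axioms, of X ?f A] assms
    unfolding total_variation_def by simp
qed

definition in_L1 :: "'p measure \<Rightarrow> ('p \<Rightarrow> ereal) \<Rightarrow> bool" where
  "in_L1 M g \<longleftrightarrow> g \<in> borel_measurable M \<and> (\<integral>\<^sup>+x. e2ennreal \<bar>g x\<bar> \<partial>M) < \<infinity>"

text \<open>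
  The integral of an extended real valued kernel against the product of \<open>\<mu>\<close> with
  itself, whose Jordan decomposition is
  \<open>(\<mu>\<^sup>+ \<Otimes> \<mu>\<^sup>+ + \<mu>\<^sup>- \<Otimes> \<mu>\<^sup>-) - (\<mu>\<^sup>+ \<Otimes> \<mu>\<^sup>- + \<mu>\<^sup>- \<Otimes> \<mu>\<^sup>+)\<close>.
  \<open>dbl_integral_pos\<close> is the integral of the positive part; \<open>e2ennreal\<close> truncates
  negative values to 0. If both parts are infinite, the integral does not exist and
  \<open>dbl_integral\<close> has the value \<open>\<infinity> - \<infinity> = \<infinity>\<close>.
\<close>

definition dbl_integral_pos ::
    "'p measure \<Rightarrow> ('p set \<Rightarrow> real) \<Rightarrow> ('p \<Rightarrow> 'p \<Rightarrow> ereal) \<Rightarrow> ennreal" where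
  "dbl_integral_pos X \<mu> K =
     (\<integral>\<^sup>+(x, y). e2ennreal (K x y) \<partial>(pos_part X \<mu> \<Otimes>\<^sub>M pos_part X \<mu>)) +
     (\<integral>\<^sup>+(x, y). e2ennreal (K x y) \<partial>(neg_part X \<mu> \<Otimes>\<^sub>M neg_part X \<mu>)) +
     (\<integral>\<^sup>+(x, y). e2ennreal (- K x y) \<partial>(pos_part X \<mu> \<Otimes>\<^sub>M neg_part X \<mu>)) +
     (\<integral>\<^sup>+(x, y). e2ennreal (- K x y) \<partial>(neg_part X \<mu> \<Otimes>\<^sub>M pos_part X \<mu>))"

definition dbl_integral ::
    "'p measure \<Rightarrow> ('p set \<Rightarrow> real) \<Rightarrow> ('p \<Rightarrow> 'p \<Rightarrow> ereal) \<Rightarrow> ereal" where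
  "dbl_integral X \<mu> K =
     enn2ereal (dbl_integral_pos X \<mu> K) - enn2ereal (dbl_integral_pos X \<mu> (\<lambda>x y. - K x y))"

text \<open>Functions on \<open>[-1, 1)\<close>; the values elsewhere are irrelevant.\<close>

definition C_sing :: "(real \<Rightarrow> real) set" where
  "C_sing = {f. continuous_on {-1..<1} f \<and>
     (\<exists>s>0. \<exists>g. continuous_on {-1..1} g \<and> (\<forall>t\<in>{-1..<1}. g t = (1 - t) powr s * f t))}"

text \<open>
  If \<open>f\<close> has no continuous extension to 1, the value \<open>\<infinity>\<close> on the diagonal
  excludes measures with atoms through the integrability condition in
  \<open>positive_definite\<close>.
\<close>

definition value_at_one :: "(real \<Rightarrow> real) \<Rightarrow> ereal" where
  "value_at_one f =
     (if \<exists>l. (f \<longlongrightarrow> l) (at_left 1) then ereal (Lim (at_left 1) f) else \<infinity>)"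

definition ext_one :: "(real \<Rightarrow> real) \<Rightarrow> real \<Rightarrow> ereal" where
  "ext_one f t = (if t = 1 then value_at_one f else ereal (f t))"

text \<open>
  The restriction to \<open>[-1, 1]\<close> makes the values of \<open>f\<close> outside this interval
  irrelevant for its integrability.
\<close>

definition jacobi_weight :: "real \<Rightarrow> real \<Rightarrow> real measure" where
  "jacobi_weight \<alpha> \<beta> =
     density (restrict_space lborel {-1..1}) (\<lambda>t. ennreal ((1 - t) powr \<alpha> * (1 + t) powr \<beta>))"

definition jacobi_measure :: "real \<Rightarrow> real \<Rightarrow> real measure" where
  "jacobi_measure \<alpha> \<beta> =
     scale_measure (inverse (emeasure (jacobi_weight \<alpha> \<beta>) {-1..1})) (jacobi_weight \<alpha> \<beta>)"

definition proj_alpha :: "'a::scalar itself \<Rightarrow> nat \<Rightarrow> real" where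
  "proj_alpha F d = (real d - 1) / 2 * DIM('a) - 1"

definition proj_beta :: "'a::scalar itself \<Rightarrow> real" where
  "proj_beta F = DIM('a) / 2 - 1"

definition kernel :: "nat \<Rightarrow> (real \<Rightarrow> real) \<Rightarrow>
    (nat \<Rightarrow> 'a::scalar) set \<Rightarrow> (nat \<Rightarrow> 'a) set \<Rightarrow> ereal" where
  "kernel d f x y = ext_one f (cos (2 * proj_dist d x y))"

definition positive_definite :: "'a::scalar itself \<Rightarrow> nat \<Rightarrow> (real \<Rightarrow> real) \<Rightarrow> bool" where
  "positive_definite F d f \<longleftrightarrow>
    (\<forall>\<mu>. signed_measure (proj_borel d :: (nat \<Rightarrow> 'a) set measure) \<mu> \<longrightarrow>
      (\<forall>y\<in>proj_space d. in_L1 (total_variation (proj_borel d) \<mu>) (\<lambda>x. kernel d f x y)) \<longrightarrow>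
      0 \<le> dbl_integral (proj_borel d) \<mu> (kernel d f))"

definition positive_definite_all :: "'a::scalar itself \<Rightarrow> (real \<Rightarrow> real) \<Rightarrow> bool" where
  "positive_definite_all F f \<longleftrightarrow>
    (\<forall>d\<ge>2. integrable (jacobi_measure (proj_alpha F d) (proj_beta F)) f \<longrightarrow>
      positive_definite F d f)"

end

theory Submission
  imports Defs "HOL-Probability.Infinite_Product_Measure"
begin

text \<open>
  Write \<open>u = cos\<^sup>2 \<theta>\<close> and \<open>g u = f (2 * u - 1)\<close>. For unit vectors \<open>x\<close> and \<open>y\<close> the overlap
  \<open>u\<close> of their lines is \<open>\<bar>\<langle>x, y\<rangle>\<bar>\<^sup>2\<close>, and the kernel is \<open>g\<close> of the overlap. The claim is that
  \<open>g\<close> is positive definite in all high dimensions iff \<open>g\<close> is a power series with nonnegative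
  coefficients on \<open>[0, 1)\<close>.

  Power series are positive definite because the overlap is the inner product of the rank one
  projections \<open>x x\<^sup>*\<close> and \<open>y y\<^sup>*\<close>; hence \<open>u ^ n\<close> is a finite sum of products
  \<open>\<psi> L * \<psi> M\<close> (\<open>overlap_power_features\<close>), whose double integrals are squares. Monotone
  convergence sums the powers; the convention for the value at 1 is exactly what makes the
  expansion hold on the diagonal as well (\<open>value_at_one_power_series\<close>).

  For the converse, a Bernstein polynomial argument replaces harmonic analysis. Let \<open>\<eta>\<close> be a
  random sign vector of length \<open>M\<close> with independent entries of mean \<open>\<rho>\<close>. Its law has density
  \<open>\<Prod>k<M. 1 + \<rho> * \<eta> k\<close> with respect to fair coins, so
  \<open>E (g ((mean \<eta>)\<^sup>2)) = (\<Sum>S. \<rho> ^ card S * A S)\<close>, where \<open>A S\<close> is the fair mean of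
  \<open>(\<Prod>k\<in>S. \<eta> k) * g ((mean \<eta>)\<^sup>2)\<close>. By the law of large numbers the left-hand side tends to
  \<open>g (\<rho>\<^sup>2)\<close> as \<open>M\<close> grows. Moreover \<open>A S \<ge> 0\<close>: if \<open>\<epsilon>\<close> and \<open>\<delta>\<close> are two
  independent fair sign vectors, then the vectors \<open>\<epsilon> / sqrt M\<close> and \<open>\<delta> / sqrt M\<close> have inner
  product \<open>mean \<eta>\<close> for \<open>\<eta> = \<epsilon> * \<delta>\<close>, and \<open>A S\<close> is the double integral of the kernel
  against the signed measure with density \<open>\<Prod>k\<in>S. \<epsilon> k\<close>. Only even \<open>card S\<close> survive the
  symmetrization \<open>\<rho> \<mapsto> - \<rho>\<close>, so \<open>g\<close> is a pointwise limit of polynomials with nonnegative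
  coefficients, and such limits are power series (\<open>nonneg_power_series_limit\<close>).

  If \<open>f\<close> is singular at 1, point masses are not admitted. So every sign \<open>\<epsilon> k\<close> is smeared to a
  random point of the unit circle, on an arc of length \<open>\<kappa>\<close> or on the antipodal arc. The mean of
  the products of two such points tends to \<open>c * \<rho>\<close> with a constant \<open>c\<close> that tends to 1
  for \<open>\<kappa> \<rightarrow> 0\<close>, and this gives a power series for \<open>v \<mapsto> g (c\<^sup>2 * v)\<close>. Two estimates make
  the argument work for the singularity \<open>(1 - u) ^ (- m)\<close>. First, the inequality between the
  arithmetic and the geometric mean bounds it by a product over the coordinates in which each
  factor is \<open>1 + O(1 / M)\<close> in the mean, so its expectation is bounded uniformly in \<open>M\<close>
  (\<open>nn_integral_singular\<close>). Second, integrability against all points of the projective space, not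
  only those of the torus, follows from Fatou's lemma (\<open>nn_integral_singular_point_finite\<close>).

  The scalar field enters only through the class \<open>scalar\<close>: the test measures live on lines that are
  spanned by real vectors.
\<close>

section \<open>Coordinates on projective spaces\<close>

lemma conj_one [simp]: "conj 1 = (1 :: 'a::scalar)"
  using conj_mult_self [of "1 :: 'a"] by simp

lemma inner_conj_conj: "inner (conj x) (conj y) = inner x (y :: 'a::scalar)"
  by (simp add: dot_norm flip: conj_add)

text \<open>
  Polarization of \<open>conj_mult_self\<close>. It ties the multiplication of the scalars to their real inner
  product, and so replaces computations with the three individual fields.
\<close>

lemma conj_mult_symmetrized: "conj x * y + conj y * x = (2 * inner x y) *\<^sub>R (1 :: 'a::scalar)"
proof -
  have "conj (x + y) * (x + y) = (norm (x + y))\<^sup>2 *\<^sub>R 1"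
    by (rule conj_mult_self)
  then show ?thesis
    by (simp add: conj_add distrib_left distrib_right conj_mult_self power2_norm_eq_inner
        inner_add_left inner_add_right inner_commute scaleR_add_left algebra_simps)
qed

lemma conj_add_self: "conj x + x = (2 * inner x 1) *\<^sub>R (1 :: 'a::scalar)"
  using conj_mult_symmetrized [of x 1] by simp

lemma conj_of_real [simp]: "conj (of_real r :: 'a::scalar) = of_real r"
proof -
  have "conj (of_real r :: 'a) = (2 * inner (of_real r) (1 :: 'a)) *\<^sub>R 1 - of_real r"
    using conj_add_self [of "of_real r :: 'a"] by (simp add: eq_diff_eq)
  also have "inner (of_real r) (1 :: 'a) = r"
    by (simp add: of_real_def flip: power2_norm_eq_inner)
  finally show ?thesis
    by (simp add: of_real_def flip: scaleR_diff_left)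
qed

lemma inner_conj_mult: "inner (conj x * y) 1 = inner x (y :: 'a::scalar)"
proof -
  have "(2 * inner (conj x * y) 1) *\<^sub>R (1 :: 'a) = (2 * inner x y) *\<^sub>R 1"
    using conj_add_self [of "conj x * y"] conj_mult_symmetrized [of x y]
    by (simp add: conj_mult add.commute)
  then show ?thesis
    by (simp add: scaleR_cancel_right)
qed

lemma inner_mult_conj: "inner (x * conj y) 1 = inner x (y :: 'a::scalar)"
  using inner_conj_mult [of "conj x" "conj y"] by (simp add: inner_conj_conj)

text \<open>
  The real part is cyclic, which is all the commutativity that remains for quaternions.
\<close>

lemma inner_mult_commute: "inner (x * y) 1 = inner (y * x) (1 :: 'a::scalar)"
  using inner_conj_mult [of "conj x" y] inner_mult_conj [of y "conj x"]
  by (simp add: inner_commute)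

lemma proj_rep_line:
  assumes "x \<noteq> (\<lambda>i. 0 :: 'a::scalar)"
  obtains c where "c \<noteq> 0" "proj_rep (line x) = (\<lambda>i. x i * c)"
proof -
  have "x \<in> line x \<and> x \<noteq> (\<lambda>i. 0)"
    using assms by (auto simp: line_def intro: range_eqI [of _ _ 1])
  then have "proj_rep (line x) \<in> line x \<and> proj_rep (line x) \<noteq> (\<lambda>i. 0)"
    unfolding proj_rep_def by (rule someI [where P = "\<lambda>z. z \<in> line x \<and> z \<noteq> (\<lambda>i. 0)"])
  then obtain c where c: "proj_rep (line x) = (\<lambda>i. x i * c)" "proj_rep (line x) \<noteq> (\<lambda>i. 0)"
    by (auto simp: line_def)
  then have "c \<noteq> 0"
    by auto
  with c show ?thesis
    using that by blast
qed

text \<open>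
  The entries of the orthogonal projection \<open>x x\<^sup>*\<close> onto the line; unlike \<open>x\<close> itself they depend
  on the line only.
\<close>

definition moment :: "nat \<Rightarrow> (nat \<Rightarrow> 'a::scalar) set \<Rightarrow> nat \<Rightarrow> nat \<Rightarrow> 'a" where
  "moment d L i j = (let x = proj_rep L in (x i * conj (x j)) /\<^sub>R (vec_norm d x)\<^sup>2)"

lemma moment_line:
  assumes "x \<noteq> (\<lambda>i. 0 :: 'a::scalar)"
  shows "moment d (line x) i j = (x i * conj (x j)) /\<^sub>R (vec_norm d x)\<^sup>2"
proof -
  obtain c where c: "c \<noteq> 0" "proj_rep (line x) = (\<lambda>i. x i * c)"
    by (rule proj_rep_line [OF assms])
  have "(x i * c) * conj (x j * c) = x i * (c * conj c) * conj (x j)"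
    by (simp add: conj_mult mult.assoc)
  also have "\<dots> = (norm c)\<^sup>2 *\<^sub>R (x i * conj (x j))"
    by (simp add: mult_conj_self)
  finally show ?thesis
    using c by (simp add: moment_def vec_norm_scale power_mult_distrib)
qed

definition overlap :: "nat \<Rightarrow> (nat \<Rightarrow> 'a::scalar) set \<Rightarrow> (nat \<Rightarrow> 'a) set \<Rightarrow> real" where
  "overlap d L M = (cos (proj_dist d L M))\<^sup>2"

lemma overlap_line:
  assumes "x \<noteq> (\<lambda>i. 0)" "y \<noteq> (\<lambda>i. 0)"
  shows "overlap d (line x) (line y) = (norm (herm d x y) / (vec_norm d x * vec_norm d y))\<^sup>2"
proof -
  let ?q = "norm (herm d x y) / (vec_norm d x * vec_norm d y)"
  have "?q \<le> 1"
    using herm_Cauchy_Schwarz [of d x y] by (auto simp: divide_le_eq_1 less_le)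
  moreover have "- 1 \<le> ?q"
    by (rule order_trans [of _ 0]) simp_all
  ultimately show ?thesis
    unfolding overlap_def proj_dist_line [OF assms] by (subst cos_arccos) auto
qed

lemma overlap_nonneg [simp]: "0 \<le> overlap d L M"
  by (simp add: overlap_def)

lemma overlap_le_1 [simp]: "overlap d L M \<le> 1"
  by (simp add: overlap_def abs_square_le_1)

lemma kernel_overlap: "kernel d f L M = ext_one f (2 * overlap d L M - 1)"
  by (simp add: kernel_def overlap_def cos_double_cos)

text \<open>
  The overlap \<open>\<bar>\<langle>x, y\<rangle>\<bar>\<^sup>2\<close> is the Hilbert--Schmidt inner product of the two projections. For
  noncommuting scalars this rests on the cyclicity of the real part.
\<close>

lemma overlap_moment:
  fixes L M :: "(nat \<Rightarrow> 'a::scalar) set"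
  assumes "L \<in> proj_space d" "M \<in> proj_space d"
  shows "overlap d L M = (\<Sum>i<d. \<Sum>j<d. inner (moment d L i j) (moment d M i j))"
proof -
  obtain x where x: "vec_norm d x = 1" "L = line x" "x \<noteq> (\<lambda>i. 0)"
    by (rule proj_space_unit [OF assms(1)])
  obtain y where y: "vec_norm d y = 1" "M = line y" "y \<noteq> (\<lambda>i. 0)"
    by (rule proj_space_unit [OF assms(2)])
  let ?H = "herm d x y"
  have cyc: "inner (x i * conj (x j)) (y i * conj (y j)) = inner ((conj (y j) * x j) * (conj (x i) * y i)) 1"
    for i j
  proof -
    have "inner (x i * conj (x j)) (y i * conj (y j))
        = inner (conj (x i * conj (x j)) * (y i * conj (y j))) 1"
      by (rule inner_conj_mult [symmetric])
    also have "\<dots> = inner ((x j * (conj (x i) * y i)) * conj (y j)) 1"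
      by (simp add: conj_mult mult.assoc)
    also have "\<dots> = inner (conj (y j) * (x j * (conj (x i) * y i))) 1"
      by (rule inner_mult_commute)
    finally show ?thesis
      by (simp add: mult.assoc)
  qed
  have "(\<Sum>i<d. \<Sum>j<d. inner (moment d L i j) (moment d M i j))
      = (\<Sum>i<d. \<Sum>j<d. inner ((conj (y j) * x j) * (conj (x i) * y i)) 1)"
    using x y by (simp add: moment_line cyc)
  also have "\<dots> = inner ((\<Sum>j<d. conj (y j) * x j) * (\<Sum>i<d. conj (x i) * y i)) 1"
    unfolding sum_product by (subst sum.swap) (simp add: inner_sum_left)
  also have "\<dots> = inner (conj ?H * ?H) 1"
    by (simp add: conj_herm) (simp add: herm_def)
  also have "\<dots> = (norm ?H)\<^sup>2"
    by (simp add: inner_conj_mult power2_norm_eq_inner)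
  finally show ?thesis
    using x y by (simp add: overlap_line)
qed

lemma overlap_self: "L \<in> proj_space d \<Longrightarrow> overlap d L L = 1"
  using Metric_space.zero [OF Metric_space_proj_dist] by (metis overlap_def cos_zero power_one)

lemma openin_subset_proj_space:
  "{U. openin (Metric_space.mtopology (proj_space d) (proj_dist d)) U} \<subseteq>
    Pow (proj_space d :: (nat \<Rightarrow> 'a::scalar) set set)"
  using Metric_space.topspace_mtopology [OF Metric_space_proj_dist] openin_subset by fastforce

lemma space_proj_borel [simp]: "space (proj_borel d) = proj_space d"
  unfolding proj_borel_def by (rule space_measure_of [OF openin_subset_proj_space])

lemma sets_proj_borel_openin:
  "openin (Metric_space.mtopology (proj_space d) (proj_dist d)) U \<Longrightarrow> U \<in> sets (proj_borel d)"
  unfolding proj_borel_def sets_measure_of [OF openin_subset_proj_space]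
  by (rule sigma_sets.Basic) simp

text \<open>
  The Borel sets come from the topology of the geodesic distance, so Lipschitz functions are the
  most convenient supply of measurable ones.
\<close>

lemma Lipschitz_measurable:
  fixes F :: "(nat \<Rightarrow> 'a::scalar) set \<Rightarrow> real"
  assumes Lip: "\<And>L M. L \<in> proj_space d \<Longrightarrow> M \<in> proj_space d \<Longrightarrow> \<bar>F L - F M\<bar> \<le> 2 * proj_dist d L M"
  shows "F \<in> borel_measurable (proj_borel d)"
proof (rule borel_measurableI)
  fix S :: "real set"
  assume "open S"
  interpret Metric_space "proj_space d :: (nat \<Rightarrow> 'a) set set" "proj_dist d"
    by (rule Metric_space_proj_dist)
  have "openin mtopology (F -` S \<inter> proj_space d)"
    unfolding openin_mtopology
  proof safe
    fix L :: "(nat \<Rightarrow> 'a) set"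
    assume L: "L \<in> proj_space d" "F L \<in> S"
    then obtain e where e: "0 < e" "\<And>t. dist t (F L) < e \<Longrightarrow> t \<in> S"
      using \<open>open S\<close> by (metis open_dist)
    have "M \<in> F -` S \<inter> proj_space d" if "M \<in> mball L (e / 2)" for M
    proof -
      have M: "M \<in> proj_space d" "proj_dist d L M < e / 2"
        using that by auto
      have "\<bar>F M - F L\<bar> < e"
        using Lip [OF L(1) M(1)] M(2) by (simp add: abs_minus_commute)
      with e M show ?thesis
        by (simp add: dist_real_def)
    qed
    then show "\<exists>r>0. mball L r \<subseteq> F -` S \<inter> proj_space d"
      using e by (intro exI [of _ "e / 2"]) auto
  qed
  then show "F -` S \<inter> space (proj_borel d) \<in> sets (proj_borel d)"
    by (simp add: sets_proj_borel_openin)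
qed

text \<open>
  One entry is dominated by the full Hilbert--Schmidt norm of the difference of two projections,
  whose square is \<open>1 + 1 - 2 * overlap\<close>.
\<close>

lemma norm_moment_diff_le:
  fixes L M :: "(nat \<Rightarrow> 'a::scalar) set"
  assumes L: "L \<in> proj_space d" and M: "M \<in> proj_space d" and "i < d" "j < d"
  shows "(norm (moment d L i j - moment d M i j))\<^sup>2 \<le> 2 - 2 * overlap d L M"
proof -
  let ?D = "\<lambda>i j. moment d L i j - moment d M i j"
  have "(norm (?D i j))\<^sup>2 \<le> (\<Sum>j<d. (norm (?D i j))\<^sup>2)"
    using assms member_le_sum [of j "{..<d}" "\<lambda>j. (norm (?D i j))\<^sup>2"] by simp
  also have "\<dots> \<le> (\<Sum>i<d. \<Sum>j<d. (norm (?D i j))\<^sup>2)"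
    using assms member_le_sum [of i "{..<d}" "\<lambda>i. \<Sum>j<d. (norm (?D i j))\<^sup>2"] by (simp add: sum_nonneg)
  also have "\<dots> = overlap d L L + overlap d M M - 2 * overlap d L M"
    using L M by (simp add: overlap_moment power2_norm_eq_inner inner_diff_left inner_diff_right
        inner_commute sum_subtractf sum.distrib sum_distrib_left algebra_simps)
  finally show ?thesis
    using L M by (simp add: overlap_self)
qed

lemma measurable_moment:
  fixes b :: "'a::scalar"
  assumes "norm b = 1" "i < d" "j < d"
  shows "(\<lambda>L. inner (moment d L i j) b) \<in> borel_measurable (proj_borel d)"
proof (rule Lipschitz_measurable)
  fix L M :: "(nat \<Rightarrow> 'a) set"
  assume L: "L \<in> proj_space d" and M: "M \<in> proj_space d"
  let ?D = "moment d L i j - moment d M i j" and ?t = "proj_dist d L M"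
  have nn: "0 \<le> ?t"
    using Metric_space.nonneg [OF Metric_space_proj_dist] .
  have "(norm ?D)\<^sup>2 \<le> 2 - 2 * overlap d L M"
    by (rule norm_moment_diff_le [OF L M assms(2,3)])
  also have "\<dots> = 2 * (sin ?t)\<^sup>2"
    by (simp add: overlap_def sin_squared_eq)
  also have "\<dots> \<le> (2 * ?t)\<^sup>2"
  proof -
    have "(sin ?t)\<^sup>2 \<le> ?t\<^sup>2"
      using abs_sin_x_le_abs_x [of ?t] by (simp add: abs_le_square_iff)
    moreover have "(2 * ?t)\<^sup>2 = 2 * ?t\<^sup>2 + 2 * ?t\<^sup>2"
      by (simp add: power_mult_distrib)
    ultimately show ?thesis
      by (smt (verit) zero_le_power2)
  qed
  finally have "norm ?D \<le> 2 * ?t"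
    by (rule power2_le_imp_le) (use nn in simp)
  moreover have "\<bar>inner ?D b\<bar> \<le> norm ?D"
    using Cauchy_Schwarz_ineq2 [of ?D b] assms by simp
  ultimately show "\<bar>inner (moment d L i j) b - inner (moment d M i j) b\<bar> \<le> 2 * ?t"
    by (simp add: inner_diff_left)
qed

text \<open>
  The overlap is continuous in its second argument; convergence of the points is expressed by the
  overlap itself, because this is what an infimum over a set of lines provides.
\<close>

lemma overlap_tendsto:
  fixes L N :: "(nat \<Rightarrow> 'a::scalar) set"
  assumes L: "L \<in> proj_space d" and N: "N \<in> proj_space d" and M: "\<And>n. M n \<in> proj_space d"
    and lim: "(\<lambda>n. overlap d (M n) N) \<longlonglongrightarrow> 1"
  shows "(\<lambda>n. overlap d L (M n)) \<longlonglongrightarrow> overlap d L N"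
proof -
  have "(\<lambda>n. moment d (M n) i j) \<longlonglongrightarrow> moment d N i j" if "i < d" "j < d" for i j
  proof -
    have "(\<lambda>n. 2 - 2 * overlap d (M n) N) \<longlonglongrightarrow> 2 - 2 * 1"
      using lim by (intro tendsto_intros)
    then have bound: "(\<lambda>n. sqrt (2 - 2 * overlap d (M n) N)) \<longlonglongrightarrow> 0"
      using tendsto_real_sqrt by fastforce
    have "\<forall>n. norm (moment d (M n) i j - moment d N i j) \<le> sqrt (2 - 2 * overlap d (M n) N)"
      using norm_moment_diff_le [OF M N that] by (auto intro: real_le_rsqrt)
    then have "(\<lambda>n. moment d (M n) i j - moment d N i j) \<longlonglongrightarrow> 0"
      by (rule Lim_null_comparison [OF always_eventually bound])
    then show ?thesis
      by (rule LIM_zero_cancel)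
  qed
  then have "(\<lambda>n. \<Sum>i<d. \<Sum>j<d. inner (moment d L i j) (moment d (M n) i j)) \<longlonglongrightarrow>
      (\<Sum>i<d. \<Sum>j<d. inner (moment d L i j) (moment d N i j))"
    by (intro tendsto_sum tendsto_inner tendsto_const) auto
  then show ?thesis
    using L N M by (simp add: overlap_moment)
qed

section \<open>Signed measures\<close>

lemma space_parts [simp]:
  "space (pos_part X \<mu>) = space X" "space (neg_part X \<mu>) = space X"
  by (rule sets_eq_imp_space_eq, simp)+

text \<open>
  A set function that is real valued and countably additive is bounded. If the positive part of
  \<open>A\<close> is infinite, \<open>A\<close> splits into a subset of infinite positive part and a rest on which
  \<open>\<mu>\<close> has modulus at least 1. Iterating this yields disjoint sets whose measures do not
  tend to 0, contradicting the convergence of their sum.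
\<close>

lemma finite_pos_part:
  assumes \<mu>: "signed_measure X \<mu>"
  shows "finite_measure (pos_part X \<mu>)"
proof (rule finite_measureI, rule notI)
  let ?f = "emeasure (pos_part X \<mu>)"
  assume "?f (space (pos_part X \<mu>)) = \<infinity>"
  then have inf: "?f (space X) = \<infinity>"
    by simp
  have split: "\<exists>B. (B \<in> sets X \<and> ?f B = \<infinity>) \<and> B \<subseteq> A \<and> 1 \<le> \<bar>\<mu> (A - B)\<bar>"
    if A: "A \<in> sets X" "?f A = \<infinity>" for A
  proof -
    have "ennreal (\<bar>\<mu> A\<bar> + 1) < (SUP B\<in>{B\<in>sets X. B \<subseteq> A}. ennreal (\<mu> B))"
      unfolding emeasure_pos_part [OF \<mu> A(1), symmetric] A(2) infinity_ennreal_def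
      by (rule ennreal_less_top)
    then obtain C where C: "C \<in> sets X" "C \<subseteq> A" "ennreal (\<bar>\<mu> A\<bar> + 1) < ennreal (\<mu> C)"
      unfolding less_SUP_iff by auto
    then have C1: "\<bar>\<mu> A\<bar> + 1 < \<mu> C"
      by (subst (asm) ennreal_less_iff) simp_all
    have eq: "\<mu> A = \<mu> C + \<mu> (A - C)"
      using signed_measure_Un [OF \<mu> C(1), of "A - C"] A C by (simp add: Un_absorb1 sets.Diff)
    have "?f C + ?f (A - C) = ?f A"
      using plus_emeasure [of C "pos_part X \<mu>" "A - C"] A C by (simp add: Un_absorb1 sets.Diff)
    then consider "?f C = \<infinity>" | "?f (A - C) = \<infinity>"
      using A(2) by (auto simp: ennreal_add_eq_top)
    then show ?thesis
    proof cases
      case 1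
      then show ?thesis
        using C C1 eq by (intro exI [of _ C]) auto
    next
      case 2
      moreover have "A - (A - C) = C"
        using C by blast
      ultimately show ?thesis
        using A C C1 by (intro exI [of _ "A - C"]) (auto simp: sets.Diff)
    qed
  qed
  obtain B where B: "\<And>n. B n \<in> sets X \<and> ?f (B n) = \<infinity>"
      "\<And>n. B (Suc n) \<subseteq> B n \<and> 1 \<le> \<bar>\<mu> (B n - B (Suc n))\<bar>"
    using dependent_nat_choice [of "\<lambda>_ A. A \<in> sets X \<and> ?f A = \<infinity>" "\<lambda>_ A B. B \<subseteq> A \<and> 1 \<le> \<bar>\<mu> (A - B)\<bar>"]
      inf split by (metis sets.top)
  let ?D = "\<lambda>n. B n - B (Suc n)"
  have dec: "B n \<subseteq> B m" if "m \<le> n" for m n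
    by (rule lift_Suc_antimono_le [of B]) (use B(2) that in auto)
  have disj: "?D m \<inter> ?D n = {}" if "m < n" for m n
    using dec [of "Suc m" n] that by auto
  have "disjoint_family ?D"
    unfolding disjoint_family_on_def
  proof (intro ballI impI)
    fix m n :: nat
    assume "m \<noteq> n"
    then show "?D m \<inter> ?D n = {}"
      using disj [of m n] disj [of n m] by (cases "m < n") (simp_all add: Int_commute)
  qed
  moreover have "range ?D \<subseteq> sets X"
    using B(1) by (blast intro: sets.Diff)
  ultimately have "(\<lambda>n. \<mu> (?D n)) sums \<mu> (\<Union>n. ?D n)"
    using \<mu> by (simp add: signed_measure_def)
  then have "(\<lambda>n. \<bar>\<mu> (?D n)\<bar>) \<longlonglongrightarrow> 0"
    by (intro tendsto_rabs_zero summable_LIMSEQ_zero sums_summable)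
  then have "\<forall>\<^sub>F n in sequentially. \<bar>\<mu> (?D n)\<bar> < 1"
    by (rule order_tendstoD) simp
  then obtain n where "\<bar>\<mu> (?D n)\<bar> < 1"
    by (auto simp: eventually_sequentially)
  then show False
    using B(2) [of n] by simp
qed

lemma signed_measure_diff:
  assumes P: "finite_measure P" "sets P = sets X" and N: "finite_measure N" "sets N = sets X"
  shows "signed_measure X (\<lambda>A. measure P A - measure N A)"
  unfolding signed_measure_def
proof safe
  fix A :: "nat \<Rightarrow> 'a set"
  assume "range A \<subseteq> sets X" "disjoint_family A"
  then show "(\<lambda>n. measure P (A n) - measure N (A n)) sums (measure P (\<Union>n. A n) - measure N (\<Union>n. A n))"
    using assms by (intro sums_diff finite_measure.finite_measure_UNION) auto
qed

text \<open>
  If two finite measures live on complementary sets, they are the Jordan decomposition of their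
  difference: the supremum in the definition of \<open>pos_part\<close> is attained at \<open>A \<inter> S\<close>.
\<close>

lemma pos_part_diff:
  assumes P: "finite_measure P" "sets P = sets X" and N: "finite_measure N" "sets N = sets X"
    and S: "S \<in> sets X" "emeasure N S = 0" "emeasure P (space X - S) = 0"
  shows "pos_part X (\<lambda>A. measure P A - measure N A) = P"
proof (rule measure_eqI)
  fix A
  assume "A \<in> sets (pos_part X (\<lambda>A. measure P A - measure N A))"
  then have A: "A \<in> sets X"
    by simp
  have le: "ennreal (measure P B - measure N B) \<le> emeasure P A" if "B \<in> sets X" "B \<subseteq> A" for B
  proof -
    have "ennreal (measure P B - measure N B) \<le> ennreal (measure P B)"
      by (intro ennreal_leI) simp
    also have "\<dots> = emeasure P B"
      by (rule finite_measure.emeasure_eq_measure [OF P(1), symmetric])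
    also have "\<dots> \<le> emeasure P A"
      using that A P by (intro emeasure_mono) auto
    finally show ?thesis .
  qed
  have "emeasure N (A \<inter> S) = 0"
    using S A N emeasure_mono [of "A \<inter> S" S N] by auto
  moreover have "emeasure P (A \<inter> S) = emeasure P A"
  proof -
    have "emeasure P (A - S) = 0"
      using S A P emeasure_mono [of "A - S" "space X - S" P] sets.sets_into_space [OF A] by auto
    moreover have "emeasure P (A \<inter> S) + emeasure P (A - S) = emeasure P (A \<inter> S \<union> (A - S))"
      using A S P by (intro plus_emeasure) auto
    moreover have "A \<inter> S \<union> (A - S) = A"
      by blast
    ultimately show ?thesis
      by simp
  qed
  ultimately have "ennreal (measure P (A \<inter> S) - measure N (A \<inter> S)) = emeasure P A"
    using finite_measure.emeasure_eq_measure [OF P(1), of "A \<inter> S"]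
      finite_measure.emeasure_eq_measure [OF N(1), of "A \<inter> S"] by simp
  then have "emeasure P A \<le> (SUP B\<in>{B\<in>sets X. B \<subseteq> A}. ennreal (measure P B - measure N B))"
    using A S by (intro SUP_upper2 [of "A \<inter> S"]) auto
  moreover have "(SUP B\<in>{B\<in>sets X. B \<subseteq> A}. ennreal (measure P B - measure N B)) \<le> emeasure P A"
    using le by (intro SUP_least) auto
  ultimately show "emeasure (pos_part X (\<lambda>A. measure P A - measure N A)) A = emeasure P A"
    using emeasure_pos_part [OF signed_measure_diff [OF P N] A] by simp
qed (use P in simp)

text \<open>
  The pointwise identity behind the four terms of \<open>dbl_integral_pos\<close>.
\<close>

lemma ennreal_parts_mult:
  fixes a b k :: real
  shows "ennreal (a * b * k) =
    ennreal a * ennreal b * ennreal k + ennreal (- a) * ennreal (- b) * ennreal k +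
    ennreal a * ennreal (- b) * ennreal (- k) + ennreal (- a) * ennreal b * ennreal (- k)"
proof -
  have pos: "ennreal (a * b * k) = ennreal a * ennreal b * ennreal k" if "0 \<le> a" "0 \<le> b" for a b k :: real
    using that by (simp add: ennreal_mult')
  consider "0 \<le> a" "0 \<le> b" | "0 \<le> a" "b \<le> 0" | "a \<le> 0" "0 \<le> b" | "a \<le> 0" "b \<le> 0"
    by linarith
  then show ?thesis
    using pos [of a b k] pos [of a "- b" "- k"] pos [of "- a" b "- k"] pos [of "- a" "- b" k]
    by cases (simp_all add: ennreal_neg)
qed

text \<open>
  The signed measure with density \<open>h\<close> with respect to a finite measure \<open>\<nu>\<close>. Its double integral
  reduces to one Bochner integral, which is how positive definiteness is tested later.
\<close>

locale signed_density =
  fixes X \<nu> :: "'p measure" and h :: "'p \<Rightarrow> real"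
  assumes finite_\<nu>: "finite_measure \<nu>" and sets_\<nu> [measurable_cong]: "sets \<nu> = sets X"
    and h_measurable [measurable]: "h \<in> borel_measurable X" and h_le: "\<And>x. \<bar>h x\<bar> \<le> 1"
begin

sublocale finite_measure \<nu>
  by (rule finite_\<nu>)

definition "pos_density = density \<nu> (\<lambda>x. ennreal (h x))"
definition "neg_density = density \<nu> (\<lambda>x. ennreal (- h x))"
definition "charge A = measure pos_density A - measure neg_density A"

lemma finite_density:
  assumes [measurable]: "g \<in> borel_measurable X" and le: "\<And>x. g x \<le> (1::real)"
  shows "finite_measure (density \<nu> (\<lambda>x. ennreal (g x)))"
proof (rule finite_measureI)
  have "emeasure (density \<nu> (\<lambda>x. ennreal (g x))) (space \<nu>) = (\<integral>\<^sup>+x. ennreal (g x) * indicator (space \<nu>) x \<partial>\<nu>)"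
    by (subst emeasure_density) auto
  also have "\<dots> \<le> (\<integral>\<^sup>+x. indicator (space \<nu>) x \<partial>\<nu>)"
    using le by (intro nn_integral_mono) (auto split: split_indicator intro: ennreal_le_1 [THEN iffD2])
  also have "\<dots> < \<infinity>"
    using emeasure_finite [of "space \<nu>"] by (simp flip: less_top)
  finally show "emeasure (density \<nu> (\<lambda>x. ennreal (g x))) (space (density \<nu> (\<lambda>x. ennreal (g x)))) \<noteq> \<infinity>"
    by simp
qed

lemma finite_pos_density: "finite_measure pos_density" and finite_neg_density: "finite_measure neg_density"
proof -
  have "h x \<le> 1" "- h x \<le> 1" for x
    using h_le [of x] by auto
  then show "finite_measure pos_density" "finite_measure neg_density"
    unfolding pos_density_def neg_density_def by (auto intro!: finite_density)
qed

lemma sets_pos_density [simp]: "sets pos_density = sets X" and sets_neg_density [simp]: "sets neg_density = sets X"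
  by (simp_all add: pos_density_def neg_density_def sets_\<nu>)

lemma signed_charge: "signed_measure X charge"
  unfolding charge_def by (intro signed_measure_diff finite_pos_density finite_neg_density) simp_all

lemma pos_part_charge: "pos_part X charge = pos_density" and neg_part_charge: "neg_part X charge = neg_density"
proof -
  define S where "S = {x\<in>space X. 0 \<le> h x}"
  have S: "S \<in> sets X"
    unfolding S_def by measurable
  have N0: "emeasure neg_density S = 0"
    unfolding neg_density_def using S
    by (subst emeasure_density)
      (auto simp: sets_\<nu> nn_integral_0_iff_AE S_def ennreal_neg split: split_indicator)
  have P0: "emeasure pos_density (space X - S) = 0"
    unfolding pos_density_def using S
    by (subst emeasure_density)
      (auto simp: sets_\<nu> nn_integral_0_iff_AE S_def ennreal_neg split: split_indicator)
  show "pos_part X charge = pos_density"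
    unfolding charge_def using S N0 P0 by (intro pos_part_diff [of _ _ _ S] finite_pos_density finite_neg_density) auto
  have "- charge A = measure neg_density A - measure pos_density A" for A
    by (simp add: charge_def)
  moreover have "space X - (space X - S) = S"
    using sets.sets_into_space [OF S] by blast
  ultimately show "neg_part X charge = neg_density"
    unfolding neg_part_def using S N0 P0
    by simp (intro pos_part_diff [of _ _ _ "space X - S"] finite_pos_density finite_neg_density; auto)
qed

lemma total_variation_charge: "total_variation X charge = density \<nu> (\<lambda>x. ennreal \<bar>h x\<bar>)"
proof (rule measure_eqI)
  fix A
  assume "A \<in> sets (total_variation X charge)"
  then have A [measurable]: "A \<in> sets X"
    by simp
  have "emeasure (total_variation X charge) A =
      (\<integral>\<^sup>+x. ennreal (h x) * indicator A x \<partial>\<nu>) + (\<integral>\<^sup>+x. ennreal (- h x) * indicator A x \<partial>\<nu>)"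
    using A unfolding emeasure_total_variation [OF A] pos_part_charge neg_part_charge
    by (simp add: pos_density_def neg_density_def emeasure_density sets_\<nu>)
  also have "\<dots> = (\<integral>\<^sup>+x. ennreal \<bar>h x\<bar> * indicator A x \<partial>\<nu>)"
    by (subst nn_integral_add [symmetric])
      (auto intro!: nn_integral_cong simp: abs_if ennreal_neg split: split_indicator)
  finally show "emeasure (total_variation X charge) A = emeasure (density \<nu> (\<lambda>x. ennreal \<bar>h x\<bar>)) A"
    using A by (simp add: emeasure_density sets_\<nu>)
qed (simp add: sets_\<nu>)

text \<open>
  As \<open>\<bar>h\<bar> \<le> 1\<close>, the admissibility condition in \<open>positive_definite\<close> may be checked against
  \<open>\<nu>\<close>.
\<close>

lemma in_L1_charge:
  assumes "in_L1 \<nu> g"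
  shows "in_L1 (total_variation X charge) g"
proof -
  have [measurable]: "g \<in> borel_measurable \<nu>" and fin: "(\<integral>\<^sup>+x. e2ennreal \<bar>g x\<bar> \<partial>\<nu>) < \<infinity>"
    using assms by (auto simp: in_L1_def)
  have "(\<integral>\<^sup>+x. e2ennreal \<bar>g x\<bar> \<partial>total_variation X charge) = (\<integral>\<^sup>+x. ennreal \<bar>h x\<bar> * e2ennreal \<bar>g x\<bar> \<partial>\<nu>)"
    unfolding total_variation_charge by (rule nn_integral_density) measurable
  also have "\<dots> \<le> (\<integral>\<^sup>+x. 1 * e2ennreal \<bar>g x\<bar> \<partial>\<nu>)"
    using h_le by (intro nn_integral_mono mult_right_mono) auto
  finally have "(\<integral>\<^sup>+x. e2ennreal \<bar>g x\<bar> \<partial>total_variation X charge) < \<infinity>"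
    using fin by (simp add: order_le_less_trans)
  then show ?thesis
    by (simp add: in_L1_def total_variation_charge)
qed

text \<open>
  The extended real kernel may differ from a real function on a null set of the product; this is where
  the infinite values on the diagonal disappear.
\<close>

lemma dbl_integral_pos_charge:
  assumes K [measurable]: "(\<lambda>(x, y). K x y) \<in> borel_measurable (X \<Otimes>\<^sub>M X)"
    and k [measurable]: "(\<lambda>(x, y). k x y) \<in> borel_measurable (X \<Otimes>\<^sub>M X)"
    and eq: "AE (x, y) in \<nu> \<Otimes>\<^sub>M \<nu>. K x y = ereal (k x y)"
  shows "dbl_integral_pos X charge K = (\<integral>\<^sup>+(x, y). ennreal (h x * h y * k x y) \<partial>(\<nu> \<Otimes>\<^sub>M \<nu>))"
proof -
  have pair: "(\<integral>\<^sup>+(x, y). e2ennreal (L x y) \<partial>(density \<nu> (\<lambda>x. ennreal (a x)) \<Otimes>\<^sub>M density \<nu> (\<lambda>x. ennreal (b x)))) =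
      (\<integral>\<^sup>+(x, y). ennreal (a x) * ennreal (b y) * e2ennreal (L x y) \<partial>(\<nu> \<Otimes>\<^sub>M \<nu>))"
    if [measurable]: "a \<in> borel_measurable X" "b \<in> borel_measurable X" "(\<lambda>(x, y). L x y) \<in> borel_measurable (X \<Otimes>\<^sub>M X)"
      and b: "\<And>x. b x \<le> 1"
    for a b :: "'p \<Rightarrow> real" and L
  proof -
    have "sigma_finite_measure (density \<nu> (\<lambda>x. ennreal (b x)))"
      using finite_density [of b] b that by (simp add: finite_measure_def)
    moreover have "sigma_finite_measure \<nu>"
      using finite_\<nu> by (simp add: finite_measure_def)
    ultimately show ?thesis
      by (subst pair_measure_density)
        (auto simp: nn_integral_density split_beta')
  qed
  have h1: "h x \<le> 1" "- h x \<le> 1" for x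
    using h_le [of x] by auto
  have "dbl_integral_pos X charge K =
     (\<integral>\<^sup>+(x, y). ennreal (h x) * ennreal (h y) * e2ennreal (K x y) \<partial>(\<nu> \<Otimes>\<^sub>M \<nu>)) +
     (\<integral>\<^sup>+(x, y). ennreal (- h x) * ennreal (- h y) * e2ennreal (K x y) \<partial>(\<nu> \<Otimes>\<^sub>M \<nu>)) +
     (\<integral>\<^sup>+(x, y). ennreal (h x) * ennreal (- h y) * e2ennreal (- K x y) \<partial>(\<nu> \<Otimes>\<^sub>M \<nu>)) +
     (\<integral>\<^sup>+(x, y). ennreal (- h x) * ennreal (h y) * e2ennreal (- K x y) \<partial>(\<nu> \<Otimes>\<^sub>M \<nu>))"
    unfolding dbl_integral_pos_def pos_part_charge neg_part_charge pos_density_def neg_density_def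
    by (intro arg_cong2 [where f = "(+)"] pair h1) (measurable; simp)+
  also have "\<dots> = (\<integral>\<^sup>+(x, y). (ennreal (h x) * ennreal (h y) * e2ennreal (K x y) +
     ennreal (- h x) * ennreal (- h y) * e2ennreal (K x y) +
     ennreal (h x) * ennreal (- h y) * e2ennreal (- K x y) +
     ennreal (- h x) * ennreal (h y) * e2ennreal (- K x y)) \<partial>(\<nu> \<Otimes>\<^sub>M \<nu>))"
    by (simp add: split_beta' nn_integral_add)
  also have "\<dots> = (\<integral>\<^sup>+(x, y). ennreal (h x * h y * k x y) \<partial>(\<nu> \<Otimes>\<^sub>M \<nu>))"
  proof (intro nn_integral_cong_AE, use eq in eventually_elim, clarify)
    fix x y
    assume "K x y = ereal (k x y)"
    then show "ennreal (h x) * ennreal (h y) * e2ennreal (K x y) +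
     ennreal (- h x) * ennreal (- h y) * e2ennreal (K x y) +
     ennreal (h x) * ennreal (- h y) * e2ennreal (- K x y) +
     ennreal (- h x) * ennreal (h y) * e2ennreal (- K x y) = ennreal (h x * h y * k x y)"
      by (simp add: ennreal_parts_mult)
  qed
  finally show ?thesis .
qed

lemma dbl_integral_charge:
  assumes K [measurable]: "(\<lambda>(x, y). K x y) \<in> borel_measurable (X \<Otimes>\<^sub>M X)"
    and k [measurable]: "(\<lambda>(x, y). k x y) \<in> borel_measurable (X \<Otimes>\<^sub>M X)"
    and eq: "AE (x, y) in \<nu> \<Otimes>\<^sub>M \<nu>. K x y = ereal (k x y)"
    and int: "integrable (\<nu> \<Otimes>\<^sub>M \<nu>) (\<lambda>(x, y). k x y)"
  shows "dbl_integral X charge K = ereal (\<integral>(x, y). h x * h y * k x y \<partial>(\<nu> \<Otimes>\<^sub>M \<nu>))"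
proof -
  let ?F = "\<lambda>(x, y). h x * h y * k x y"
  have F: "integrable (\<nu> \<Otimes>\<^sub>M \<nu>) ?F"
  proof (rule Bochner_Integration.integrable_bound [OF int])
    have "\<bar>h x * h y * k x y\<bar> \<le> \<bar>k x y\<bar>" for x y
      using h_le [of x] h_le [of y] by (simp add: abs_mult mult_le_one mult_left_le_one_le)
    then show "AE z in \<nu> \<Otimes>\<^sub>M \<nu>. norm (?F z) \<le> norm ((\<lambda>(x, y). k x y) z)"
      by (intro AE_I2) (auto split: prod.split)
  qed measurable
  have "dbl_integral_pos X charge K = (\<integral>\<^sup>+z. ennreal (?F z) \<partial>(\<nu> \<Otimes>\<^sub>M \<nu>))"
    by (subst dbl_integral_pos_charge [OF K k eq]) (simp add: split_beta')
  moreover have "dbl_integral_pos X charge (\<lambda>x y. - K x y) = (\<integral>\<^sup>+z. ennreal (- ?F z) \<partial>(\<nu> \<Otimes>\<^sub>M \<nu>))"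
    by (subst dbl_integral_pos_charge [of _ "\<lambda>x y. - k x y"]) (use eq in \<open>auto simp: split_beta'\<close>)
  moreover obtain r q where "0 \<le> r" "0 \<le> q"
     "(\<integral>\<^sup>+z. ennreal (?F z) \<partial>(\<nu> \<Otimes>\<^sub>M \<nu>)) = ennreal r" "(\<integral>\<^sup>+z. ennreal (- ?F z) \<partial>(\<nu> \<Otimes>\<^sub>M \<nu>)) = ennreal q"
     "(\<integral>z. ?F z \<partial>(\<nu> \<Otimes>\<^sub>M \<nu>)) = r - q"
    using F by (rule integrableE)
  ultimately show ?thesis
    by (simp add: dbl_integral_def)
qed

end

section \<open>Power series are positive definite\<close>

text \<open>
  Powers of the overlap are inner products of tensor powers of the projections: a word \<open>w\<close> of length
  \<open>n\<close> selects one real coordinate of \<open>x x\<^sup>*\<close> for each tensor factor, and distributivity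
  turns the power of a sum into a sum over words.
\<close>

lemma overlap_power_features:
  fixes d n :: nat
  obtains W :: "(nat \<Rightarrow> nat \<times> nat \<times> 'a::scalar) set" and \<psi> :: "_ \<Rightarrow> (nat \<Rightarrow> 'a) set \<Rightarrow> real"
  where "finite W" "\<And>w. w \<in> W \<Longrightarrow> \<psi> w \<in> borel_measurable (proj_borel d)"
    "\<And>w L. w \<in> W \<Longrightarrow> L \<in> proj_space d \<Longrightarrow> \<bar>\<psi> w L\<bar> \<le> 1"
    "\<And>L M. L \<in> proj_space d \<Longrightarrow> M \<in> proj_space d \<Longrightarrow>
      overlap d L M ^ n = (\<Sum>w\<in>W. \<psi> w L * \<psi> w M)"
proof -
  define I where "I = {..<d} \<times> {..<d} \<times> (Basis :: 'a set)"
  define \<phi> where "\<phi> = (\<lambda>(i, j, b) (L :: (nat \<Rightarrow> 'a) set). inner (moment d L i j) b)"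
  have I: "finite I"
    by (simp add: I_def)
  have overlap: "overlap d L M = (\<Sum>k\<in>I. \<phi> k L * \<phi> k M)"
    if "L \<in> proj_space d" "M \<in> proj_space d" for L M
  proof -
    have "overlap d L M = (\<Sum>i<d. \<Sum>j<d. \<Sum>b\<in>Basis. \<phi> (i, j, b) L * \<phi> (i, j, b) M)"
      unfolding overlap_moment [OF that] \<phi>_def prod.case by (intro sum.cong refl euclidean_inner)
    then show ?thesis
      by (simp add: I_def sum.cartesian_product split_beta')
  qed
  have \<phi>_meas: "\<phi> k \<in> borel_measurable (proj_borel d)" if "k \<in> I" for k
    using that by (auto simp: I_def \<phi>_def intro!: measurable_moment)
  have \<phi>_le: "\<bar>\<phi> k L\<bar> \<le> 1" if "k \<in> I" "L \<in> proj_space d" for k L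
  proof -
    have "\<phi> k L * \<phi> k L \<le> (\<Sum>k\<in>I. \<phi> k L * \<phi> k L)"
      using that I by (intro member_le_sum) auto
    also have "\<dots> = overlap d L L"
      by (rule overlap [symmetric]) (use that in auto)
    also have "\<dots> = 1"
      using that by (simp add: overlap_self)
    finally show ?thesis
      using abs_square_le_1 [of "\<phi> k L"] by (simp add: power2_eq_square)
  qed
  let ?W = "PiE {..<n} (\<lambda>_. I)" and ?\<psi> = "\<lambda>w L. \<Prod>k<n. \<phi> (w k) L"
  show thesis
  proof
    show "finite ?W"
      using I by (intro finite_PiE) auto
    show "?\<psi> w \<in> borel_measurable (proj_borel d)" if "w \<in> ?W" for w
      using that by (intro borel_measurable_prod \<phi>_meas) auto
    show "\<bar>?\<psi> w L\<bar> \<le> 1" if "w \<in> ?W" "L \<in> proj_space d" for w L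
      unfolding abs_prod
    proof (rule prod_le_1)
      fix k
      assume "k \<in> {..<n}"
      then have "w k \<in> I"
        using that(1) by blast
      then show "0 \<le> \<bar>\<phi> (w k) L\<bar> \<and> \<bar>\<phi> (w k) L\<bar> \<le> 1"
        using \<phi>_le [OF _ that(2)] by simp
    qed
    show "overlap d L M ^ n = (\<Sum>w\<in>?W. ?\<psi> w L * ?\<psi> w M)"
      if "L \<in> proj_space d" "M \<in> proj_space d" for L M
    proof -
      have "overlap d L M ^ n = (\<Prod>k<n. \<Sum>i\<in>I. \<phi> i L * \<phi> i M)"
        using that by (simp add: overlap)
      also have "\<dots> = (\<Sum>w\<in>?W. \<Prod>k<n. \<phi> (w k) L * \<phi> (w k) M)"
        using I by (intro prod_sum_PiE) auto
      finally show ?thesis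
        by (simp add: prod.distrib)
    qed
  qed
qed

lemma measurable_overlap [measurable]:
  "(\<lambda>(L, M). overlap d L M) \<in> borel_measurable (proj_borel d \<Otimes>\<^sub>M proj_borel d :: ((nat \<Rightarrow> 'a::scalar) set \<times> _) measure)"
proof -
  obtain W :: "(nat \<Rightarrow> nat \<times> nat \<times> 'a::scalar) set" and \<psi> :: "_ \<Rightarrow> (nat \<Rightarrow> 'a) set \<Rightarrow> real"
    where W: "finite W" "\<And>w. w \<in> W \<Longrightarrow> \<psi> w \<in> borel_measurable (proj_borel d)"
    and eq: "\<And>L M. L \<in> proj_space d \<Longrightarrow> M \<in> proj_space d \<Longrightarrow>
      overlap d L M ^ 1 = (\<Sum>w\<in>W. \<psi> w L * \<psi> w M)"
    by (rule overlap_power_features [of d 1]) blast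
  have "(\<lambda>z. \<Sum>w\<in>W. \<psi> w (fst z) * \<psi> w (snd z)) \<in> borel_measurable (proj_borel d \<Otimes>\<^sub>M proj_borel d)"
  proof (rule borel_measurable_sum)
    fix w assume "w \<in> W"
    then have [measurable]: "\<psi> w \<in> borel_measurable (proj_borel d)"
      by (rule W)
    show "(\<lambda>z. \<psi> w (fst z) * \<psi> w (snd z)) \<in> borel_measurable (proj_borel d \<Otimes>\<^sub>M proj_borel d)"
      by measurable
  qed
  also have "?this \<longleftrightarrow> ?thesis"
    by (intro measurable_cong) (auto simp: space_pair_measure simp flip: eq)
  finally show ?thesis .
qed

text \<open>
  With \<open>p\<close> and \<open>q\<close> the integrals of a feature \<open>\<psi> w\<close> against the two measures, this is
  \<open>2 * p * q \<le> p\<^sup>2 + q\<^sup>2\<close>, summed over the words \<open>w\<close>.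
\<close>

lemma nn_integral_overlap_power:
  fixes P N :: "(nat \<Rightarrow> 'a::scalar) set measure"
  assumes P: "finite_measure P" "sets P = sets (proj_borel d)"
    and N: "finite_measure N" "sets N = sets (proj_borel d)"
  shows "(\<integral>\<^sup>+(L, M). ennreal (overlap d L M ^ n) \<partial>(P \<Otimes>\<^sub>M N)) +
    (\<integral>\<^sup>+(L, M). ennreal (overlap d L M ^ n) \<partial>(N \<Otimes>\<^sub>M P)) \<le>
    (\<integral>\<^sup>+(L, M). ennreal (overlap d L M ^ n) \<partial>(P \<Otimes>\<^sub>M P)) +
    (\<integral>\<^sup>+(L, M). ennreal (overlap d L M ^ n) \<partial>(N \<Otimes>\<^sub>M N))"
proof -
  define J where "J A B = (\<integral>\<^sup>+(L, M). ennreal (overlap d L M ^ n) \<partial>(A \<Otimes>\<^sub>M B))"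
    for A B :: "(nat \<Rightarrow> 'a) set measure"
  obtain W :: "(nat \<Rightarrow> nat \<times> nat \<times> 'a::scalar) set" and \<psi> :: "_ \<Rightarrow> (nat \<Rightarrow> 'a) set \<Rightarrow> real"
    where W: "finite W" "\<And>w. w \<in> W \<Longrightarrow> \<psi> w \<in> borel_measurable (proj_borel d)"
      "\<And>w L. w \<in> W \<Longrightarrow> L \<in> proj_space d \<Longrightarrow> \<bar>\<psi> w L\<bar> \<le> 1"
    and eq: "\<And>L M. L \<in> proj_space d \<Longrightarrow> M \<in> proj_space d \<Longrightarrow>
      overlap d L M ^ n = (\<Sum>w\<in>W. \<psi> w L * \<psi> w M)"
    by (rule overlap_power_features [of d n]) blast
  have J: "J A B = ennreal (\<Sum>w\<in>W. (\<integral>L. \<psi> w L \<partial>A) * (\<integral>M. \<psi> w M \<partial>B))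
      \<and> 0 \<le> (\<Sum>w\<in>W. (\<integral>L. \<psi> w L \<partial>A) * (\<integral>M. \<psi> w M \<partial>B))"
    if A: "finite_measure A" "sets A = sets (proj_borel d)"
      and B: "finite_measure B" "sets B = sets (proj_borel d)" for A B
  proof -
    interpret A: finite_measure A by (rule A)
    interpret B: finite_measure B by (rule B)
    interpret AB: pair_sigma_finite A B ..
    interpret ABf: finite_measure "A \<Otimes>\<^sub>M B"
      by (intro finite_measure_pair_measure A B)
    have [measurable_cong]: "sets A = sets (proj_borel d)" "sets B = sets (proj_borel d)"
      by (fact A B)+
    have sp: "space A = proj_space d" "space B = proj_space d"
      using sets_eq_imp_space_eq [OF A(2)] sets_eq_imp_space_eq [OF B(2)] by simp_all
    have int: "integrable (A \<Otimes>\<^sub>M B) (\<lambda>z. \<psi> w (fst z) * \<psi> w (snd z))" if w: "w \<in> W" for w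
    proof (rule ABf.integrable_const_bound [where B = 1])
      have [measurable]: "\<psi> w \<in> borel_measurable (proj_borel d)"
        using W w by blast
      show "(\<lambda>z. \<psi> w (fst z) * \<psi> w (snd z)) \<in> borel_measurable (A \<Otimes>\<^sub>M B)"
        by measurable
      have "\<bar>\<psi> w L * \<psi> w M\<bar> \<le> 1" if "L \<in> proj_space d" "M \<in> proj_space d" for L M
        using W(3) [OF w that(1)] W(3) [OF w that(2)] by (simp add: abs_mult mult_le_one)
      then show "AE z in A \<Otimes>\<^sub>M B. norm (\<psi> w (fst z) * \<psi> w (snd z)) \<le> 1"
        by (intro AE_I2) (auto simp: space_pair_measure sp)
    qed
    have "(\<integral>z. \<psi> w (fst z) * \<psi> w (snd z) \<partial>(A \<Otimes>\<^sub>M B)) = (\<integral>L. \<psi> w L \<partial>A) * (\<integral>M. \<psi> w M \<partial>B)" if "w \<in> W" for w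
      using AB.integral_fst [of "\<lambda>x y. \<psi> w x * \<psi> w y"] int [OF that] by (simp add: split_beta')
    then have "(\<integral>z. (\<Sum>w\<in>W. \<psi> w (fst z) * \<psi> w (snd z)) \<partial>(A \<Otimes>\<^sub>M B))
        = (\<Sum>w\<in>W. (\<integral>L. \<psi> w L \<partial>A) * (\<integral>M. \<psi> w M \<partial>B))"
      by (simp add: int)
    moreover have "J A B = (\<integral>\<^sup>+z. ennreal (\<Sum>w\<in>W. \<psi> w (fst z) * \<psi> w (snd z)) \<partial>(A \<Otimes>\<^sub>M B))"
      unfolding J_def by (intro nn_integral_cong) (auto simp: space_pair_measure sp eq)
    moreover have nn: "AE z in A \<Otimes>\<^sub>M B. 0 \<le> (\<Sum>w\<in>W. \<psi> w (fst z) * \<psi> w (snd z))"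
      by (intro AE_I2) (auto simp: space_pair_measure sp simp flip: eq)
    ultimately show ?thesis
      using integral_nonneg_AE [OF nn] int by (simp add: nn_integral_eq_integral [OF _ nn])
  qed
  let ?p = "\<lambda>w. \<integral>L. \<psi> w L \<partial>P" and ?q = "\<lambda>w. \<integral>L. \<psi> w L \<partial>N"
  have "(\<Sum>w\<in>W. ?p w * ?q w) + (\<Sum>w\<in>W. ?q w * ?p w) \<le> (\<Sum>w\<in>W. ?p w * ?p w) + (\<Sum>w\<in>W. ?q w * ?q w)"
    unfolding sum.distrib [symmetric]
  proof (rule sum_mono)
    fix w
    have "0 \<le> (?p w - ?q w)\<^sup>2"
      by simp
    then show "?p w * ?q w + ?q w * ?p w \<le> ?p w * ?p w + ?q w * ?q w"
      by (simp add: power2_eq_square algebra_simps)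
  qed
  then show ?thesis
    using J [OF P P] J [OF P N] J [OF N P] J [OF N N] unfolding J_def [symmetric]
    by (simp flip: ennreal_plus)
qed

lemma cosine_series_iff:
  "(\<forall>\<theta>\<in>{0<..pi / 2}. (\<lambda>n. a n * cos \<theta> ^ (2 * n)) sums f (cos (2 * \<theta>))) \<longleftrightarrow>
   (\<forall>u. 0 \<le> u \<longrightarrow> u < 1 \<longrightarrow> (\<lambda>n. a n * u ^ n) sums f (2 * u - 1))" (is "?L \<longleftrightarrow> ?R")
proof
  assume L: ?L
  show ?R
  proof (intro allI impI)
    fix u :: real
    assume u: "0 \<le> u" "u < 1"
    let ?\<theta> = "arccos (sqrt u)"
    have s: "0 \<le> sqrt u" "- 1 \<le> sqrt u" "sqrt u < 1"
      using u by (auto intro: order_trans [of _ 0])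
    then have "cos ?\<theta> = sqrt u"
      by (intro cos_arccos) auto
    moreover have "?\<theta> \<in> {0<..pi / 2}"
      using arccos_less_arccos [of "sqrt u" 1] arccos_le_pi2 [of "sqrt u"] s by auto
    ultimately show "(\<lambda>n. a n * u ^ n) sums f (2 * u - 1)"
      using L [rule_format, of ?\<theta>] u by (simp add: power_mult cos_double_cos)
  qed
next
  assume R: ?R
  show ?L
  proof
    fix \<theta> :: real
    assume "\<theta> \<in> {0<..pi / 2}"
    then have "0 \<le> cos \<theta>" "cos \<theta> < 1"
      using cos_monotone_0_pi [of 0 \<theta>] by (auto intro: cos_ge_zero)
    then have "(cos \<theta>)\<^sup>2 < 1"
      by (simp add: power_strict_mono power_less_one_iff)
    then show "(\<lambda>n. a n * cos \<theta> ^ (2 * n)) sums f (cos (2 * \<theta>))"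
      using R by (simp add: power_mult cos_double_cos)
  qed
qed

text \<open>
  A power series with nonnegative coefficients has a limit at 1 iff the coefficients are summable, and
  then the limit is their sum. The two cases of \<open>value_at_one\<close> match these alternatives.
\<close>

lemma value_at_one_power_series:
  assumes a: "\<And>n. 0 \<le> a n"
    and f: "\<And>u. 0 \<le> u \<Longrightarrow> u < 1 \<Longrightarrow> (\<lambda>n. a n * u ^ n) sums f (2 * u - 1)"
  shows "0 \<le> value_at_one f \<and> e2ennreal (value_at_one f) = (\<Sum>n. ennreal (a n))"
proof -
  have sums: "(\<lambda>n. a n * ((1 + t) / 2) ^ n) sums f t" if "-1 \<le> t" "t < 1" for t
    using f [of "(1 + t) / 2"] that by (simp add: field_simps)
  have part: "((\<lambda>t. \<Sum>n<N. a n * ((1 + t) / 2) ^ n) \<longlongrightarrow> (\<Sum>n<N. a n)) (at_left 1)" for N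
    by (auto intro!: tendsto_eq_intros)
  have ev: "\<forall>\<^sub>F t in at_left 1. -1 \<le> t \<and> t < (1::real)"
    by (auto simp: eventually_at_left_field intro!: exI [of _ "-1"])
  have part_le: "\<forall>\<^sub>F t in at_left 1. (\<Sum>n<N. a n * ((1 + t) / 2) ^ n) \<le> f t" for N
    using ev
  proof eventually_elim
    case (elim t)
    then have "summable (\<lambda>n. a n * ((1 + t) / 2) ^ n)" "f t = (\<Sum>n. a n * ((1 + t) / 2) ^ n)"
      using sums [of t] by (simp_all add: sums_iff)
    then show ?case
      using a elim by (simp add: sum_le_suminf)
  qed
  have lim: "(f \<longlongrightarrow> suminf a) (at_left 1)" if "summable a"
  proof (rule order_tendstoI)
    fix y
    assume "y < suminf a"
    moreover have "(\<lambda>N. \<Sum>n<N. a n) \<longlonglongrightarrow> suminf a"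
      using that by (rule summable_LIMSEQ)
    ultimately have "\<forall>\<^sub>F N in sequentially. y < (\<Sum>n<N. a n)"
      by (simp add: order_tendstoD)
    then obtain N where "y < (\<Sum>n<N. a n)"
      by (auto simp: eventually_sequentially)
    then have "\<forall>\<^sub>F t in at_left 1. y < (\<Sum>n<N. a n * ((1 + t) / 2) ^ n)"
      using part order_tendstoD by blast
    with part_le [of N] show "\<forall>\<^sub>F t in at_left 1. y < f t"
      by eventually_elim simp
  next
    fix y
    assume y: "suminf a < y"
    from ev show "\<forall>\<^sub>F t in at_left 1. f t < y"
    proof eventually_elim
      case (elim t)
      have "a n * ((1 + t) / 2) ^ n \<le> a n" for n
        using elim a by (intro mult_left_le power_le_one) auto
      then have "f t \<le> suminf a"
        using sums_le [OF _ sums summable_sums [OF that]] elim by simp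
      with y show ?case
        by simp
    qed
  qed
  have summ: "summable a" if "(f \<longlongrightarrow> l) (at_left 1)" for l
  proof (rule summableI_nonneg_bounded)
    show "(\<Sum>n<N. a n) \<le> l" for N
      using trivial_limit_at_left_real that part part_le by (rule tendsto_le)
  qed (rule a)
  show ?thesis
  proof (cases "summable a")
    case True
    then have "value_at_one f = ereal (suminf a)"
      using lim by (auto simp: value_at_one_def intro: tendsto_Lim)
    then show ?thesis
      using True a by (simp add: suminf_nonneg suminf_ennreal2)
  next
    case False
    then have "value_at_one f = \<infinity>"
      using summ by (auto simp: value_at_one_def)
    moreover have "(\<Sum>n. ennreal (a n)) = top"
      using False a summable_suminf_not_top [of a] by blast
    ultimately show ?thesis
      by simp
  qed
qed

text \<open>
  The kernel is nonnegative, so the two parts of the double integral are nonnegative series whose terms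
  are compared one by one. If the larger part is infinite, so is the double integral.
\<close>

lemma power_series_positive_definite:
  fixes F :: "'a::scalar itself"
  assumes a: "\<And>n. 0 \<le> a n"
    and f: "\<And>u. 0 \<le> u \<Longrightarrow> u < 1 \<Longrightarrow> (\<lambda>n. a n * u ^ n) sums f (2 * u - 1)"
  shows "positive_definite F d f"
  unfolding positive_definite_def
proof (intro allI impI)
  fix \<mu>
  let ?X = "proj_borel d :: (nat \<Rightarrow> 'a) set measure"
  assume \<mu>: "signed_measure ?X \<mu>"
  define P N where "P = pos_part ?X \<mu>" and "N = neg_part ?X \<mu>"
  have P: "finite_measure P" "sets P = sets ?X" and N: "finite_measure N" "sets N = sets ?X"
    using finite_pos_part [OF \<mu>] finite_pos_part [OF signed_measure_uminus [OF \<mu>]]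
    by (simp_all add: P_def N_def neg_part_def)
  have ext: "0 \<le> ext_one f (2 * u - 1)" "e2ennreal (ext_one f (2 * u - 1)) = (\<Sum>n. ennreal (a n) * ennreal (u ^ n))"
    if u: "0 \<le> u" "u \<le> 1" for u
  proof -
    have "0 \<le> ext_one f (2 * u - 1) \<and> e2ennreal (ext_one f (2 * u - 1)) = (\<Sum>n. ennreal (a n * u ^ n))"
    proof (cases "u = 1")
      case True
      then show ?thesis
        using value_at_one_power_series [OF a f] by (simp add: ext_one_def)
    next
      case False
      then have s: "(\<lambda>n. a n * u ^ n) sums f (2 * u - 1)"
        using u f by simp
      then have "0 \<le> f (2 * u - 1)"
        using sums_le [OF _ sums_zero s] a u by simp
      moreover have "(\<Sum>n. ennreal (a n * u ^ n)) = ennreal (f (2 * u - 1))"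
        using s a u by (subst suminf_ennreal2) (auto simp: sums_iff)
      ultimately show ?thesis
        using False by (simp add: ext_one_def)
    qed
    then show "0 \<le> ext_one f (2 * u - 1)" "e2ennreal (ext_one f (2 * u - 1)) = (\<Sum>n. ennreal (a n) * ennreal (u ^ n))"
      using a u by (simp_all add: ennreal_mult)
  qed
  let ?J = "\<lambda>n A B. \<integral>\<^sup>+(L, M). ennreal (overlap d L M ^ n) \<partial>(A \<Otimes>\<^sub>M B)"
  have pos: "(\<integral>\<^sup>+(L, M). e2ennreal (kernel d f L M) \<partial>(A \<Otimes>\<^sub>M B)) = (\<Sum>n. ennreal (a n) * ?J n A B)"
    if [measurable_cong]: "sets A = sets ?X" "sets B = sets ?X" for A B
  proof -
    have "(\<integral>\<^sup>+(L, M). e2ennreal (kernel d f L M) \<partial>(A \<Otimes>\<^sub>M B)) =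
      (\<integral>\<^sup>+z. (\<Sum>n. ennreal (a n) * ennreal ((\<lambda>(L, M). overlap d L M) z ^ n)) \<partial>(A \<Otimes>\<^sub>M B))"
      by (intro nn_integral_cong) (auto simp: kernel_overlap ext)
    also have "\<dots> = (\<Sum>n. \<integral>\<^sup>+z. ennreal (a n) * ennreal ((\<lambda>(L, M). overlap d L M) z ^ n) \<partial>(A \<Otimes>\<^sub>M B))"
      by (rule nn_integral_suminf) measurable
    also have "\<dots> = (\<Sum>n. ennreal (a n) * (\<integral>\<^sup>+z. ennreal ((\<lambda>(L, M). overlap d L M) z ^ n) \<partial>(A \<Otimes>\<^sub>M B)))"
      by (intro suminf_cong nn_integral_cmult) measurable
    finally show ?thesis
      by (simp add: split_beta')
  qed
  have neg: "(\<integral>\<^sup>+(L, M). e2ennreal (- kernel d f L M) \<partial>(A \<Otimes>\<^sub>M B)) = 0" for A B :: "(nat \<Rightarrow> 'a) set measure"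
    by (simp add: kernel_overlap ext e2ennreal_neg split_beta')
  have "dbl_integral_pos ?X \<mu> (\<lambda>x y. - kernel d f x y) = (\<Sum>n. ennreal (a n) * ?J n P N) + (\<Sum>n. ennreal (a n) * ?J n N P)"
    using pos [OF P(2) N(2)] pos [OF N(2) P(2)] neg unfolding dbl_integral_pos_def P_def N_def by simp
  also have "\<dots> = (\<Sum>n. ennreal (a n) * (?J n P N + ?J n N P))"
    by (simp add: suminf_add summableI distrib_left)
  also have "\<dots> \<le> (\<Sum>n. ennreal (a n) * (?J n P P + ?J n N N))"
    by (intro suminf_le mult_left_mono nn_integral_overlap_power P N summableI) auto
  also have "\<dots> = (\<Sum>n. ennreal (a n) * ?J n P P) + (\<Sum>n. ennreal (a n) * ?J n N N)"
    by (simp add: suminf_add summableI distrib_left)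
  also have "\<dots> = dbl_integral_pos ?X \<mu> (kernel d f)"
    using pos [OF P(2) P(2)] pos [OF N(2) N(2)] neg unfolding dbl_integral_pos_def P_def N_def by simp
  finally show "0 \<le> dbl_integral ?X \<mu> (kernel d f)"
    unfolding dbl_integral_def by (intro ereal_diff_positive) (simp add: less_eq_ennreal.rep_eq)
qed

section \<open>Limits of power series with nonnegative coefficients\<close>

text \<open>
  Nonnegativity bounds the coefficients: \<open>A k j * v ^ j\<close> is at most the value at \<open>v\<close>, which
  converges. So the sequences of coefficients lie in a product of compact intervals and have a
  coordinatewise convergent subsequence. At a smaller argument the terms are dominated by a geometric
  series, which permits the limit to be taken termwise.
\<close>

lemma nonneg_power_series_limit:
  fixes A :: "nat \<Rightarrow> nat \<Rightarrow> real" and g :: "real \<Rightarrow> real"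
  assumes nonneg: "\<And>k j. 0 \<le> A k j"
    and conv: "\<And>v. 0 \<le> v \<Longrightarrow> v < 1 \<Longrightarrow>
      \<exists>q. (\<forall>\<^sub>F k in sequentially. (\<lambda>j. A k j * v ^ j) sums q k) \<and> q \<longlonglongrightarrow> g v"
  obtains a where "\<And>j. 0 \<le> a j" "\<And>v. 0 \<le> v \<Longrightarrow> v < 1 \<Longrightarrow> (\<lambda>j. a j * v ^ j) sums g v"
proof -
  have bound: "\<exists>B. \<forall>\<^sub>F k in sequentially. \<forall>j. A k j * v ^ j \<le> B" if v: "0 \<le> v" "v < 1" for v
  proof -
    obtain q where q: "\<forall>\<^sub>F k in sequentially. (\<lambda>j. A k j * v ^ j) sums q k" "q \<longlonglongrightarrow> g v"
      using conv [OF v] by blast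
    have "\<forall>\<^sub>F k in sequentially. q k < g v + 1"
      using q(2) by (rule order_tendstoD) simp
    with q(1) have "\<forall>\<^sub>F k in sequentially. \<forall>j. A k j * v ^ j \<le> g v + 1"
    proof eventually_elim
      case (elim k)
      have "A k j * v ^ j \<le> q k" for j
        using sum_le_suminf [of "\<lambda>j. A k j * v ^ j" "{j}"] elim nonneg v
        by (simp add: sums_iff)
      with elim show ?case
        by (meson less_imp_le order_trans)
    qed
    then show ?thesis ..
  qed
  obtain B where "\<forall>\<^sub>F k in sequentially. \<forall>j. A k j * (1 / 2) ^ j \<le> B"
    using bound [of "1 / 2"] by auto
  then obtain N where N: "\<And>k j. N \<le> k \<Longrightarrow> A k j * (1 / 2) ^ j \<le> B"
    by (auto simp: eventually_sequentially)
  let ?K = "PiE UNIV (\<lambda>j. {0..B * 2 ^ j})"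
  have "compactin (product_topology (\<lambda>_. euclidean) UNIV) ?K"
    by (subst compactin_PiE) auto
  then have "compact ?K"
    by (simp add: euclidean_product_topology)
  then have "seq_compact ?K"
    by (simp add: seq_compact_eq_compact)
  moreover have "\<forall>n. A (n + N) \<in> ?K"
  proof
    fix n
    have "A (n + N) j \<le> B * 2 ^ j" for j
      using N [of "n + N" j] by (simp add: power_divide field_simps)
    then show "A (n + N) \<in> ?K"
      using nonneg by auto
  qed
  ultimately obtain a r where a: "a \<in> ?K" and r: "strict_mono r"
    and lim: "((\<lambda>n. A (n + N)) \<circ> r) \<longlonglongrightarrow> a"
    by (rule seq_compactE)
  have coord: "(\<lambda>n. A (r n + N) j) \<longlonglongrightarrow> a j" for j
  proof -
    have "continuous_on UNIV (\<lambda>x :: nat \<Rightarrow> real. x j)"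
      by (rule continuous_on_product_coordinates)
    from continuous_on_tendsto_compose [OF this lim] show ?thesis
      by (simp add: o_def)
  qed
  have r_top: "filterlim (\<lambda>n. r n + N) sequentially sequentially"
    using r by (intro filterlim_subseq) (simp add: strict_mono_def)
  show thesis
  proof
    show "0 \<le> a j" for j
      using a by auto
  next
    fix v :: real
    assume v: "0 \<le> v" "v < 1"
    obtain q where q: "\<forall>\<^sub>F k in sequentially. (\<lambda>j. A k j * v ^ j) sums q k" "q \<longlonglongrightarrow> g v"
      using conv [OF v] by blast
    \<comment> \<open>an argument strictly between \<open>v\<close> and 1; the dominating series has the ratio \<open>v / ?w\<close>\<close>
    let ?w = "(v + 1) / 2"
    have w: "v < ?w" "0 < ?w" "?w < 1"
      using v by auto
    obtain B' where B': "\<forall>\<^sub>F k in sequentially. \<forall>j. A k j * ?w ^ j \<le> B'"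
      using bound [of ?w] w by auto
    let ?M = "count_space UNIV :: nat measure"
    have dom: "AE j in ?M. norm (A k j * v ^ j) \<le> B' * (v / ?w) ^ j"
      if "\<forall>j. A k j * ?w ^ j \<le> B'" for k
    proof -
      have "A k j * v ^ j \<le> B' * (v / ?w) ^ j" for j
      proof -
        have "A k j * v ^ j = (A k j * ?w ^ j) * (v / ?w) ^ j"
          using w by (simp add: power_divide)
        also have "\<dots> \<le> B' * (v / ?w) ^ j"
          using that v w by (intro mult_right_mono) auto
        finally show ?thesis .
      qed
      then show ?thesis
        using nonneg v by (simp add: AE_count_space)
    qed
    have ev: "\<forall>\<^sub>F n in sequentially. (\<lambda>j. A (r n + N) j * v ^ j) sums q (r n + N) \<and>
        (\<forall>j. A (r n + N) j * ?w ^ j \<le> B')"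
      using eventually_compose_filterlim [OF eventually_conj [OF q(1) B'] r_top] .
    then obtain n0 where n0: "\<And>n. n0 \<le> n \<Longrightarrow> (\<lambda>j. A (r n + N) j * v ^ j) sums q (r n + N)"
       "\<And>n. n0 \<le> n \<Longrightarrow> \<forall>j. A (r n + N) j * ?w ^ j \<le> B'"
      by (auto simp: eventually_sequentially)
    define F where "F n j = A (r (n + n0) + N) j * v ^ j" for n j
    have int_w: "integrable ?M (\<lambda>j. B' * (v / ?w) ^ j)"
    proof -
      have "summable (\<lambda>j. (v / ?w) ^ j)"
        using v w by (intro summable_geometric) simp
      then have "integrable ?M (\<lambda>j. (v / ?w) ^ j)"
        using v w by (simp add: integrable_count_space_nat_iff)
      then show ?thesis
        by (rule integrable_mult_right)
    qed
    have F_lim: "(\<lambda>n. F n j) \<longlonglongrightarrow> a j * v ^ j" for j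
      unfolding F_def using LIMSEQ_ignore_initial_segment [OF coord, of n0] by (intro tendsto_mult) auto
    have F_dom: "AE j in ?M. norm (F n j) \<le> B' * (v / ?w) ^ j" for n
      unfolding F_def by (rule dom) (rule n0, simp)
    have "(\<lambda>n. \<integral>j. F n j \<partial>?M) \<longlonglongrightarrow> (\<integral>j. a j * v ^ j \<partial>?M)"
      by (rule integral_dominated_convergence [where w = "\<lambda>j. B' * (v / ?w) ^ j"])
        (use int_w F_lim F_dom in \<open>auto\<close>)
    moreover have F_int: "integrable ?M (F n)" for n
      by (rule Bochner_Integration.integrable_bound [OF int_w]) (use F_dom [of n] in auto)
    moreover have "(\<integral>j. F n j \<partial>?M) = q (r (n + n0) + N)" for n
    proof -
      have "(\<integral>j. F n j \<partial>?M) = (\<Sum>j. F n j)"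
        using F_int by (rule integral_count_space_nat)
      also have "\<dots> = q (r (n + n0) + N)"
        using n0(1) [of "n + n0"] by (simp add: F_def sums_iff)
      finally show ?thesis .
    qed
    moreover have "(\<lambda>n. q (r (n + n0) + N)) \<longlonglongrightarrow> g v"
      using LIMSEQ_ignore_initial_segment [OF filterlim_compose [OF q(2) r_top], of n0] by simp
    ultimately have eq: "(\<integral>j. a j * v ^ j \<partial>?M) = g v"
      by (simp add: LIMSEQ_unique)
    have int_a: "integrable ?M (\<lambda>j. a j * v ^ j)"
      by (rule integrable_dominated_convergence [where w = "\<lambda>j. B' * (v / ?w) ^ j" and s = F])
        (use int_w F_lim F_dom in \<open>auto\<close>)
    then have "summable (\<lambda>j. a j * v ^ j)"
      using integrable_count_space_nat_iff summable_norm_cancel by blast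
    with eq int_a show "(\<lambda>j. a j * v ^ j) sums g v"
      by (simp add: sums_iff integral_count_space_nat)
  qed
qed

section \<open>Concentration of a tilted mean with a singular integrand\<close>

text \<open>
  The key to uniform integrability. By the inequality of the means the left-hand side is at most
  \<open>\<Prod>k<M. y k powr (- q / M)\<close>, and convexity of \<open>exp\<close> on the segment from \<open>0\<close> to
  \<open>- ln (y k) / 4\<close> bounds each factor. The factors are \<open>1 + O(1 / M)\<close> in the mean as soon
  as \<open>y k powr (- 1 / 4)\<close> is integrable, however large \<open>q\<close> is.
\<close>

lemma inverse_mean_power_le:
  fixes y :: "nat \<Rightarrow> real"
  assumes M: "4 * q \<le> M" "0 < M" and y: "\<And>k. k < M \<Longrightarrow> 0 < y k" "\<And>k. k < M \<Longrightarrow> y k \<le> 1"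
  shows "inverse ((\<Sum>k<M. y k) / M) ^ q \<le> (\<Prod>k<M. 1 + 4 * real q / M * y k powr (- 1 / 4))"
proof -
  let ?p = "real q / M"
  have p: "0 \<le> ?p" "4 * ?p \<le> 1"
    using M by (simp_all add: divide_le_eq flip: of_nat_mult)
  have le: "(\<Prod>k<M. y k) powr (1 / M) \<le> (\<Sum>k<M. y k) / M"
    using arith_geom_mean [of "{..<M}" y] M y
    by (simp add: less_imp_le sum_divide_distrib lessThan_empty_iff)
  have pos: "0 < (\<Prod>k<M. y k) powr (1 / M)"
    using y by (simp add: prod_pos less_imp_neq [symmetric])
  have "0 < (\<Sum>k<M. y k) / M"
    using pos le by (rule less_le_trans)
  then have "inverse ((\<Sum>k<M. y k) / M) ^ q \<le> inverse ((\<Prod>k<M. y k) powr (1 / M)) ^ q"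
    by (intro power_mono le_imp_inverse_le le pos) (simp only: inverse_nonnegative_iff_nonnegative less_imp_le)
  also have "\<dots> = (\<Prod>k<M. y k) powr (- ?p)"
  proof -
    have pos: "0 < (\<Prod>k<M. y k)"
      using y by (intro prod_pos) simp
    have "inverse ((\<Prod>k<M. y k) powr (1 / M)) ^ q = ((\<Prod>k<M. y k) powr (- 1 / M)) powr q"
      using pos by (subst powr_realpow) (auto simp: powr_minus dest!: y(1))
    then show ?thesis
      by (simp add: powr_powr)
  qed
  also have "\<dots> = (\<Prod>k<M. y k powr (- ?p))"
    using y(1) by (subst prod_powr_distrib) (simp_all add: less_imp_le)
  also have "\<dots> \<le> (\<Prod>k<M. 1 + 4 * ?p * y k powr (- 1 / 4))"
  proof (rule prod_mono, rule conjI)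
    fix k assume "k \<in> {..<M}"
    then have yk: "0 < y k" "y k \<le> 1"
      using y by auto
    \<comment> \<open>\<open>4 * ?p \<le> 1\<close> is the weight of the right end point \<open>x / 4\<close> of the segment\<close>
    define x where "x = - ln (y k)"
    have "exp ((1 - 4 * ?p) *\<^sub>R 0 + (4 * ?p) *\<^sub>R (x / 4)) \<le> (1 - 4 * ?p) * exp 0 + 4 * ?p * exp (x / 4)"
      using exp_convex by (rule convex_onD) (use p in auto)
    then have "exp (?p * x) \<le> (1 - 4 * ?p) + 4 * ?p * exp (x / 4)"
      by simp
    then have "exp (?p * x) \<le> 1 + 4 * ?p * exp (x / 4)"
      using p(1) by linarith
    then show "y k powr (- ?p) \<le> 1 + 4 * ?p * y k powr (- 1 / 4)"
      using yk by (simp add: powr_def x_def)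
  qed simp
  finally show ?thesis
    by simp
qed

text \<open>
  A modulus of continuity for \<open>x \<mapsto> g (x\<^sup>2)\<close> at \<open>x0\<close> that is valid up to the singularity: near
  \<open>x0\<close> continuity suffices, and away from \<open>x0\<close> the quotient \<open>(x - x0)\<^sup>2 / d\<^sup>2\<close> is at least
  1 and the growth bound applies.
\<close>

lemma singular_modulus:
  fixes g :: "real \<Rightarrow> real"
  assumes cont: "continuous_on {0..<1} g"
    and bound: "\<And>u. 0 \<le> u \<Longrightarrow> u < 1 \<Longrightarrow> \<bar>g u\<bar> \<le> C * inverse (1 - u) ^ m"
    and x0: "x0\<^sup>2 < 1" and e: "0 < e"
  obtains D where "0 < D"
    "\<And>x. x\<^sup>2 < 1 \<Longrightarrow> \<bar>g (x\<^sup>2) - g (x0\<^sup>2)\<bar> \<le> e + D * ((x - x0)\<^sup>2 * inverse (1 - x\<^sup>2) ^ m)"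
proof -
  have "continuous_on {-1<..<1} (\<lambda>x. g (x\<^sup>2))"
    by (intro continuous_on_compose2 [OF cont] continuous_intros)
      (auto simp: abs_square_less_1 [THEN iffD2] abs_less_iff)
  moreover have x0': "x0 \<in> {-1<..<1}"
    using x0 by (auto simp: abs_square_less_1 abs_less_iff)
  ultimately have "isCont (\<lambda>x. g (x\<^sup>2)) x0"
    using continuous_on_eq_continuous_at open_greaterThanLessThan by blast
  then obtain d where d: "0 < d" "\<And>x. \<bar>x - x0\<bar> < d \<Longrightarrow> \<bar>g (x\<^sup>2) - g (x0\<^sup>2)\<bar> < e"
    using e unfolding continuous_at_eps_delta dist_real_def by blast
  \<comment> \<open>the summand 1 only ensures that the constant is positive\<close>
  define E where "E = \<bar>C\<bar> + \<bar>g (x0\<^sup>2)\<bar> + 1"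
  show thesis
  proof
    show "0 < E / d\<^sup>2"
      using d by (simp add: E_def)
    fix x :: real
    assume x: "x\<^sup>2 < 1"
    let ?r = "inverse (1 - x\<^sup>2) ^ m"
    have "1 \<le> inverse (1 - x\<^sup>2)"
      using x by (simp add: one_le_inverse_iff)
    then have r: "1 \<le> ?r"
      by (rule one_le_power)
    show "\<bar>g (x\<^sup>2) - g (x0\<^sup>2)\<bar> \<le> e + E / d\<^sup>2 * ((x - x0)\<^sup>2 * ?r)"
    proof (cases "\<bar>x - x0\<bar> < d")
      case True
      then have "\<bar>g (x\<^sup>2) - g (x0\<^sup>2)\<bar> \<le> e"
        using d by (simp add: less_imp_le)
      moreover have "0 \<le> E / d\<^sup>2 * ((x - x0)\<^sup>2 * ?r)"
        using r by (intro mult_nonneg_nonneg) (auto simp: E_def)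
      ultimately show ?thesis
        by linarith
    next
      case False
      then have "d\<^sup>2 \<le> (x - x0)\<^sup>2"
        using d power_mono [of d "\<bar>x - x0\<bar>" 2] by simp
      then have quot: "1 \<le> (x - x0)\<^sup>2 / d\<^sup>2"
        using d by simp
      have "\<bar>g (x\<^sup>2) - g (x0\<^sup>2)\<bar> \<le> C * ?r + \<bar>g (x0\<^sup>2)\<bar> * 1"
        using bound [of "x\<^sup>2"] x by simp
      also have "\<dots> \<le> \<bar>C\<bar> * ?r + \<bar>g (x0\<^sup>2)\<bar> * ?r"
        using r by (intro add_mono mult_mono) auto
      also have "\<dots> \<le> E * ?r"
        using r by (simp add: E_def distrib_right)
      also have "\<dots> = 1 * (E * ?r)"
        by simp
      also have "\<dots> \<le> ((x - x0)\<^sup>2 / d\<^sup>2) * (E * ?r)"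
        using r quot by (intro mult_right_mono) (auto simp: E_def)
      also have "\<dots> = E / d\<^sup>2 * ((x - x0)\<^sup>2 * ?r)"
        by simp
      finally show ?thesis
        using e by linarith
    qed
  qed
qed

lemma inverse_ennreal_antimono: "a \<le> b \<Longrightarrow> inverse (ennreal b) \<le> inverse (ennreal a)"
  by (cases "a \<le> 0") (auto simp: ennreal_neg inverse_ennreal intro!: ennreal_leI le_imp_inverse_le)

text \<open>
  In \<open>ennreal\<close> the growth bound also holds at \<open>u = 1\<close>, where its right-hand side is infinite.
\<close>

lemma singular_bound_ennreal:
  fixes g :: "real \<Rightarrow> real"
  assumes bound: "\<And>u. 0 \<le> u \<Longrightarrow> u < 1 \<Longrightarrow> \<bar>g u\<bar> \<le> C * inverse (1 - u) ^ m"
    and "0 < C" "0 < m" "0 \<le> u" "u \<le> 1"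
  shows "ennreal \<bar>g u\<bar> \<le> ennreal C * inverse (ennreal (1 - u)) ^ m"
proof (cases "u < 1")
  case True
  then have "ennreal \<bar>g u\<bar> \<le> ennreal (C * inverse (1 - u) ^ m)"
    using bound assms by (intro ennreal_leI) auto
  also have "\<dots> = ennreal C * inverse (ennreal (1 - u)) ^ m"
    using True assms by (simp add: ennreal_mult inverse_ennreal ennreal_power)
  finally show ?thesis .
next
  case False
  then have "ennreal C * inverse (ennreal (1 - u)) ^ m = top"
    using assms by (simp add: ennreal_mult_top power_0_left ennreal_top_mult top_power_ennreal)
  then show ?thesis
    by simp
qed

text \<open>
  One coordinate of the random experiment. Both \<open>\<tau>\<close> and \<open>y\<close> are centred and \<open>c\<close> is their
  covariance, so the density \<open>1 + \<rho> * \<tau>\<close> tilts the mean of \<open>y\<close> from \<open>0\<close> to \<open>\<rho> * c\<close>. The last assumption says how rarely \<open>\<bar>y\<bar>\<close> is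
  close to 1.
\<close>

locale coordinate = prob_space D for D :: "'z measure" +
  fixes y \<tau> :: "'z \<Rightarrow> real" and c K :: real
  assumes measurable_y [measurable]: "y \<in> borel_measurable D"
    and measurable_\<tau> [measurable]: "\<tau> \<in> borel_measurable D"
    and y_le: "\<And>z. \<bar>y z\<bar> \<le> 1" and \<tau>_le: "\<And>z. \<bar>\<tau> z\<bar> \<le> 1"
    and expectation_\<tau>: "(\<integral>z. \<tau> z \<partial>D) = 0"
    and expectation_y: "(\<integral>z. y z \<partial>D) = 0"
    and expectation_\<tau>y: "(\<integral>z. \<tau> z * y z \<partial>D) = c"
    and y_less: "AE z in D. (y z)\<^sup>2 < 1"
    and K_nonneg: "0 \<le> K"
    and singular: "(\<integral>\<^sup>+z. ennreal ((1 - (y z)\<^sup>2) powr (- 1 / 4)) \<partial>D) \<le> ennreal K"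
begin

text \<open>
  Of \<open>M\<close> independent coordinates: their joint law \<open>Q M\<close>, the tilting density \<open>W \<rho> M\<close> and the mean
  \<open>X M\<close> of the values of \<open>y\<close>.
\<close>

definition "Q M = PiM {..<M} (\<lambda>_. D)"
definition "W \<rho> M \<omega> = (\<Prod>k<M. 1 + \<rho> * \<tau> (\<omega> k))" for \<rho> :: real and M :: nat
definition "X M \<omega> = (\<Sum>k<M. y (\<omega> k)) / M" for M :: nat

sublocale D: product_prob_space "\<lambda>_::nat. D"
  by unfold_locales

lemma measurable_W [measurable]: "W \<rho> M \<in> borel_measurable (Q M)"
  unfolding W_def Q_def by measurable

lemma measurable_X [measurable]: "X M \<in> borel_measurable (Q M)"
  unfolding X_def Q_def by measurable

lemma abs_X_le: "\<bar>X M \<omega>\<bar> \<le> 1"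
proof -
  have "\<bar>\<Sum>k<M. y (\<omega> k)\<bar> \<le> (\<Sum>k<M. 1)"
    by (rule order_trans [OF sum_abs]) (intro sum_mono y_le)
  then show ?thesis
    by (cases "M = 0") (auto simp: X_def)
qed

lemma weight_bounds:
  assumes "\<bar>\<rho>\<bar> \<le> 1"
  shows "0 \<le> 1 + \<rho> * \<tau> z" "1 + \<rho> * \<tau> z \<le> 2"
proof -
  have "\<bar>\<rho> * \<tau> z\<bar> \<le> 1"
    using assms \<tau>_le [of z] by (simp add: abs_mult mult_le_one)
  then show "0 \<le> 1 + \<rho> * \<tau> z" "1 + \<rho> * \<tau> z \<le> 2"
    by (auto simp: abs_le_iff)
qed

lemma integrable_coordinate:
  "integrable D \<tau>" "integrable D y" "integrable D (\<lambda>z. \<tau> z * y z)" "integrable D (\<lambda>z. (y z)\<^sup>2)"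
  "integrable D (\<lambda>z. \<tau> z * (y z)\<^sup>2)"
proof -
  have "\<bar>\<tau> z * y z\<bar> \<le> 1" "\<bar>(y z)\<^sup>2\<bar> \<le> 1" "\<bar>\<tau> z * (y z)\<^sup>2\<bar> \<le> 1" for z
    using y_le [of z] \<tau>_le [of z] by (auto simp: abs_mult abs_square_le_1 intro!: mult_le_one)
  then show "integrable D \<tau>" "integrable D y" "integrable D (\<lambda>z. \<tau> z * y z)" "integrable D (\<lambda>z. (y z)\<^sup>2)"
    "integrable D (\<lambda>z. \<tau> z * (y z)\<^sup>2)"
    using y_le \<tau>_le by (auto intro!: integrable_const_bound [where B = 1])
qed

lemma abs_c_le: "\<bar>c\<bar> \<le> 1"
proof -
  have "\<bar>c\<bar> \<le> (\<integral>z. \<bar>\<tau> z * y z\<bar> \<partial>D)"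
    unfolding expectation_\<tau>y [symmetric] by (rule integral_abs_bound)
  also have "\<dots> \<le> (\<integral>z. 1 \<partial>D)"
    using integrable_coordinate(3) y_le \<tau>_le
    by (intro integral_mono integrable_abs) (auto simp: abs_mult intro!: mult_le_one)
  finally show ?thesis
    by (simp add: prob_space)
qed

text \<open>
  Under the tilted law the coordinates are still independent, and \<open>y - c * \<rho>\<close> is centred. So the
  products for \<open>k \<noteq> l\<close> vanish in the mean and only the \<open>M\<close> diagonal terms remain.
\<close>

lemma second_moment:
  assumes \<rho>: "\<bar>\<rho>\<bar> \<le> 1" and M: "0 < M"
  shows "integrable (Q M) (\<lambda>\<omega>. W \<rho> M \<omega> * (X M \<omega> - c * \<rho>)\<^sup>2)"
    and "(\<integral>\<omega>. W \<rho> M \<omega> * (X M \<omega> - c * \<rho>)\<^sup>2 \<partial>Q M) \<le> 4 / M"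
proof -
  define w where "w z = 1 + \<rho> * \<tau> z" for z
  define v where "v z = y z - c * \<rho>" for z
  \<comment> \<open>the \<open>i\<close>-th factor of the tilted product \<open>v (\<omega> k) * v (\<omega> l)\<close>, also for \<open>k = l\<close>\<close>
  define f where "f k l i z = w z * ((if i = k then v z else 1) * (if i = l then v z else 1))"
    for k l i :: nat and z
  have [measurable]: "w \<in> borel_measurable D" "v \<in> borel_measurable D"
    unfolding w_def v_def by measurable
  have w: "0 \<le> w z" "w z \<le> 2" for z
    using weight_bounds [OF \<rho>] by (auto simp: w_def)
  have v: "\<bar>v z\<bar> \<le> 2" for z
  proof -
    have "\<bar>c * \<rho>\<bar> \<le> 1"
      using abs_c_le \<rho> by (simp add: abs_mult mult_le_one)
    then show ?thesis
      using y_le [of z] by (auto simp: v_def)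
  qed
  have Ew: "(\<integral>z. w z \<partial>D) = 1" and Ewv: "(\<integral>z. w z * v z \<partial>D) = 0"
    using integrable_coordinate expectation_y expectation_\<tau> expectation_\<tau>y
    by (simp_all add: w_def v_def algebra_simps prob_space)
  have int: "integrable D (f k l i)" for k l i
  proof (rule integrable_const_bound [where B = 8])
    have "\<bar>if i = k then v z else 1\<bar> \<le> 2" "\<bar>if i = l then v z else 1\<bar> \<le> 2" for z
      using v [of z] by auto
    then have "\<bar>f k l i z\<bar> \<le> 2 * (2 * 2)" for z
      unfolding f_def abs_mult using w [of z] by (intro mult_mono) auto
    then show "AE z in D. norm (f k l i z) \<le> 8"
      by simp
    show "f k l i \<in> borel_measurable D"
      unfolding f_def by measurable
  qed
  have Ewvv: "(\<integral>z. w z * (v z * v z) \<partial>D) \<le> 4"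
  proof -
    have "w z * (v z * v z) \<le> w z * 4" for z
    proof -
      have "v z * v z = \<bar>v z\<bar> * \<bar>v z\<bar>"
        by simp
      also have "\<dots> \<le> 2 * 2"
        using v [of z] by (intro mult_mono) auto
      finally show ?thesis
        using w [of z] by (intro mult_left_mono) auto
    qed
    moreover have "integrable D (\<lambda>z. w z * (v z * v z))"
      using int [of 0 0 0] unfolding f_def by simp
    moreover have "integrable D w"
      using integrable_coordinate by (simp add: w_def [abs_def])
    ultimately have "(\<integral>z. w z * (v z * v z) \<partial>D) \<le> (\<integral>z. w z * 4 \<partial>D)"
      by (intro integral_mono) auto
    then show ?thesis
      by (simp add: Ew)
  qed
  have prod_f: "(\<Prod>i<M. f k l i (\<omega> i)) = W \<rho> M \<omega> * (v (\<omega> k) * v (\<omega> l))" if "k < M" "l < M" for k l \<omega>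
    using that by (simp add: f_def prod.distrib W_def w_def)
  have int_Q: "integrable (Q M) (\<lambda>\<omega>. W \<rho> M \<omega> * (v (\<omega> k) * v (\<omega> l)))" if "k < M" "l < M" for k l
    using D.product_integrable_prod [of "{..<M}" "f k l"] int that by (simp add: prod_f Q_def)
  have int_eq: "(\<integral>\<omega>. W \<rho> M \<omega> * (v (\<omega> k) * v (\<omega> l)) \<partial>Q M) = (\<Prod>i<M. \<integral>z. f k l i z \<partial>D)"
    if "k < M" "l < M" for k l
    using D.product_integral_prod [of "{..<M}" "f k l"] int that by (simp add: prod_f Q_def)
  have E0: "(\<integral>\<omega>. W \<rho> M \<omega> * (v (\<omega> k) * v (\<omega> l)) \<partial>Q M) = 0" if "k < M" "l < M" "k \<noteq> l" for k l
  proof -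
    have "(\<integral>z. f k l k z \<partial>D) = 0"
      using that Ewv by (simp add: f_def)
    then show ?thesis
      using that by (auto simp: int_eq intro!: prod_zero)
  qed
  have E1: "(\<integral>\<omega>. W \<rho> M \<omega> * (v (\<omega> k) * v (\<omega> k)) \<partial>Q M) \<le> 4" if "k < M" for k
  proof -
    have "(\<Prod>i<M. \<integral>z. f k k i z \<partial>D) = (\<Prod>i<M. if i = k then (\<integral>z. w z * (v z * v z) \<partial>D) else 1)"
      by (intro prod.cong) (auto simp: f_def Ew)
    also have "\<dots> = (\<integral>z. w z * (v z * v z) \<partial>D)"
      using that by simp
    finally show ?thesis
      using that Ewvv by (simp add: int_eq)
  qed
  have expand: "W \<rho> M \<omega> * (X M \<omega> - c * \<rho>)\<^sup>2 =
      (\<Sum>k<M. \<Sum>l<M. W \<rho> M \<omega> * (v (\<omega> k) * v (\<omega> l))) / M\<^sup>2" for \<omega>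
  proof -
    have "X M \<omega> - c * \<rho> = (\<Sum>k<M. v (\<omega> k)) / M"
      using M by (simp add: X_def v_def sum_subtractf diff_divide_distrib)
    then have "(X M \<omega> - c * \<rho>)\<^sup>2 = (\<Sum>k<M. \<Sum>l<M. v (\<omega> k) * v (\<omega> l)) / M\<^sup>2"
      by (simp add: power_divide power2_eq_square sum_product)
    then show ?thesis
      by (simp add: sum_distrib_left)
  qed
  show "integrable (Q M) (\<lambda>\<omega>. W \<rho> M \<omega> * (X M \<omega> - c * \<rho>)\<^sup>2)"
    unfolding expand by (intro integrable_divide_zero Bochner_Integration.integrable_sum int_Q) auto
  have "(\<integral>\<omega>. W \<rho> M \<omega> * (X M \<omega> - c * \<rho>)\<^sup>2 \<partial>Q M) =
      (\<Sum>k<M. \<Sum>l<M. \<integral>\<omega>. W \<rho> M \<omega> * (v (\<omega> k) * v (\<omega> l)) \<partial>Q M) / M\<^sup>2"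
  proof -
    have "(\<integral>\<omega>. (\<Sum>k<M. \<Sum>l<M. W \<rho> M \<omega> * (v (\<omega> k) * v (\<omega> l))) \<partial>Q M) =
        (\<Sum>k<M. \<integral>\<omega>. (\<Sum>l<M. W \<rho> M \<omega> * (v (\<omega> k) * v (\<omega> l))) \<partial>Q M)"
      by (rule Bochner_Integration.integral_sum)
        (intro Bochner_Integration.integrable_sum int_Q; simp)
    also have "\<dots> = (\<Sum>k<M. \<Sum>l<M. \<integral>\<omega>. W \<rho> M \<omega> * (v (\<omega> k) * v (\<omega> l)) \<partial>Q M)"
      by (intro sum.cong refl Bochner_Integration.integral_sum int_Q) auto
    finally show ?thesis
      unfolding expand by simp
  qed
  also have "(\<Sum>k<M. \<Sum>l<M. \<integral>\<omega>. W \<rho> M \<omega> * (v (\<omega> k) * v (\<omega> l)) \<partial>Q M) \<le> (\<Sum>k<M. \<Sum>l<M. if l = k then 4 else 0)"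
    using E0 E1 by (intro sum_mono) auto
  also have "\<dots> = 4 * real M"
    by simp
  finally show "(\<integral>\<omega>. W \<rho> M \<omega> * (X M \<omega> - c * \<rho>)\<^sup>2 \<partial>Q M) \<le> 4 / M"
    using M by (simp add: divide_right_mono power2_eq_square)
qed

lemma W_nonneg: "\<bar>\<rho>\<bar> \<le> 1 \<Longrightarrow> 0 \<le> W \<rho> M \<omega>"
  unfolding W_def by (intro prod_nonneg weight_bounds) auto

lemma nn_integral_weight:
  assumes "\<bar>\<rho>\<bar> \<le> 1"
  shows "(\<integral>\<^sup>+z. ennreal (1 + \<rho> * \<tau> z) \<partial>D) = 1"
proof -
  have "(\<integral>\<^sup>+z. ennreal (1 + \<rho> * \<tau> z) \<partial>D) = ennreal (\<integral>z. 1 + \<rho> * \<tau> z \<partial>D)"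
    using integrable_coordinate weight_bounds [OF assms]
    by (intro nn_integral_eq_integral) auto
  then show ?thesis
    using integrable_coordinate expectation_\<tau> by (simp add: prob_space)
qed

lemma nn_integral_W:
  assumes "\<bar>\<rho>\<bar> \<le> 1"
  shows "(\<integral>\<^sup>+\<omega>. ennreal (W \<rho> M \<omega>) \<partial>Q M) = 1"
proof -
  have "(\<integral>\<^sup>+\<omega>. ennreal (W \<rho> M \<omega>) \<partial>Q M) = (\<integral>\<^sup>+\<omega>. (\<Prod>k<M. ennreal (1 + \<rho> * \<tau> (\<omega> k))) \<partial>Q M)"
    using weight_bounds [OF assms] by (simp add: W_def prod_ennreal)
  also have "\<dots> = (\<Prod>k<M. \<integral>\<^sup>+z. ennreal (1 + \<rho> * \<tau> z) \<partial>D)"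
    unfolding Q_def by (rule D.product_nn_integral_prod) auto
  finally show ?thesis
    by (simp add: nn_integral_weight [OF assms])
qed

lemma integrable_W: "\<bar>\<rho>\<bar> \<le> 1 \<Longrightarrow> integrable (Q M) (W \<rho> M)"
  and integral_W: "\<bar>\<rho>\<bar> \<le> 1 \<Longrightarrow> (\<integral>\<omega>. W \<rho> M \<omega> \<partial>Q M) = 1"
  using nn_integral_W [of \<rho> M] W_nonneg [of \<rho> M]
  by (simp_all add: integrable_iff_bounded integral_eq_nn_integral)

text \<open>
  The factor of \<open>inverse_mean_power_le\<close> for one coordinate, with the value \<open>\<infinity>\<close> in the
  singular case, where \<open>powr\<close> has the value 0.
\<close>

definition "H q M z = (if (y z)\<^sup>2 < 1 then ennreal (1 + 4 * real q / M * (1 - (y z)\<^sup>2) powr (- 1 / 4)) else \<infinity>)"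
  for q M :: nat

lemma measurable_H [measurable]: "H q M \<in> borel_measurable D"
  unfolding H_def by measurable

lemma inverse_mean_le_prod_H:
  assumes M: "4 * q \<le> M" "0 < M"
  shows "inverse (ennreal ((\<Sum>k<M. 1 - (y (\<omega> k))\<^sup>2) / M)) ^ q \<le> (\<Prod>k<M. H q M (\<omega> k))"
proof (cases "\<forall>k<M. (y (\<omega> k))\<^sup>2 < 1")
  let ?S = "(\<Sum>k<M. 1 - (y (\<omega> k))\<^sup>2) / M"
  case True
  then have pos: "0 < ?S"
    using M by (intro divide_pos_pos sum_pos) auto
  then have "inverse (ennreal (?S)) ^ q =
      ennreal (inverse (?S) ^ q)"
    by (simp add: inverse_ennreal ennreal_power del: inverse_divide)
  also have "\<dots> \<le> ennreal (\<Prod>k<M. 1 + 4 * real q / M * (1 - (y (\<omega> k))\<^sup>2) powr (- 1 / 4))"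
    using True M by (intro ennreal_leI inverse_mean_power_le) auto
  also have "\<dots> = (\<Prod>k<M. ennreal (1 + 4 * real q / M * (1 - (y (\<omega> k))\<^sup>2) powr (- 1 / 4)))"
    by (intro prod_ennreal [symmetric]) simp
  also have "\<dots> = (\<Prod>k<M. H q M (\<omega> k))"
    using True by (simp add: H_def)
  finally show ?thesis .
next
  case False
  then have "(\<Prod>k<M. H q M (\<omega> k)) = top"
    by (auto simp: ennreal_prod_eq_top H_def ennreal_eq_0_iff not_le add_pos_nonneg)
  then show ?thesis
    by simp
qed

lemma mean_le_1_minus_X:
  assumes "0 < M"
  shows "(\<Sum>k<M. 1 - (y (\<omega> k))\<^sup>2) / M \<le> 1 - (X M \<omega>)\<^sup>2"
proof -
  have "(\<Sum>k<M. y (\<omega> k))\<^sup>2 \<le> real M * (\<Sum>k<M. (y (\<omega> k))\<^sup>2)"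
    using Cauchy_Schwarz_ineq_sum [of "\<lambda>_. 1" "\<lambda>k. y (\<omega> k)" "{..<M}"] by simp
  then have "(X M \<omega>)\<^sup>2 \<le> (\<Sum>k<M. (y (\<omega> k))\<^sup>2) / M"
    using assms by (simp add: X_def power_divide power2_eq_square divide_simps mult.commute)
  then show ?thesis
    using assms by (simp add: sum_subtractf diff_divide_distrib)
qed

text \<open>
  The integrand is bounded by a product over the coordinates; each factor has integral at most
  \<open>1 + 8 * q * K / M\<close>, and the \<open>M\<close>-th power of this is bounded.
\<close>

lemma nn_integral_singular:
  assumes \<rho>: "\<bar>\<rho>\<bar> \<le> 1" and M: "4 * q \<le> M" "0 < M"
  shows "(\<integral>\<^sup>+\<omega>. ennreal (W \<rho> M \<omega>) * inverse (ennreal (1 - (X M \<omega>)\<^sup>2)) ^ q \<partial>Q M) \<le> ennreal (exp (8 * real q * K))"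
proof -
  let ?R = "\<lambda>\<omega>. inverse (ennreal (1 - (X M \<omega>)\<^sup>2)) ^ q"
  let ?c = "4 * real q / M"
  have "(\<integral>\<^sup>+\<omega>. ennreal (W \<rho> M \<omega>) * ?R \<omega> \<partial>Q M) \<le>
      (\<integral>\<^sup>+\<omega>. (\<Prod>k<M. ennreal (1 + \<rho> * \<tau> (\<omega> k)) * H q M (\<omega> k)) \<partial>Q M)"
  proof (rule nn_integral_mono)
    fix \<omega>
    have "?R \<omega> \<le> inverse (ennreal ((\<Sum>k<M. 1 - (y (\<omega> k))\<^sup>2) / M)) ^ q"
      using mean_le_1_minus_X [OF M(2)] by (intro power_mono inverse_ennreal_antimono) auto
    also have "\<dots> \<le> (\<Prod>k<M. H q M (\<omega> k))"
      by (rule inverse_mean_le_prod_H [OF M])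
    finally have "ennreal (W \<rho> M \<omega>) * ?R \<omega> \<le>
        ennreal (W \<rho> M \<omega>) * (\<Prod>k<M. H q M (\<omega> k))"
      by (rule mult_left_mono) simp
    then show "ennreal (W \<rho> M \<omega>) * ?R \<omega> \<le>
        (\<Prod>k<M. ennreal (1 + \<rho> * \<tau> (\<omega> k)) * H q M (\<omega> k))"
      using weight_bounds [OF \<rho>] by (simp add: W_def prod.distrib prod_ennreal)
  qed
  also have "\<dots> = (\<Prod>k<M. \<integral>\<^sup>+z. ennreal (1 + \<rho> * \<tau> z) * H q M z \<partial>D)"
    unfolding Q_def by (rule D.product_nn_integral_prod) auto
  also have "\<dots> \<le> (\<Prod>k<M. ennreal (1 + 2 * ?c * K))"
  proof -
    have "(\<integral>\<^sup>+z. ennreal (1 + \<rho> * \<tau> z) * H q M z \<partial>D) \<le>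
        (\<integral>\<^sup>+z. ennreal (1 + \<rho> * \<tau> z) + ennreal (2 * ?c) * ennreal ((1 - (y z)\<^sup>2) powr (- 1 / 4)) \<partial>D)"
    proof (rule nn_integral_mono_AE, use y_less in eventually_elim)
      fix z
      assume z: "(y z)\<^sup>2 < 1"
      let ?p = "(1 - (y z)\<^sup>2) powr (- 1 / 4)"
      have "(1 + \<rho> * \<tau> z) * (?c * ?p) \<le> 2 * (?c * ?p)"
        using weight_bounds [OF \<rho>] by (intro mult_right_mono) auto
      then have "(1 + \<rho> * \<tau> z) * (1 + ?c * ?p) \<le> (1 + \<rho> * \<tau> z) + 2 * ?c * ?p"
        by (simp add: algebra_simps)
      then have "ennreal ((1 + \<rho> * \<tau> z) * (1 + ?c * ?p)) \<le> ennreal ((1 + \<rho> * \<tau> z) + 2 * ?c * ?p)"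
        by (rule ennreal_leI)
      also have "\<dots> = ennreal (1 + \<rho> * \<tau> z) + ennreal (2 * ?c) * ennreal ?p"
        using weight_bounds [OF \<rho>, of z] by (simp flip: ennreal_mult')
      finally show "ennreal (1 + \<rho> * \<tau> z) * H q M z \<le> ennreal (1 + \<rho> * \<tau> z) + ennreal (2 * ?c) * ennreal ?p"
        using z weight_bounds [OF \<rho>, of z] by (simp add: H_def ennreal_mult)
    qed
    also have "\<dots> = 1 + ennreal (2 * ?c) * (\<integral>\<^sup>+z. ennreal ((1 - (y z)\<^sup>2) powr (- 1 / 4)) \<partial>D)"
      by (simp add: nn_integral_add nn_integral_cmult nn_integral_weight [OF \<rho>])
    also have "\<dots> \<le> 1 + ennreal (2 * ?c) * ennreal K"
      by (intro add_left_mono mult_left_mono singular) simp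
    also have "\<dots> = ennreal (1 + 2 * ?c * K)"
      using K_nonneg by (simp flip: ennreal_mult' ennreal_1)
    finally have "(\<integral>\<^sup>+z. ennreal (1 + \<rho> * \<tau> z) * H q M z \<partial>D) \<le> ennreal (1 + 2 * ?c * K)" .
    then show ?thesis
      unfolding prod_constant by (rule power_mono) simp
  qed
  also have "\<dots> = ennreal ((1 + 2 * ?c * K) ^ M)"
    unfolding prod_constant card_lessThan by (rule ennreal_power) (use K_nonneg in simp)
  also have "\<dots> \<le> ennreal (exp (8 * real q * K))"
  proof (rule ennreal_leI)
    have "(1 + 2 * ?c * K) ^ M \<le> exp (2 * ?c * K) ^ M"
      using K_nonneg exp_ge_add_one_self [of "2 * ?c * K"] by (intro power_mono) auto
    also have "\<dots> = exp (8 * real q * K)"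
      using M by (simp flip: exp_of_nat_mult)
    finally show "(1 + 2 * ?c * K) ^ M \<le> exp (8 * real q * K)" .
  qed
  finally show ?thesis .
qed

lemma X_square_le: "(X M \<omega>)\<^sup>2 \<le> 1"
  using abs_X_le by (simp add: abs_square_le_1)

context
  fixes g :: "real \<Rightarrow> real" and C :: real and m :: nat
  assumes g_measurable [measurable]: "g \<in> borel_measurable borel"
    and g_cont: "continuous_on {0..<1} g"
    and g_bound: "\<And>u. 0 \<le> u \<Longrightarrow> u < 1 \<Longrightarrow> \<bar>g u\<bar> \<le> C * inverse (1 - u) ^ m"
    and C: "0 < C" and m: "0 < m"
begin

lemma integrable_weighted:
  assumes \<rho>: "\<bar>\<rho>\<bar> \<le> 1" and M: "4 * m \<le> M" "0 < M"
  shows "integrable (Q M) (\<lambda>\<omega>. W \<rho> M \<omega> * g ((X M \<omega>)\<^sup>2))"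
proof (rule integrableI_bounded)
  let ?F = "\<lambda>\<omega>. ennreal (norm (W \<rho> M \<omega> * g ((X M \<omega>)\<^sup>2)))"
  let ?R = "\<lambda>\<omega>. inverse (ennreal (1 - (X M \<omega>)\<^sup>2)) ^ m"
  have "(\<integral>\<^sup>+\<omega>. ?F \<omega> \<partial>Q M) \<le>
    (\<integral>\<^sup>+\<omega>. ennreal C * (ennreal (W \<rho> M \<omega>) * ?R \<omega>) \<partial>Q M)"
  proof (rule nn_integral_mono)
    fix \<omega>
    have "?F \<omega> = ennreal (W \<rho> M \<omega>) * ennreal \<bar>g ((X M \<omega>)\<^sup>2)\<bar>"
      using W_nonneg [OF \<rho>] by (simp add: abs_mult ennreal_mult)
    also have "\<dots> \<le> ennreal (W \<rho> M \<omega>) * (ennreal C * ?R \<omega>)"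
      using X_square_le by (intro mult_left_mono singular_bound_ennreal [OF g_bound C m]) auto
    finally show "?F \<omega> \<le>
        ennreal C * (ennreal (W \<rho> M \<omega>) * ?R \<omega>)"
      by (simp add: mult.left_commute)
  qed
  also have "\<dots> = ennreal C * (\<integral>\<^sup>+\<omega>. ennreal (W \<rho> M \<omega>) * ?R \<omega> \<partial>Q M)"
    by (rule nn_integral_cmult) measurable
  also have "\<dots> \<le> ennreal C * ennreal (exp (8 * real m * K))"
    by (rule mult_left_mono [OF nn_integral_singular [OF \<rho> M]]) simp
  also have "\<dots> < \<infinity>"
    by (simp add: ennreal_mult_less_top)
  finally show "(\<integral>\<^sup>+\<omega>. ?F \<omega> \<partial>Q M) < \<infinity>" .
qed measurable

text \<open>
  With \<open>r = (1 - x\<^sup>2) ^ (- m)\<close> the error term \<open>(x - x0)\<^sup>2 * r\<close> is at most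
  \<open>s * (x - x0) ^ 4 + r\<^sup>2 / s\<close>. The choice \<open>s = sqrt M\<close> balances the second moment, of order
  \<open>1 / M\<close>, against the uniformly bounded mean of \<open>r\<^sup>2\<close>.
\<close>

lemma deviation_le:
  assumes \<rho>: "\<bar>\<rho>\<bar> \<le> 1" and M: "8 * m \<le> M" "0 < M"
    and e: "0 \<le> e" and D: "0 < E"
    "\<And>x. x\<^sup>2 < 1 \<Longrightarrow> \<bar>g (x\<^sup>2) - g ((c * \<rho>)\<^sup>2)\<bar> \<le> e + E * ((x - c * \<rho>)\<^sup>2 * inverse (1 - x\<^sup>2) ^ m)"
  shows "\<bar>(\<integral>\<omega>. W \<rho> M \<omega> * g ((X M \<omega>)\<^sup>2) \<partial>Q M) - g ((c * \<rho>)\<^sup>2)\<bar> \<le>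
    e + E * (16 + exp (16 * real m * K)) / sqrt M"
proof -
  let ?G = "\<lambda>\<omega>. g ((X M \<omega>)\<^sup>2)"
  let ?v = "\<lambda>x. (x - c * \<rho>)\<^sup>2"
  let ?V = "\<lambda>\<omega>. (X M \<omega> - c * \<rho>)\<^sup>2"
  define s where "s = sqrt (real M)"
  let ?g0 = "g ((c * \<rho>)\<^sup>2)"
  let ?R = "\<lambda>\<omega>. inverse (ennreal (1 - (X M \<omega>)\<^sup>2)) ^ (2 * m)"
  have s: "0 < s" and s_sq: "s * s = real M"
    using M by (simp_all add: s_def)
  have x0: "\<bar>c * \<rho>\<bar> \<le> 1"
    using abs_c_le \<rho> by (simp add: abs_mult mult_le_one)
  have pointwise: "ennreal \<bar>?G \<omega> - ?g0\<bar> \<le>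
      ennreal e + (ennreal (E * 4 * s) * ennreal (?V \<omega>) + ennreal (E / s) * ?R \<omega>)" for \<omega>
  proof (cases "(X M \<omega>)\<^sup>2 < 1")
    case True
    define x r where "x = X M \<omega>" and "r = inverse (1 - x\<^sup>2) ^ m"
    have r: "0 \<le> r"
      using True by (simp add: r_def x_def)
    have "?v x \<le> 4"
      using abs_X_le [of M \<omega>] x0 power_mono [of "\<bar>x - c * \<rho>\<bar>" 2 2] by (simp add: x_def abs_le_iff)
    then have fourth: "?v x * ?v x \<le> 4 * ?v x"
      by (intro mult_right_mono) auto
    have amgm: "2 * (a * b) \<le> a * a + b * b" for a b :: real
      using sum_squares_bound [of a b] by (simp add: power2_eq_square)
    have "2 * s * (?v x * r) \<le> s * s * (?v x * ?v x) + r * r"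
      using amgm [of "s * ?v x" r] by (simp add: mult_ac)
    also have "\<dots> \<le> s * s * (4 * ?v x) + r * r"
      by (intro add_right_mono mult_left_mono fourth) simp
    finally have "?v x * r \<le> (4 * s * ?v x + r\<^sup>2 / s) / 2"
      using s by (simp add: field_simps power2_eq_square [of r])
    also have "\<dots> \<le> 4 * s * ?v x + r\<^sup>2 / s"
    proof -
      have half: "a / 2 \<le> a" if "0 \<le> a" for a :: real
        using that by simp
      show ?thesis
        by (rule half) (use s in simp)
    qed
    finally have "E * (?v x * r) \<le> E * (4 * s * ?v x + r\<^sup>2 / s)"
      using D by (intro mult_left_mono) auto
    then have "\<bar>g (x\<^sup>2) - ?g0\<bar> \<le> e + (E * 4 * s * ?v x + E / s * r\<^sup>2)"
      using D(2) [of x] True by (simp add: x_def r_def algebra_simps)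
    then have "ennreal \<bar>g (x\<^sup>2) - ?g0\<bar> \<le> ennreal (e + (E * 4 * s * ?v x + E / s * r\<^sup>2))"
      by (rule ennreal_leI)
    also have "\<dots> = ennreal e + (ennreal (E * 4 * s) * ennreal (?v x) + ennreal (E / s) * ennreal (r\<^sup>2))"
      using e D(1) s by (simp flip: ennreal_mult)
    also have "ennreal (r\<^sup>2) = ?R \<omega>"
      using True by (simp add: r_def x_def inverse_ennreal ennreal_power power_mult mult.commute [of 2 m] flip: power_mult)
    finally show ?thesis
      by (simp add: x_def)
  next
    case False
    then have "ennreal (E / s) * ?R \<omega> = top"
      using m D s by (simp add: ennreal_mult_top power_0_left ennreal_top_mult top_power_ennreal ennreal_neg)
    then show ?thesis
      by simp
  qed
  have int: "integrable (Q M) (\<lambda>\<omega>. W \<rho> M \<omega> * ?G \<omega>)"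
    by (rule integrable_weighted) (use \<rho> M in auto)
  let ?F = "\<lambda>\<omega>. W \<rho> M \<omega> * (?G \<omega> - ?g0)"
  have int_F: "integrable (Q M) ?F"
    using int integrable_W [OF \<rho>] by (simp add: right_diff_distrib)
  have "ennreal \<bar>(\<integral>\<omega>. W \<rho> M \<omega> * ?G \<omega> \<partial>Q M) - ?g0\<bar> = ennreal \<bar>\<integral>\<omega>. ?F \<omega> \<partial>Q M\<bar>"
    using int integrable_W [OF \<rho>] integral_W [OF \<rho>] by (simp add: right_diff_distrib)
  also have "\<dots> \<le> (\<integral>\<^sup>+\<omega>. ennreal (norm (?F \<omega>)) \<partial>Q M)"
    using integral_norm_bound_ennreal [OF int_F] by simp
  also have "\<dots> \<le> (\<integral>\<^sup>+\<omega>. ennreal e * ennreal (W \<rho> M \<omega>) +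
      (ennreal (E * 4 * s) * ennreal (W \<rho> M \<omega> * ?V \<omega>) +
       ennreal (E / s) * (ennreal (W \<rho> M \<omega>) * ?R \<omega>)) \<partial>Q M)"
  proof (rule nn_integral_mono)
    fix \<omega>
    have "ennreal (norm (?F \<omega>)) = ennreal (W \<rho> M \<omega>) * ennreal \<bar>?G \<omega> - ?g0\<bar>"
      using W_nonneg [OF \<rho>] by (simp add: abs_mult ennreal_mult)
    also have "\<dots> \<le> ennreal (W \<rho> M \<omega>) * (ennreal e +
        (ennreal (E * 4 * s) * ennreal (?V \<omega>) + ennreal (E / s) * ?R \<omega>))"
      by (intro mult_left_mono pointwise) simp
    finally show "ennreal (norm (?F \<omega>)) \<le> ennreal e * ennreal (W \<rho> M \<omega>) +
      (ennreal (E * 4 * s) * ennreal (W \<rho> M \<omega> * ?V \<omega>) +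
       ennreal (E / s) * (ennreal (W \<rho> M \<omega>) * ?R \<omega>))"
      using W_nonneg [OF \<rho>, of M \<omega>] by (simp add: ennreal_mult distrib_left mult_ac)
  qed
  also have "\<dots> = ennreal e + (ennreal (E * 4 * s) * (\<integral>\<^sup>+\<omega>. ennreal (W \<rho> M \<omega> * ?V \<omega>) \<partial>Q M) +
       ennreal (E / s) * (\<integral>\<^sup>+\<omega>. ennreal (W \<rho> M \<omega>) * ?R \<omega> \<partial>Q M))"
    by (simp add: nn_integral_add nn_integral_cmult nn_integral_W [OF \<rho>])
  also have "\<dots> \<le> ennreal e + (ennreal (E * 4 * s) * ennreal (4 / M) + ennreal (E / s) * ennreal (exp (8 * real (2 * m) * K)))"
  proof (intro add_left_mono add_mono mult_left_mono)
    have "(\<integral>\<^sup>+\<omega>. ennreal (W \<rho> M \<omega> * ?V \<omega>) \<partial>Q M) = ennreal (\<integral>\<omega>. W \<rho> M \<omega> * ?V \<omega> \<partial>Q M)"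
      using W_nonneg [OF \<rho>] by (intro nn_integral_eq_integral second_moment \<rho> M) auto
    also have "\<dots> \<le> ennreal (4 / M)"
      by (intro ennreal_leI second_moment \<rho> M)
    finally show "(\<integral>\<^sup>+\<omega>. ennreal (W \<rho> M \<omega> * ?V \<omega>) \<partial>Q M) \<le> ennreal (4 / M)" .
    show "(\<integral>\<^sup>+\<omega>. ennreal (W \<rho> M \<omega>) * ?R \<omega> \<partial>Q M) \<le> ennreal (exp (8 * real (2 * m) * K))"
      using nn_integral_singular [OF \<rho>, of "2 * m" M] M by simp
  qed simp_all
  also have "\<dots> = ennreal (e + (E * 4 * s * (4 / M) + E / s * exp (8 * real (2 * m) * K)))"
    using e D(1) s by (simp flip: ennreal_mult)
  also have "e + (E * 4 * s * (4 / M) + E / s * exp (8 * real (2 * m) * K)) = e + E * (16 + exp (16 * real m * K)) / s"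
  proof -
    have "E * 4 * s * (4 / M) = E * 16 / s"
      using s unfolding s_sq [symmetric] by (simp add: field_simps)
    then show ?thesis
      by (simp add: distrib_left add_divide_distrib)
  qed
  finally have le: "ennreal \<bar>(\<integral>\<omega>. W \<rho> M \<omega> * ?G \<omega> \<partial>Q M) - ?g0\<bar> \<le>
      ennreal (e + E * (16 + exp (16 * real m * K)) / s)" .
  have nonneg: "0 \<le> e + E * (16 + exp (16 * real m * K)) / s"
    using e D(1) s by simp
  show ?thesis
    using le unfolding ennreal_le_iff [OF nonneg] by (simp only: s_def)
qed

text \<open>
  The law of large numbers for the tilted law and the singular function \<open>g\<close>.
\<close>

lemma weighted_mean_tendsto:
  assumes \<rho>: "\<bar>\<rho>\<bar> \<le> 1" and x0: "(c * \<rho>)\<^sup>2 < 1"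
  shows "(\<lambda>M. \<integral>\<omega>. W \<rho> M \<omega> * g ((X M \<omega>)\<^sup>2) \<partial>Q M) \<longlonglongrightarrow> g ((c * \<rho>)\<^sup>2)"
proof (rule tendstoI)
  fix e :: real
  assume "0 < e"
  then have e: "0 < e / 2"
    by simp
  obtain E where E: "0 < E"
    "\<And>x. x\<^sup>2 < 1 \<Longrightarrow> \<bar>g (x\<^sup>2) - g ((c * \<rho>)\<^sup>2)\<bar> \<le> e / 2 + E * ((x - c * \<rho>)\<^sup>2 * inverse (1 - x\<^sup>2) ^ m)"
    by (rule singular_modulus [OF g_cont g_bound x0 e]) auto
  let ?B = "E * (16 + exp (16 * real m * K))"
  have "(\<lambda>M. ?B / sqrt (real M)) \<longlonglongrightarrow> 0"
    by (intro tendsto_divide_0 [OF tendsto_const] filterlim_at_top_imp_at_infinity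
        filterlim_compose [OF sqrt_at_top] filterlim_real_sequentially)
  then have "\<forall>\<^sub>F M in sequentially. ?B / sqrt (real M) < e / 2"
    using e by (rule order_tendstoD)
  moreover have "\<forall>\<^sub>F M in sequentially. 8 * m \<le> M"
    by (rule eventually_ge_at_top)
  moreover have "\<forall>\<^sub>F M in sequentially. (0::nat) < M"
    by (rule eventually_gt_at_top)
  ultimately show "\<forall>\<^sub>F M in sequentially. dist (\<integral>\<omega>. W \<rho> M \<omega> * g ((X M \<omega>)\<^sup>2) \<partial>Q M) (g ((c * \<rho>)\<^sup>2)) < e"
  proof eventually_elim
    case (elim M)
    have "\<bar>(\<integral>\<omega>. W \<rho> M \<omega> * g ((X M \<omega>)\<^sup>2) \<partial>Q M) - g ((c * \<rho>)\<^sup>2)\<bar> \<le> e / 2 + ?B / sqrt (real M)"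
      using deviation_le [OF \<rho> elim(2) elim(3) less_imp_le [OF e] E] by simp
    with elim(1) show ?case
      unfolding dist_real_def by linarith
  qed
qed

end

end

section \<open>Sign moments as coefficients\<close>

context coordinate
begin

lemma W_expand: "W \<rho> M \<omega> = (\<Sum>S\<in>Pow {..<M}. \<rho> ^ card S * (\<Prod>k\<in>S. \<tau> (\<omega> k)))"
proof -
  have "W \<rho> M \<omega> = (\<Prod>k<M. \<rho> * \<tau> (\<omega> k) + 1)"
    by (simp add: W_def add.commute)
  also have "\<dots> = (\<Sum>S\<in>Pow {..<M}. (\<Prod>k\<in>S. \<rho> * \<tau> (\<omega> k)) * (\<Prod>k\<in>{..<M} - S. 1))"
    by (rule prod_add) simp
  finally show ?thesis
    by (simp add: prod.distrib)
qed

definition "sign_moment g M S = (\<integral>\<omega>. (\<Prod>k\<in>S. \<tau> (\<omega> k)) * g ((X M \<omega>)\<^sup>2) \<partial>Q M)"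
  for g :: "real \<Rightarrow> real" and M :: nat

definition "coefficient g M j = (\<Sum>S\<in>{S \<in> Pow {..<M}. card S = 2 * j}. sign_moment g M S)"
  for g :: "real \<Rightarrow> real" and M j :: nat

text \<open>
  Averaging over \<open>\<rho>\<close> and \<open>- \<rho>\<close> removes the odd sets from the expansion of \<open>W\<close>, so the result
  is a polynomial in \<open>\<rho>\<^sup>2\<close>.
\<close>

lemma coefficient_sums:
  fixes g :: "real \<Rightarrow> real"
  assumes g [measurable]: "g \<in> borel_measurable borel" and int: "integrable (Q M) (\<lambda>\<omega>. g ((X M \<omega>)\<^sup>2))"
  shows "(\<lambda>j. coefficient g M j * (\<rho>\<^sup>2) ^ j) sums
    (((\<integral>\<omega>. W \<rho> M \<omega> * g ((X M \<omega>)\<^sup>2) \<partial>Q M) + (\<integral>\<omega>. W (- \<rho>) M \<omega> * g ((X M \<omega>)\<^sup>2) \<partial>Q M)) / 2)"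
proof -
  let ?T = "\<lambda>S \<omega>. (\<Prod>k\<in>S. \<tau> (\<omega> k))"
  let ?G = "\<lambda>\<omega>. g ((X M \<omega>)\<^sup>2)"
  have int_S: "integrable (Q M) (\<lambda>\<omega>. ?T S \<omega> * ?G \<omega>)" if S: "S \<in> Pow {..<M}" for S
  proof (rule Bochner_Integration.integrable_bound [OF int])
    have "(\<lambda>\<omega>. \<Prod>k\<in>S. \<tau> (\<omega> k)) \<in> borel_measurable (Q M)"
    proof (rule borel_measurable_prod)
      fix k
      assume "k \<in> S"
      then have "(\<lambda>\<omega>. \<omega> k) \<in> measurable (Q M) D"
        unfolding Q_def using S by (intro measurable_component_singleton) auto
      from measurable_compose [OF this measurable_\<tau>]
      show "(\<lambda>\<omega>. \<tau> (\<omega> k)) \<in> borel_measurable (Q M)" .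
    qed
    then show "(\<lambda>\<omega>. ?T S \<omega> * ?G \<omega>) \<in> borel_measurable (Q M)"
      by measurable
    have "\<bar>\<Prod>k\<in>S. \<tau> (\<omega> k)\<bar> \<le> 1" for \<omega>
      unfolding abs_prod by (rule prod_le_1) (simp add: \<tau>_le)
    then show "AE \<omega> in Q M. norm (?T S \<omega> * ?G \<omega>) \<le> norm (?G \<omega>)"
      by (intro AE_I2) (simp add: abs_mult mult_left_le_one_le)
  qed
  have expand: "(\<integral>\<omega>. W r M \<omega> * ?G \<omega> \<partial>Q M) = (\<Sum>S\<in>Pow {..<M}. r ^ card S * sign_moment g M S)" for r
  proof -
    have "(\<integral>\<omega>. W r M \<omega> * ?G \<omega> \<partial>Q M) =
        (\<integral>\<omega>. (\<Sum>S\<in>Pow {..<M}. r ^ card S * (?T S \<omega> * ?G \<omega>)) \<partial>Q M)"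
      by (simp add: W_expand sum_distrib_right mult.assoc)
    also have "\<dots> = (\<Sum>S\<in>Pow {..<M}. \<integral>\<omega>. r ^ card S * (?T S \<omega> * ?G \<omega>) \<partial>Q M)"
      by (intro Bochner_Integration.integral_sum integrable_mult_right int_S)
    finally show ?thesis
      by (simp add: sign_moment_def)
  qed
  let ?E = "{S \<in> Pow {..<M}. even (card S)}"
  have "((\<integral>\<omega>. W \<rho> M \<omega> * ?G \<omega> \<partial>Q M) + (\<integral>\<omega>. W (- \<rho>) M \<omega> * ?G \<omega> \<partial>Q M)) / 2 =
      (\<Sum>S\<in>Pow {..<M}. if even (card S) then \<rho> ^ card S * sign_moment g M S else 0)"
    unfolding expand sum.distrib [symmetric] sum_divide_distrib by (intro sum.cong) auto
  also have "\<dots> = (\<Sum>S\<in>?E. \<rho> ^ card S * sign_moment g M S)"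
    by (rule sum.inter_filter [symmetric]) simp
  also have "\<dots> = (\<Sum>j\<le>M. \<Sum>S\<in>{S \<in> ?E. card S div 2 = j}. \<rho> ^ card S * sign_moment g M S)"
  proof (rule sum.group [symmetric])
    show "(\<lambda>S. card S div 2) ` ?E \<subseteq> {..M}"
    proof (rule image_subsetI)
      fix S
      assume "S \<in> ?E"
      then have "card S \<le> M"
        using card_mono [of "{..<M}" S] by simp
      then show "card S div 2 \<in> {..M}"
        using div_le_dividend [of "card S" 2] by (simp add: order_trans)
    qed
  qed auto
  also have "\<dots> = (\<Sum>j\<le>M. coefficient g M j * (\<rho>\<^sup>2) ^ j)"
  proof (rule sum.cong)
    fix j
    have "(\<Sum>S\<in>{S \<in> ?E. card S div 2 = j}. \<rho> ^ card S * sign_moment g M S) =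
        (\<Sum>S\<in>{S \<in> Pow {..<M}. card S = 2 * j}. sign_moment g M S * (\<rho>\<^sup>2) ^ j)"
      by (rule sum.cong) (auto simp: mult.commute simp flip: power_mult)
    then show "(\<Sum>S\<in>{S \<in> ?E. card S div 2 = j}. \<rho> ^ card S * sign_moment g M S) = coefficient g M j * (\<rho>\<^sup>2) ^ j"
      by (simp only: coefficient_def sum_distrib_right)
  qed simp
  finally have eq: "((\<integral>\<omega>. W \<rho> M \<omega> * ?G \<omega> \<partial>Q M) + (\<integral>\<omega>. W (- \<rho>) M \<omega> * ?G \<omega> \<partial>Q M)) / 2 =
      (\<Sum>j\<le>M. coefficient g M j * (\<rho>\<^sup>2) ^ j)" .
  have "coefficient g M j = 0" if j: "j \<notin> {..M}" for j
  proof -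
    have "card S \<noteq> 2 * j" if "S \<subseteq> {..<M}" for S
      using card_mono [of "{..<M}" S] that j by simp
    then have "{S \<in> Pow {..<M}. card S = 2 * j} = {}"
      by auto
    then show ?thesis
      unfolding coefficient_def by (simp only: sum.empty)
  qed
  then show ?thesis
    unfolding eq by (intro sums_finite) auto
qed

end

section \<open>The law of two antipodal arcs\<close>

text \<open>
  Maps \<open>[-1, 1]\<close> to the two arcs. The sign of \<open>t\<close> selects the arc, so that the reflection
  \<open>t \<mapsto> - t\<close> becomes the antipodal map.
\<close>

definition tilt :: "real \<Rightarrow> real \<Rightarrow> real" where
  "tilt \<kappa> t = \<kappa> * \<bar>t\<bar> + (if t < 0 then pi else 0)"

definition arc_measure :: "real \<Rightarrow> real measure" where
  "arc_measure \<kappa> = distr (uniform_measure lborel {-1..1}) borel (tilt \<kappa>)"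

definition arc_support :: "real \<Rightarrow> real set" where
  "arc_support \<kappa> = {0..\<kappa>} \<union> {pi..pi + \<kappa>}"

lemma measurable_tilt [measurable]: "tilt \<kappa> \<in> borel_measurable borel"
  unfolding tilt_def by measurable

lemma sets_arc [simp, measurable_cong]: "sets (arc_measure \<kappa>) = sets borel"
  and space_arc [simp]: "space (arc_measure \<kappa>) = UNIV"
  by (simp_all add: arc_measure_def)

lemma prob_space_uniform: "prob_space (uniform_measure lborel {-1..1::real})"
  by (rule prob_space_uniform_measure) simp_all

lemma prob_space_arc: "prob_space (arc_measure \<kappa>)"
  unfolding arc_measure_def using prob_space_uniform by (rule prob_space.prob_space_distr) measurable

text \<open>
  By the mean value theorem and \<open>cos \<ge> 1 / 2\<close> on \<open>[0, pi / 3]\<close>, which contains \<open>[0, 1]\<close>.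
\<close>

lemma sin_lower_bound:
  assumes "\<bar>x\<bar> \<le> (1::real)"
  shows "\<bar>x\<bar> / 2 \<le> \<bar>sin x\<bar>"
proof -
  have pos: "x / 2 \<le> sin x" if x: "0 < x" "x \<le> 1" for x :: real
  proof -
    obtain z where z: "0 < z" "z < x" "sin x - sin 0 = (x - 0) * cos z"
      using MVT2 [of 0 x sin cos] x by auto
    have "cos (pi / 3) \<le> cos z"
      using z x pi_gt3 by (intro cos_monotone_0_pi_le) auto
    then have "1 / 2 \<le> cos z"
      by (simp add: cos_60)
    then have "x * (1 / 2) \<le> x * cos z"
      using x by (intro mult_left_mono) auto
    then show ?thesis
      using z by simp
  qed
  consider "x = 0" | "0 < x" | "x < 0"
    by linarith
  then show ?thesis
  proof cases
    case 2
    then show ?thesis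
      using pos [of x] assms by simp
  next
    case 3
    then show ?thesis
      using pos [of "- x"] assms by simp
  qed simp
qed

lemma AE_uniform: "AE t in lborel. P t \<Longrightarrow> AE t in uniform_measure lborel {-1..1::real}. t \<in> {-1..1} \<and> P t"
  by (rule AE_uniform_measureI) auto

lemma AE_arc_support: "0 \<le> \<kappa> \<Longrightarrow> AE t in arc_measure \<kappa>. t \<in> arc_support \<kappa>"
proof -
  assume \<kappa>: "0 \<le> \<kappa>"
  have "tilt \<kappa> t \<in> arc_support \<kappa>" if "t \<in> {-1..1}" for t
  proof -
    have "\<kappa> * \<bar>t\<bar> \<le> \<kappa> * 1" "0 \<le> \<kappa> * \<bar>t\<bar>"
      using that \<kappa> by (intro mult_left_mono mult_nonneg_nonneg; auto)+
    then show ?thesis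
      by (auto simp: tilt_def arc_support_def)
  qed
  then have "AE t in uniform_measure lborel {-1..1}. tilt \<kappa> t \<in> arc_support \<kappa>"
    using AE_uniform [of "\<lambda>_. True"] by auto
  then show ?thesis
    unfolding arc_measure_def by (subst AE_distr_iff) (auto simp: arc_support_def)
qed

text \<open>
  Read on the circle, the law is invariant under the rotation by \<open>pi\<close>. This is the source of all vanishing means.
\<close>

lemma integral_arc_antiperiodic:
  fixes F :: "real \<Rightarrow> real"
  assumes [measurable]: "F \<in> borel_measurable borel" and anti: "\<And>t. F (t + pi) = - F t"
  shows "(\<integral>t. F t \<partial>arc_measure \<kappa>) = 0"
proof -
  let ?U = "uniform_measure lborel {-1..1::real}"
  have refl: "distr ?U borel uminus = ?U"
  proof (rule measure_eqI)
    fix A :: "real set"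
    assume "A \<in> sets (distr ?U borel uminus)"
    then have A [measurable]: "A \<in> sets borel"
      by simp
    have "emeasure lborel ({-1..1} \<inter> uminus -` A) = emeasure lborel (uminus -` ({-1..1} \<inter> A) \<inter> space (lborel :: real measure))"
      by (rule arg_cong [where f = "emeasure lborel"]) auto
    also have "\<dots> = emeasure (distr lborel borel uminus) ({-1..1} \<inter> A)"
      by (rule emeasure_distr [symmetric]) auto
    also have "\<dots> = emeasure lborel ({-1..1} \<inter> A)"
      by (simp add: lborel_distr_uminus)
    moreover have "uminus -` A \<in> sets (borel :: real measure)"
      using measurable_sets [of uminus "borel :: real measure" borel A] A by simp
    ultimately show "emeasure (distr ?U borel uminus) A = emeasure ?U A"
      by (simp add: emeasure_distr)
  qed simp
  have "(\<integral>t. F t \<partial>arc_measure \<kappa>) = (\<integral>t. F (tilt \<kappa> t) \<partial>?U)"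
    unfolding arc_measure_def by (rule integral_distr) measurable
  moreover have "(\<integral>t. F (tilt \<kappa> t) \<partial>?U) = (\<integral>t. F (tilt \<kappa> (- t)) \<partial>?U)"
    by (subst refl [symmetric], rule integral_distr) measurable
  moreover have "(\<integral>t. F (tilt \<kappa> (- t)) \<partial>?U) = (\<integral>t. - F (tilt \<kappa> t) \<partial>?U)"
  proof (rule integral_cong_AE)
    have "F (tilt \<kappa> (- t)) = - F (tilt \<kappa> t)" if "t \<noteq> 0" for t
      using that anti [of "\<kappa> * \<bar>t\<bar>"] by (auto simp: tilt_def)
    then show "AE t in ?U. F (tilt \<kappa> (- t)) = - F (tilt \<kappa> t)"
      using AE_uniform [OF AE_lborel_singleton [of 0]] by auto
  qed measurable
  moreover have "(\<integral>t. - F (tilt \<kappa> t) \<partial>?U) = - (\<integral>t. F (tilt \<kappa> t) \<partial>?U)"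
    by simp
  ultimately show ?thesis
    by linarith
qed

text \<open>
  Modulo \<open>pi\<close> both arcs coincide with \<open>[0, \<kappa>]\<close>, and \<open>\<bar>sin\<bar>\<close> has period \<open>pi\<close>.
\<close>

lemma arc_sin_ge:
  assumes \<kappa>: "0 < \<kappa>" "\<kappa> \<le> 1" and b: "b \<in> arc_support \<kappa>"
  obtains \<beta> where "\<beta> \<in> {0..1}"
    "\<And>t. t \<in> {-1..1} \<Longrightarrow> \<kappa> / 2 * \<bar>\<bar>t\<bar> - \<beta>\<bar> \<le> \<bar>sin (tilt \<kappa> t - b)\<bar>"
proof -
  \<comment> \<open>the position of \<open>b\<close> on its arc, on the scale of \<open>tilt\<close>\<close>
  define \<beta> where "\<beta> = (if b \<le> \<kappa> then b else b - pi) / \<kappa>"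
  have pi: "\<kappa> < pi"
    using \<kappa> pi_gt3 by linarith
  have \<beta>: "\<beta> \<in> {0..1}"
    using b \<kappa> pi by (auto simp: \<beta>_def arc_support_def divide_le_eq le_divide_eq)
  have "\<bar>sin (tilt \<kappa> t - b)\<bar> = \<bar>sin (\<kappa> * (\<bar>t\<bar> - \<beta>))\<bar>" for t
  proof -
    have "b = \<kappa> * \<beta> \<or> b = pi + \<kappa> * \<beta>"
      using \<kappa> by (simp add: \<beta>_def)
    then have "tilt \<kappa> t - b = \<kappa> * (\<bar>t\<bar> - \<beta>) \<or> tilt \<kappa> t - b = \<kappa> * (\<bar>t\<bar> - \<beta>) + pi \<or> tilt \<kappa> t - b = \<kappa> * (\<bar>t\<bar> - \<beta>) - pi"
      by (auto simp: tilt_def right_diff_distrib)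
    moreover have "\<bar>sin (x + pi)\<bar> = \<bar>sin x\<bar>" "\<bar>sin (x - pi)\<bar> = \<bar>sin x\<bar>" for x :: real
      by (simp_all add: sin_diff)
    ultimately show ?thesis
      by metis
  qed
  moreover have "\<kappa> / 2 * \<bar>\<bar>t\<bar> - \<beta>\<bar> \<le> \<bar>sin (\<kappa> * (\<bar>t\<bar> - \<beta>))\<bar>" if "t \<in> {-1..1}" for t
  proof -
    have "\<bar>\<bar>t\<bar> - \<beta>\<bar> \<le> 1"
      using that \<beta> by auto
    then have "\<bar>\<kappa> * (\<bar>t\<bar> - \<beta>)\<bar> \<le> 1"
      using \<kappa> by (simp add: abs_mult mult_le_one)
    from sin_lower_bound [OF this] show ?thesis
      using \<kappa> by (simp add: abs_mult)
  qed
  ultimately show thesis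
    using \<beta> that by auto
qed

lemma AE_arc_sin_nonzero:
  assumes \<kappa>: "0 < \<kappa>" "\<kappa> \<le> 1" and b: "b \<in> arc_support \<kappa>"
  shows "AE t in arc_measure \<kappa>. sin (t - b) \<noteq> 0"
proof -
  obtain \<beta> where \<beta>: "\<beta> \<in> {0..1}"
    "\<And>t. t \<in> {-1..1} \<Longrightarrow> \<kappa> / 2 * \<bar>\<bar>t\<bar> - \<beta>\<bar> \<le> \<bar>sin (tilt \<kappa> t - b)\<bar>"
    by (rule arc_sin_ge [OF assms]) blast
  have "AE t in lborel. t \<noteq> \<beta> \<and> t \<noteq> - \<beta>"
    using AE_lborel_singleton [of \<beta>] AE_lborel_singleton [of "- \<beta>"] by eventually_elim simp
  then have "AE t in uniform_measure lborel {-1..1}. t \<in> {-1..1} \<and> t \<noteq> \<beta> \<and> t \<noteq> - \<beta>"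
    by (rule AE_uniform)
  then have "AE t in uniform_measure lborel {-1..1}. sin (tilt \<kappa> t - b) \<noteq> 0"
  proof eventually_elim
    case (elim t)
    then have "0 < \<kappa> / 2 * \<bar>\<bar>t\<bar> - \<beta>\<bar>"
      using \<kappa> by (auto simp: abs_if split: if_splits)
    then show ?case
      using \<beta>(2) [of t] elim by auto
  qed
  then show ?thesis
    unfolding arc_measure_def by (subst AE_distr_iff) auto
qed

lemma nn_integral_inverse_sqrt:
  "(\<integral>\<^sup>+x. ennreal (\<bar>x\<bar> powr (- 1 / 2)) * indicator {-2..2} x \<partial>lborel) < \<infinity>"
proof -
  let ?f = "\<lambda>x :: real. ennreal (x powr (- 1 / 2)) * indicator {0..2} x"
  have [measurable]: "?f \<in> borel_measurable borel"
    by measurable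
  \<comment> \<open>the right half of the integral; the left half is its mirror image\<close>
  have "integral\<^sup>N lborel ?f = ennreal (2 powr (- 1 / 2 + 1) / (- 1 / 2 + 1))"
    by (rule nn_integral_has_integral_lebesgue') (use has_integral_powr_from_0 [of "- 1 / 2" 2] in auto)
  then have fin: "integral\<^sup>N lborel ?f < \<infinity>"
    by simp
  have "(\<integral>\<^sup>+x. ennreal (\<bar>x\<bar> powr (- 1 / 2)) * indicator {-2..2} x \<partial>lborel) \<le> (\<integral>\<^sup>+x. ?f x + ?f (- x) \<partial>lborel)"
    by (intro nn_integral_mono) (auto split: split_indicator)
  also have "\<dots> = integral\<^sup>N lborel ?f + (\<integral>\<^sup>+x. ?f (- x) \<partial>lborel)"
    by (rule nn_integral_add) measurable
  also have "(\<integral>\<^sup>+x. ?f (- x) \<partial>lborel) = integral\<^sup>N lborel ?f"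
    using nn_integral_real_affine [of ?f "-1" 0] by simp
  finally show ?thesis
    using fin by (simp add: order_le_less_trans)
qed

text \<open>
  The integrand is at most a multiple of \<open>\<bar>t - \<beta>\<bar> powr (- 1 / 2) + \<bar>t + \<beta>\<bar> powr (- 1 / 2)\<close>,
  and translating to a fixed interval makes the bound uniform in \<open>\<beta>\<close>.
\<close>

lemma nn_integral_arc_sin:
  assumes \<kappa>: "0 < \<kappa>" "\<kappa> \<le> 1"
  obtains K where "0 \<le> K"
    "\<And>b. b \<in> arc_support \<kappa> \<Longrightarrow> (\<integral>\<^sup>+t. ennreal (\<bar>sin (t - b)\<bar> powr (- 1 / 2)) \<partial>arc_measure \<kappa>) \<le> ennreal K"
proof -
  let ?g = "\<lambda>x :: real. ennreal (\<bar>x\<bar> powr (- 1 / 2)) * indicator {-2..2} x"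
  define C where "C = integral\<^sup>N lborel ?g"
  define A where "A = (\<kappa> / 2) powr (- 1 / 2)"
  have C: "C < \<infinity>"
    unfolding C_def by (rule nn_integral_inverse_sqrt)
  have A: "0 \<le> A"
    by (simp add: A_def)
  have le: "(\<integral>\<^sup>+t. ennreal (\<bar>sin (t - b)\<bar> powr (- 1 / 2)) \<partial>arc_measure \<kappa>) \<le> ennreal A * (C + C)"
    if b: "b \<in> arc_support \<kappa>" for b
  proof -
    obtain \<beta> where \<beta>: "\<beta> \<in> {0..1}"
      "\<And>t. t \<in> {-1..1} \<Longrightarrow> \<kappa> / 2 * \<bar>\<bar>t\<bar> - \<beta>\<bar> \<le> \<bar>sin (tilt \<kappa> t - b)\<bar>"
      by (rule arc_sin_ge [OF \<kappa> b]) blast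
    have shift: "(\<integral>\<^sup>+t. ?g (s + t) \<partial>lborel) = C" for s
      using nn_integral_real_affine [of ?g 1 s] by (simp add: C_def)
    have "(\<integral>\<^sup>+t. ennreal (\<bar>sin (t - b)\<bar> powr (- 1 / 2)) \<partial>arc_measure \<kappa>) =
        (\<integral>\<^sup>+t. ennreal (\<bar>sin (tilt \<kappa> t - b)\<bar> powr (- 1 / 2)) \<partial>uniform_measure lborel {-1..1})"
      unfolding arc_measure_def by (rule nn_integral_distr) measurable
    also have "\<dots> = (\<integral>\<^sup>+t. ennreal (\<bar>sin (tilt \<kappa> t - b)\<bar> powr (- 1 / 2)) * indicator {-1..1} t \<partial>lborel) / 2"
      by (subst nn_integral_uniform_measure) auto
    also have "\<dots> \<le> (\<integral>\<^sup>+t. ennreal (\<bar>sin (tilt \<kappa> t - b)\<bar> powr (- 1 / 2)) * indicator {-1..1} t \<partial>lborel)"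
    proof -
      have "x / 2 \<le> x" for x :: ennreal
        by (cases x) (simp_all add: ennreal_divide_numeral ennreal_leI)
      then show ?thesis .
    qed
    also have "\<dots> \<le> (\<integral>\<^sup>+t. ennreal A * (?g (- \<beta> + t) + ?g (\<beta> + t)) \<partial>lborel)"
    proof (rule nn_integral_mono_AE)
      have "AE t in lborel. t \<noteq> \<beta> \<and> t \<noteq> - \<beta>"
        using AE_lborel_singleton [of \<beta>] AE_lborel_singleton [of "- \<beta>"] by eventually_elim simp
      then show "AE t in lborel. ennreal (\<bar>sin (tilt \<kappa> t - b)\<bar> powr (- 1 / 2)) * indicator {-1..1} t
          \<le> ennreal A * (?g (- \<beta> + t) + ?g (\<beta> + t))"
      proof eventually_elim
        case (elim t)
        show ?case
        proof (cases "t \<in> {-1..1}")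
          case True
          let ?p = "\<lambda>x :: real. x powr (- 1 / 2)"
          have pos: "0 < \<bar>\<bar>t\<bar> - \<beta>\<bar>"
            using elim by (auto simp: abs_if split: if_splits)
          have "?p \<bar>sin (tilt \<kappa> t - b)\<bar> \<le> ?p (\<kappa> / 2 * \<bar>\<bar>t\<bar> - \<beta>\<bar>)"
            using \<beta>(2) [OF True] pos \<kappa> by (intro powr_mono2') auto
          also have "\<dots> = A * ?p \<bar>\<bar>t\<bar> - \<beta>\<bar>"
            unfolding A_def by (subst powr_mult) (use pos \<kappa> in auto)
          also have "\<dots> \<le> A * (?p \<bar>- \<beta> + t\<bar> + ?p \<bar>\<beta> + t\<bar>)"
          proof (rule mult_left_mono [OF _ A])
            show "?p \<bar>\<bar>t\<bar> - \<beta>\<bar> \<le> ?p \<bar>- \<beta> + t\<bar> + ?p \<bar>\<beta> + t\<bar>"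
            proof (cases "0 \<le> t")
              case True
              then have "\<bar>\<bar>t\<bar> - \<beta>\<bar> = \<bar>- \<beta> + t\<bar>"
                by simp
              then show ?thesis
                by simp
            next
              case False
              then have "\<bar>\<bar>t\<bar> - \<beta>\<bar> = \<bar>\<beta> + t\<bar>"
                by (simp add: abs_minus_commute add.commute)
              then show ?thesis
                by simp
            qed
          qed
          finally have "ennreal (?p \<bar>sin (tilt \<kappa> t - b)\<bar>) \<le> ennreal (A * (?p \<bar>- \<beta> + t\<bar> + ?p \<bar>\<beta> + t\<bar>))"
            by (rule ennreal_leI)
          also have "\<dots> = ennreal A * (?g (- \<beta> + t) + ?g (\<beta> + t))"
            using True \<beta>(1) A by (simp add: ennreal_mult)
          finally show ?thesis
            using True by simp
        qed simp
      qed
    qed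
    also have "\<dots> = ennreal A * (C + C)"
      using shift [of "- \<beta>"] shift [of \<beta>] by (simp add: nn_integral_cmult nn_integral_add)
    finally show ?thesis .
  qed
  have "ennreal A * (C + C) < top"
    using C by (simp add: ennreal_mult_less_top)
  then obtain K where "0 \<le> K" "ennreal A * (C + C) = ennreal K"
    by (metis ennreal_cases less_irrefl)
  then show thesis
    using that le by metis
qed

text \<open>
  Inner product of the points of the unit circle with the two given angles, and the product of the signs
  of the arcs on which they lie.
\<close>

definition pair_cos :: "real \<times> real \<Rightarrow> real" where
  "pair_cos z = cos (fst z - snd z)"

definition pair_sign :: "real \<times> real \<Rightarrow> real" where
  "pair_sign z = sgn (cos (fst z)) * sgn (cos (snd z))"

text \<open>
  The constant \<open>c\<close> of \<open>coordinate\<close>: the mean of \<open>pair_sign * pair_cos\<close>, computed from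
  \<open>cos (s - t) = cos s * cos t + sin s * sin t\<close>.
\<close>

definition arc_mean :: "real \<Rightarrow> real" where
  "arc_mean \<kappa> = (\<integral>t. sgn (cos t) * cos t \<partial>arc_measure \<kappa>)\<^sup>2 + (\<integral>t. sgn (cos t) * sin t \<partial>arc_measure \<kappa>)\<^sup>2"

lemma measurable_pair_cos [measurable]: "pair_cos \<in> borel_measurable (borel \<Otimes>\<^sub>M borel)"
  and measurable_pair_sign [measurable]: "pair_sign \<in> borel_measurable (borel \<Otimes>\<^sub>M borel)"
  unfolding pair_cos_def pair_sign_def by measurable

lemma integrable_arc_bounded:
  fixes F :: "real \<Rightarrow> real"
  assumes "F \<in> borel_measurable borel" "\<And>t. \<bar>F t\<bar> \<le> 1"
  shows "integrable (arc_measure \<kappa>) F"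
proof -
  interpret prob_space "arc_measure \<kappa>"
    by (rule prob_space_arc)
  show ?thesis
    using assms by (intro integrable_const_bound [where B = 1]) auto
qed

lemma integral_arc_pair:
  fixes F G :: "real \<Rightarrow> real"
  assumes [measurable]: "F \<in> borel_measurable borel" "G \<in> borel_measurable borel"
    and le: "\<And>t. \<bar>F t\<bar> \<le> 1" "\<And>t. \<bar>G t\<bar> \<le> 1"
  shows "integrable (arc_measure \<kappa> \<Otimes>\<^sub>M arc_measure \<kappa>) (\<lambda>z. F (fst z) * G (snd z))"
    and "(\<integral>z. F (fst z) * G (snd z) \<partial>(arc_measure \<kappa> \<Otimes>\<^sub>M arc_measure \<kappa>)) = (\<integral>t. F t \<partial>arc_measure \<kappa>) * (\<integral>t. G t \<partial>arc_measure \<kappa>)"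
proof -
  interpret prob_space "arc_measure \<kappa>"
    by (rule prob_space_arc)
  interpret PP: pair_prob_space "arc_measure \<kappa>" "arc_measure \<kappa>" ..
  show int: "integrable (arc_measure \<kappa> \<Otimes>\<^sub>M arc_measure \<kappa>) (\<lambda>z. F (fst z) * G (snd z))"
    using le by (intro PP.P.integrable_const_bound [where B = 1]) (auto simp: abs_mult intro!: mult_le_one)
  show "(\<integral>z. F (fst z) * G (snd z) \<partial>(arc_measure \<kappa> \<Otimes>\<^sub>M arc_measure \<kappa>)) = (\<integral>t. F t \<partial>arc_measure \<kappa>) * (\<integral>t. G t \<partial>arc_measure \<kappa>)"
    using PP.integral_fst [of "\<lambda>x y. F x * G y"] int by (simp add: split_beta')
qed

lemma coordinate_arc:
  assumes \<kappa>: "0 < \<kappa>" "\<kappa> \<le> 1" and K: "0 \<le> K"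
    "\<And>b. b \<in> arc_support \<kappa> \<Longrightarrow> (\<integral>\<^sup>+t. ennreal (\<bar>sin (t - b)\<bar> powr (- 1 / 2)) \<partial>arc_measure \<kappa>) \<le> ennreal K"
  shows "coordinate (arc_measure \<kappa> \<Otimes>\<^sub>M arc_measure \<kappa>) pair_cos pair_sign (arc_mean \<kappa>) K"
proof -
  interpret prob_space "arc_measure \<kappa>"
    by (rule prob_space_arc)
  interpret PP: pair_prob_space "arc_measure \<kappa>" "arc_measure \<kappa>" ..
  let ?D = "arc_measure \<kappa> \<Otimes>\<^sub>M arc_measure \<kappa>"
  note int_pair = integral_arc_pair
  have cos_split: "pair_cos = (\<lambda>z. cos (fst z) * cos (snd z) + sin (fst z) * sin (snd z))"
    by (simp add: pair_cos_def cos_diff fun_eq_iff)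
  have zero: "(\<integral>t. cos t \<partial>arc_measure \<kappa>) = 0" "(\<integral>t. sin t \<partial>arc_measure \<kappa>) = 0" "(\<integral>t. sgn (cos t) \<partial>arc_measure \<kappa>) = 0"
    by (rule integral_arc_antiperiodic; simp add: sgn_minus)+
  have sgn_le: "\<bar>sgn (cos t)\<bar> \<le> 1" "\<bar>sgn (cos t) * cos t\<bar> \<le> 1" "\<bar>sgn (cos t) * sin t\<bar> \<le> 1" for t :: real
    by (auto simp: sgn_if)
  have sin2: "1 - (pair_cos z)\<^sup>2 = (sin (fst z - snd z))\<^sup>2" for z
    by (simp add: pair_cos_def sin_squared_eq)
  have AE_supp: "AE t in arc_measure \<kappa>. t \<in> arc_support \<kappa>"
    using \<kappa> by (intro AE_arc_support) simp
  show ?thesis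
  proof
    show "pair_cos \<in> borel_measurable ?D" "pair_sign \<in> borel_measurable ?D"
      by measurable
    show "\<bar>pair_cos z\<bar> \<le> 1" for z
      by (simp add: pair_cos_def)
    show "\<bar>pair_sign z\<bar> \<le> 1" for z
      by (auto simp: pair_sign_def sgn_if)
    show "(\<integral>z. pair_sign z \<partial>?D) = 0"
      unfolding pair_sign_def by (subst int_pair) (auto simp: zero sgn_le)
    show "(\<integral>z. pair_cos z \<partial>?D) = 0"
      unfolding cos_split by (simp add: int_pair zero)
    have "pair_sign z * pair_cos z = (sgn (cos (fst z)) * cos (fst z)) * (sgn (cos (snd z)) * cos (snd z)) +
        (sgn (cos (fst z)) * sin (fst z)) * (sgn (cos (snd z)) * sin (snd z))" for z
      unfolding cos_split pair_sign_def by (simp add: algebra_simps)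
    then show "(\<integral>z. pair_sign z * pair_cos z \<partial>?D) = arc_mean \<kappa>"
      using int_pair [of "\<lambda>t. sgn (cos t) * cos t" "\<lambda>t. sgn (cos t) * cos t" \<kappa>]
        int_pair [of "\<lambda>t. sgn (cos t) * sin t" "\<lambda>t. sgn (cos t) * sin t" \<kappa>] sgn_le
      by (simp add: arc_mean_def power2_eq_square)
    have "AE s in arc_measure \<kappa>. AE t in arc_measure \<kappa>. sin (s - t) \<noteq> 0"
      using AE_supp
    proof eventually_elim
      case (elim s)
      then have "AE t in arc_measure \<kappa>. sin (t - s) \<noteq> 0"
        by (rule AE_arc_sin_nonzero [OF \<kappa>])
      then show ?case
        by eventually_elim (metis minus_diff_eq sin_minus neg_equal_0_iff_equal)
    qed
    moreover have "{z \<in> space ?D. sin (fst z - snd z) \<noteq> 0} \<in> sets ?D"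
      by measurable
    ultimately have "AE z in ?D. sin (fst z - snd z) \<noteq> 0"
      by (intro PP.AE_pair_measure) auto
    then show "AE z in ?D. (pair_cos z)\<^sup>2 < 1"
      by eventually_elim (metis sin2 diff_gt_0_iff_gt zero_less_power2)
    have powr: "(1 - (pair_cos z)\<^sup>2) powr (- 1 / 4) = \<bar>sin (fst z - snd z)\<bar> powr (- 1 / 2)" for z
    proof -
      have sq: "(sin (fst z - snd z))\<^sup>2 = \<bar>sin (fst z - snd z)\<bar> powr 2"
        by (cases "sin (fst z - snd z) = 0") (simp_all add: powr_numeral)
      show ?thesis
        unfolding sin2 sq powr_powr by simp
    qed
    have "(\<integral>\<^sup>+z. ennreal ((1 - (pair_cos z)\<^sup>2) powr (- 1 / 4)) \<partial>?D) =
        (\<integral>\<^sup>+b. (\<integral>\<^sup>+t. ennreal (\<bar>sin (t - b)\<bar> powr (- 1 / 2)) \<partial>arc_measure \<kappa>) \<partial>arc_measure \<kappa>)"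
      unfolding powr by (subst PP.nn_integral_snd [symmetric]) auto
    also have "\<dots> \<le> (\<integral>\<^sup>+b. ennreal K \<partial>arc_measure \<kappa>)"
      by (rule nn_integral_mono_AE, use AE_supp in eventually_elim) (rule K(2))
    also have "\<dots> = ennreal K"
      by (simp add: emeasure_space_1 [simplified])
    finally show "(\<integral>\<^sup>+z. ennreal ((1 - (pair_cos z)\<^sup>2) powr (- 1 / 4)) \<partial>?D) \<le> ennreal K" .
  qed (rule K(1))
qed

lemma cos_arc_support:
  assumes \<kappa>: "0 \<le> \<kappa>" "\<kappa> \<le> 1" and t: "t \<in> arc_support \<kappa>"
  shows "cos \<kappa> \<le> sgn (cos t) * cos t" "0 < cos \<kappa>"
proof -
  have less: "\<kappa> < pi / 2"
    using \<kappa> pi_gt3 by linarith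
  then show pos: "0 < cos \<kappa>"
    using \<kappa> by (intro cos_gt_zero_pi) auto
  have le: "cos \<kappa> \<le> cos s" if "s \<in> {0..\<kappa>}" for s
    using that \<kappa> less by (intro cos_monotone_0_pi_le) auto
  show "cos \<kappa> \<le> sgn (cos t) * cos t"
  proof (cases "t \<in> {0..\<kappa>}")
    case True
    then show ?thesis
      using le [of t] pos by simp
  next
    case False
    then have "t - pi \<in> {0..\<kappa>}"
      using t by (auto simp: arc_support_def)
    then show ?thesis
      using le [of "t - pi"] pos by (simp add: cos_diff)
  qed
qed

lemma arc_mean_ge:
  assumes \<kappa>: "0 < \<kappa>" "\<kappa> \<le> 1"
  shows "(cos \<kappa>)\<^sup>2 \<le> arc_mean \<kappa>"
proof -
  interpret prob_space "arc_measure \<kappa>"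
    by (rule prob_space_arc)
  have "AE t in arc_measure \<kappa>. t \<in> arc_support \<kappa>"
    using \<kappa> by (intro AE_arc_support) simp
  then have "AE t in arc_measure \<kappa>. cos \<kappa> \<le> sgn (cos t) * cos t"
    by eventually_elim (rule cos_arc_support; use \<kappa> in simp)
  moreover have "integrable (arc_measure \<kappa>) (\<lambda>t. sgn (cos t) * cos t)"
    by (rule integrable_arc_bounded) (auto simp: sgn_if)
  ultimately have "(\<integral>t. cos \<kappa> \<partial>arc_measure \<kappa>) \<le> (\<integral>t. sgn (cos t) * cos t \<partial>arc_measure \<kappa>)"
    by (intro integral_mono_AE) auto
  then have "cos \<kappa> \<le> (\<integral>t. sgn (cos t) * cos t \<partial>arc_measure \<kappa>)"
    by (simp add: prob_space [simplified])
  moreover have "0 < cos \<kappa>"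
    by (rule cos_arc_support [of \<kappa> 0]) (use \<kappa> in \<open>auto simp: arc_support_def\<close>)
  ultimately have "(cos \<kappa>)\<^sup>2 \<le> (\<integral>t. sgn (cos t) * cos t \<partial>arc_measure \<kappa>)\<^sup>2"
    by (intro power_mono) auto
  then show ?thesis
    unfolding arc_mean_def by (simp add: add_increasing2)
qed

section \<open>Tori of lines\<close>

lemma sum_lessThan_double:
  fixes f :: "nat \<Rightarrow> 'b::comm_monoid_add"
  shows "(\<Sum>i<2 * M. f i) = (\<Sum>k<M. f (2 * k) + f (2 * k + 1))"
  by (induction M) (simp_all add: add.assoc)

text \<open>
  Up to normalization, the vector formed by \<open>M\<close> points of the unit circle. It is real, so that its
  inner products do not depend on the field.
\<close>

definition torus_vec :: "nat \<Rightarrow> (nat \<Rightarrow> real) \<Rightarrow> nat \<Rightarrow> 'a::scalar" where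
  "torus_vec M \<psi> i =
    (if i < 2 * M then of_real (if even i then cos (\<psi> (i div 2)) else sin (\<psi> (i div 2))) else 0)"

definition torus_line :: "nat \<Rightarrow> (nat \<Rightarrow> real) \<Rightarrow> (nat \<Rightarrow> 'a::scalar) set" where
  "torus_line M \<psi> = line (torus_vec M \<psi>)"

lemma herm_torus_vec:
  "herm (2 * M) (torus_vec M \<psi>) (torus_vec M \<psi>') =
    (of_real (\<Sum>k<M. cos (\<psi> k - \<psi>' k)) :: 'a::scalar)"
proof -
  have "(of_real (cos (\<psi> k)) * of_real (cos (\<psi>' k)) + of_real (sin (\<psi> k)) * of_real (sin (\<psi>' k)) :: 'a) =
      of_real (cos (\<psi> k - \<psi>' k))" for k
    by (simp add: cos_diff)
  then show ?thesis
    unfolding herm_def sum_lessThan_double by (simp add: torus_vec_def)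
qed

lemma vec_norm_torus_vec: "vec_norm (2 * M) (torus_vec M \<psi> :: nat \<Rightarrow> 'a::scalar) = sqrt (real M)"
proof -
  have "(vec_norm (2 * M) (torus_vec M \<psi> :: nat \<Rightarrow> 'a))\<^sup>2 *\<^sub>R (1 :: 'a) = real M *\<^sub>R 1"
    unfolding herm_self [symmetric] herm_torus_vec by (simp add: scaleR_conv_of_real)
  then have "(vec_norm (2 * M) (torus_vec M \<psi> :: nat \<Rightarrow> 'a))\<^sup>2 = real M"
    by simp
  then show ?thesis
    by (metis real_sqrt_unique vec_norm_nonneg)
qed

lemma torus_vec_nonzero:
  assumes "0 < M"
  shows "torus_vec M \<psi> \<noteq> (\<lambda>i. 0 :: 'a::scalar)"
proof
  assume eq: "torus_vec M \<psi> = (\<lambda>i. 0 :: 'a)"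
  have "vec_norm (2 * M) (torus_vec M \<psi> :: nat \<Rightarrow> 'a) = 0"
    unfolding eq by (simp add: vec_norm_def L2_set_def)
  with assms show False
    by (simp add: vec_norm_torus_vec)
qed

lemma torus_line_in_proj_space: "0 < M \<Longrightarrow> torus_line M \<psi> \<in> proj_space (2 * M)"
  unfolding torus_line_def proj_space_def
  by (intro imageI DiffI) (auto simp: coord_space_def torus_vec_nonzero, simp add: torus_vec_def)

lemma overlap_torus_line:
  assumes "0 < M"
  shows "overlap (2 * M) (torus_line M \<psi> :: (nat \<Rightarrow> 'a::scalar) set) (torus_line M \<psi>') =
    ((\<Sum>k<M. cos (\<psi> k - \<psi>' k)) / M)\<^sup>2"
proof -
  have "norm (herm (2 * M) (torus_vec M \<psi>) (torus_vec M \<psi>' :: nat \<Rightarrow> 'a)) = \<bar>\<Sum>k<M. cos (\<psi> k - \<psi>' k)\<bar>"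
    unfolding herm_torus_vec by (rule norm_of_real)
  then show ?thesis
    using assms unfolding torus_line_def
    by (simp add: overlap_line torus_vec_nonzero vec_norm_torus_vec power_divide)
qed

text \<open>
  Lines of the torus come close only if all angles do, modulo \<open>pi\<close>: by the Cauchy--Schwarz inequality
  the squared mean of the cosines is at most the mean of their squares.
\<close>

lemma overlap_torus_line_le:
  assumes "0 < M"
  shows "(\<Sum>k<M. (sin (\<psi> k - \<psi>' k))\<^sup>2) / M \<le>
    1 - overlap (2 * M) (torus_line M \<psi> :: (nat \<Rightarrow> 'a::scalar) set) (torus_line M \<psi>')"
proof -
  let ?c = "\<lambda>k. cos (\<psi> k - \<psi>' k)"
  have "(\<Sum>k<M. ?c k)\<^sup>2 \<le> real M * (\<Sum>k<M. (?c k)\<^sup>2)"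
    using Cauchy_Schwarz_ineq_sum [of "\<lambda>_. 1" ?c "{..<M}"] by simp
  then have "((\<Sum>k<M. ?c k) / M)\<^sup>2 \<le> (\<Sum>k<M. (?c k)\<^sup>2) / M"
    using assms by (simp add: power_divide power2_eq_square divide_simps mult.commute)
  also have "\<dots> = 1 - (\<Sum>k<M. (sin (\<psi> k - \<psi>' k))\<^sup>2) / M"
    using assms by (simp add: cos_squared_eq sum_subtractf diff_divide_distrib)
  finally show ?thesis
    using assms by (simp add: overlap_torus_line)
qed

lemma inner_moment_torus_line:
  assumes "k < M" "l < M"
  shows "inner (moment (2 * M) (torus_line M \<psi> :: (nat \<Rightarrow> 'a::scalar) set) (2 * k) (2 * l)) 1 =
    cos (\<psi> k) * cos (\<psi> l) / M"
proof -
  have "moment (2 * M) (torus_line M \<psi> :: (nat \<Rightarrow> 'a) set) (2 * k) (2 * l) =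
      (cos (\<psi> k) * cos (\<psi> l) / M) *\<^sub>R 1"
    using assms unfolding torus_line_def
    by (simp add: moment_line torus_vec_nonzero vec_norm_torus_vec)
      (simp add: torus_vec_def scaleR_conv_of_real divide_inverse mult_ac flip: of_real_mult of_real_inverse)
  then show ?thesis
    by (simp add: flip: power2_norm_eq_inner)
qed

text \<open>
  The map is continuous in the product topology on sequences, because the distance of two of its values
  is a continuous function of finitely many angles.
\<close>

lemma measurable_torus_line:
  assumes "0 < M"
  shows "(torus_line M :: _ \<Rightarrow> (nat \<Rightarrow> 'a::scalar) set) \<in> measurable (PiM {..<M} (\<lambda>_. borel)) (proj_borel (2 * M))"
proof -
  let ?B = "PiM {..<M} (\<lambda>_. borel) :: (nat \<Rightarrow> real) measure"
  let ?X = "torus_line M :: _ \<Rightarrow> (nat \<Rightarrow> 'a) set"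
  interpret Metric_space "proj_space (2 * M) :: (nat \<Rightarrow> 'a) set set" "proj_dist (2 * M)"
    by (rule Metric_space_proj_dist)
  have id: "(\<lambda>\<psi>. \<psi>) \<in> measurable ?B (borel :: (nat \<Rightarrow> real) measure)"
  proof -
    have "(\<lambda>\<psi>. \<psi>) \<in> measurable ?B (PiM UNIV (\<lambda>_. borel))"
    proof (rule measurable_PiM_single')
      fix i :: nat
      show "(\<lambda>\<psi>. \<psi> i) \<in> borel_measurable ?B"
      proof (cases "i < M")
        case True
        then show ?thesis
          by (intro measurable_component_singleton) auto
      next
        case False
        then have "(\<lambda>\<psi>. \<psi> i) \<in> borel_measurable ?B \<longleftrightarrow> (\<lambda>\<psi>. undefined :: real) \<in> borel_measurable ?B"
          by (intro measurable_cong) (auto simp: space_PiM PiE_def extensional_def)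
        then show ?thesis
          by simp
      qed
    qed auto
    then show ?thesis
      by (simp add: measurable_cong_sets [OF refl sets_PiM_equal_borel])
  qed
  have open_vimage: "open {\<psi>. ?X \<psi> \<in> U}" if U: "openin mtopology U" for U
  proof (subst open_subopen, rule ballI)
    fix \<psi>0
    assume "\<psi>0 \<in> {\<psi>. ?X \<psi> \<in> U}"
    then obtain r where r: "0 < r" "mball (?X \<psi>0) r \<subseteq> U"
      using U unfolding openin_mtopology by blast
    let ?\<Theta> = "\<lambda>\<psi>. arccos \<bar>(\<Sum>k<M. cos (\<psi>0 k - \<psi> k)) / M\<bar>"
    have dist: "proj_dist (2 * M) (?X \<psi>0) (?X \<psi>) = ?\<Theta> \<psi>" for \<psi>
    proof -
      have "norm (herm (2 * M) (torus_vec M \<psi>0) (torus_vec M \<psi> :: nat \<Rightarrow> 'a)) = \<bar>\<Sum>k<M. cos (\<psi>0 k - \<psi> k)\<bar>"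
        unfolding herm_torus_vec by (rule norm_of_real)
      then show ?thesis
        using assms unfolding torus_line_def
        by (simp add: proj_dist_line torus_vec_nonzero vec_norm_torus_vec)
    qed
    have abs_le: "\<bar>(\<Sum>k<M. cos (\<psi>0 k - \<psi> k)) / M\<bar> \<le> 1" for \<psi>
    proof -
      have "\<bar>\<Sum>k<M. cos (\<psi>0 k - \<psi> k)\<bar> \<le> (\<Sum>k<M. 1)"
        by (rule order_trans [OF sum_abs]) (intro sum_mono abs_cos_le_one)
      then show ?thesis
        using assms by simp
    qed
    have "continuous_on UNIV ?\<Theta>"
    proof (rule continuous_on_arccos)
      have "continuous_on UNIV (\<lambda>\<psi> :: nat \<Rightarrow> real. \<psi> k)" for k
        by (rule continuous_on_product_coordinates)
      then show "continuous_on UNIV (\<lambda>\<psi>. \<bar>(\<Sum>k<M. cos (\<psi>0 k - \<psi> k)) / M\<bar>)"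
        using assms by (intro continuous_intros) auto
      show "\<forall>\<psi>\<in>UNIV. - 1 \<le> \<bar>(\<Sum>k<M. cos (\<psi>0 k - \<psi> k)) / M\<bar> \<and> \<bar>(\<Sum>k<M. cos (\<psi>0 k - \<psi> k)) / M\<bar> \<le> 1"
        using abs_le by (auto intro: order_trans [of _ 0])
    qed
    then have "open {\<psi>. ?\<Theta> \<psi> < r}"
      by (intro open_Collect_less continuous_on_const)
    moreover have "?\<Theta> \<psi>0 < r"
      using r assms by simp
    moreover have "{\<psi>. ?\<Theta> \<psi> < r} \<subseteq> {\<psi>. ?X \<psi> \<in> U}"
    proof
      fix \<psi>
      assume "\<psi> \<in> {\<psi>. ?\<Theta> \<psi> < r}"
      then have "?X \<psi> \<in> mball (?X \<psi>0) r"
        using torus_line_in_proj_space [OF assms, where 'a = 'a] dist [of \<psi>] by simp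
      with r show "\<psi> \<in> {\<psi>. ?X \<psi> \<in> U}"
        by auto
    qed
    ultimately show "\<exists>T. open T \<and> \<psi>0 \<in> T \<and> T \<subseteq> {\<psi>. ?X \<psi> \<in> U}"
      by blast
  qed
  show ?thesis
    unfolding proj_borel_def
  proof (rule measurable_measure_of [OF openin_subset_proj_space])
    show "?X \<in> space ?B \<rightarrow> proj_space (2 * M)"
      using torus_line_in_proj_space [OF assms] by auto
    fix U
    assume "U \<in> {U. openin mtopology U}"
    then have "open {\<psi>. ?X \<psi> \<in> U}"
      by (intro open_vimage) simp
    then have "(\<lambda>\<psi>. \<psi>) -` {\<psi>. ?X \<psi> \<in> U} \<inter> space ?B \<in> sets ?B"
      by (intro measurable_sets [OF id] borel_open)
    then show "?X -` U \<inter> space ?B \<in> sets ?B"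
      by (simp add: vimage_def)
  qed
qed

section \<open>Testing positive definiteness on a torus\<close>

definition zip_fun :: "nat \<Rightarrow> (nat \<Rightarrow> 'z) \<times> (nat \<Rightarrow> 'z) \<Rightarrow> nat \<Rightarrow> 'z \<times> 'z" where
  "zip_fun M p = (\<lambda>k\<in>{..<M}. (fst p k, snd p k))"

lemma measurable_zip_fun [measurable]:
  "zip_fun M \<in> measurable (PiM {..<M} (\<lambda>_. A) \<Otimes>\<^sub>M PiM {..<M} (\<lambda>_. A)) (PiM {..<M} (\<lambda>_. A \<Otimes>\<^sub>M A))"
  unfolding zip_fun_def by measurable

text \<open>
  A pair of independent vectors with independent entries is a vector of independent pairs. It suffices
  to compare the measures of boxes, where Fubini's theorem applies in each coordinate.
\<close>

lemma (in prob_space) distr_zip_fun: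
  "distr (PiM {..<N} (\<lambda>_. M) \<Otimes>\<^sub>M PiM {..<N} (\<lambda>_. M)) (PiM {..<N} (\<lambda>_. M \<Otimes>\<^sub>M M)) (zip_fun N) =
    PiM {..<N} (\<lambda>_. M \<Otimes>\<^sub>M M)"
proof -
  let ?P = "PiM {..<N} (\<lambda>_. M)"
  interpret MM: pair_prob_space M M ..
  interpret PM: product_prob_space "\<lambda>_::nat. M"
    by unfold_locales
  interpret PMM: product_prob_space "\<lambda>_::nat. M \<Otimes>\<^sub>M M"
    by unfold_locales
  interpret P: prob_space ?P
    by (rule prob_space_PiM) unfold_locales
  interpret PP: pair_prob_space ?P ?P ..
  show ?thesis
  proof (rule PMM.PiM_eqI)
    fix B :: "nat \<Rightarrow> ('a \<times> 'a) set"
    assume B: "\<And>k. k \<in> {..<N} \<Longrightarrow> B k \<in> sets (M \<Otimes>\<^sub>M M)"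
    \<comment> \<open>extended by 0 to the indices \<open>k \<ge> N\<close>, for which nothing is known about \<open>B k\<close>\<close>
    define F :: "nat \<Rightarrow> 'a \<times> 'a \<Rightarrow> ennreal" where "F k z = (if k < N then indicator (B k) z else 0)" for k z
    have F [measurable]: "F k \<in> borel_measurable (M \<Otimes>\<^sub>M M)" for k
      unfolding F_def using B by (cases "k < N") auto
    have "emeasure (distr (?P \<Otimes>\<^sub>M ?P) (PiM {..<N} (\<lambda>_. M \<Otimes>\<^sub>M M)) (zip_fun N)) (PiE {..<N} B) =
        emeasure (?P \<Otimes>\<^sub>M ?P) (zip_fun N -` PiE {..<N} B \<inter> space (?P \<Otimes>\<^sub>M ?P))"
      using B by (intro emeasure_distr sets_PiM_I_finite measurable_zip_fun) auto
    also have "\<dots> = (\<integral>\<^sup>+p. indicator (zip_fun N -` PiE {..<N} B \<inter> space (?P \<Otimes>\<^sub>M ?P)) p \<partial>(?P \<Otimes>\<^sub>M ?P))"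
      using B by (intro nn_integral_indicator [symmetric] measurable_sets [OF measurable_zip_fun] sets_PiM_I_finite) auto
    also have "\<dots> = (\<integral>\<^sup>+p. (\<Prod>k<N. F k (fst p k, snd p k)) \<partial>(?P \<Otimes>\<^sub>M ?P))"
    proof (rule nn_integral_cong)
      fix p
      assume p: "p \<in> space (?P \<Otimes>\<^sub>M ?P)"
      show "indicator (zip_fun N -` PiE {..<N} B \<inter> space (?P \<Otimes>\<^sub>M ?P)) p = (\<Prod>k<N. F k (fst p k, snd p k))"
      proof (cases "\<forall>k<N. (fst p k, snd p k) \<in> B k")
        case True
        then show ?thesis
          using p by (auto simp: F_def zip_fun_def indicator_def)
      next
        case False
        then obtain k where "k < N" "F k (fst p k, snd p k) = 0"
          by (auto simp: F_def)
        then have "(\<Prod>k<N. F k (fst p k, snd p k)) = 0"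
          by (intro prod_zero) auto
        moreover have "zip_fun N p \<notin> PiE {..<N} B"
          using False by (auto simp: zip_fun_def)
        ultimately show ?thesis
          by simp
      qed
    qed
    also have "\<dots> = (\<integral>\<^sup>+a. (\<integral>\<^sup>+b. (\<Prod>k<N. F k (a k, b k)) \<partial>?P) \<partial>?P)"
      by (subst P.nn_integral_fst [symmetric]) auto
    also have "\<dots> = (\<integral>\<^sup>+a. (\<Prod>k<N. \<integral>\<^sup>+t. F k (a k, t) \<partial>M) \<partial>?P)"
    proof (rule nn_integral_cong)
      fix a
      assume "a \<in> space ?P"
      then have "a k \<in> space M" if "k < N" for k
        using that by (auto simp: space_PiM)
      then have "(\<lambda>t. F k (a k, t)) \<in> borel_measurable M" if "k < N" for k
        using that by (intro measurable_Pair2 [OF F])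
      then show "(\<integral>\<^sup>+b. (\<Prod>k<N. F k (a k, b k)) \<partial>?P) = (\<Prod>k<N. \<integral>\<^sup>+t. F k (a k, t) \<partial>M)"
        by (intro PM.product_nn_integral_prod) auto
    qed
    also have "\<dots> = (\<Prod>k<N. \<integral>\<^sup>+s. \<integral>\<^sup>+t. F k (s, t) \<partial>M \<partial>M)"
      by (rule PM.product_nn_integral_prod) auto
    also have "\<dots> = (\<Prod>k<N. emeasure (M \<Otimes>\<^sub>M M) (B k))"
    proof (rule prod.cong)
      fix k
      assume "k \<in> {..<N}"
      then have "(\<integral>\<^sup>+z. F k z \<partial>(M \<Otimes>\<^sub>M M)) = emeasure (M \<Otimes>\<^sub>M M) (B k)"
        using B by (simp add: F_def)
      then show "(\<integral>\<^sup>+s. \<integral>\<^sup>+t. F k (s, t) \<partial>M \<partial>M) = emeasure (M \<Otimes>\<^sub>M M) (B k)"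
        by (simp add: nn_integral_fst)
    qed simp
    finally show "emeasure (distr (?P \<Otimes>\<^sub>M ?P) (PiM {..<N} (\<lambda>_. M \<Otimes>\<^sub>M M)) (zip_fun N)) (PiE {..<N} B) =
        (\<Prod>k<N. emeasure (M \<Otimes>\<^sub>M M) (B k))" .
  qed simp_all
qed

text \<open>
  The function \<open>g\<close> of the overlap. It is set to 0 outside \<open>[0, 1)\<close>, which makes it Borel measurable.
\<close>

definition profile :: "(real \<Rightarrow> real) \<Rightarrow> real \<Rightarrow> real" where
  "profile f u = (if 0 \<le> u \<and> u < 1 then f (2 * u - 1) else 0)"

text \<open>
  The exponent of the singularity is rounded up to a natural number, so that the bound can be read in
  the extended nonnegative reals, with the value \<open>\<infinity>\<close> at \<open>u = 1\<close>.
\<close>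

lemma profile_C_sing:
  assumes "f \<in> C_sing"
  shows "continuous_on {0..<1} (profile f)" and "profile f \<in> borel_measurable borel"
    and "\<exists>C m. 0 < C \<and> 0 < m \<and> (\<forall>u. 0 \<le> u \<longrightarrow> u < 1 \<longrightarrow> \<bar>profile f u\<bar> \<le> C * inverse (1 - u) ^ m)"
proof -
  obtain s h where f: "continuous_on {-1..<1} f" and s: "0 < s" and h: "continuous_on {-1..1} h"
    and eq: "\<And>t. t \<in> {-1..<1} \<Longrightarrow> h t = (1 - t) powr s * f t"
    using assms unfolding C_sing_def by blast
  have "continuous_on {0..<1} (\<lambda>u. f (2 * u - 1))"
    by (rule continuous_on_compose2 [OF f]) (auto intro!: continuous_intros)
  then show cont: "continuous_on {0..<1} (profile f)"
    by (rule continuous_on_eq) (auto simp: profile_def)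
  have "(\<lambda>u. indicator {0..<1} u *\<^sub>R profile f u) \<in> borel_measurable borel"
    using cont by (intro borel_measurable_continuous_on_indicator) auto
  also have "(\<lambda>u. indicator {0..<1} u *\<^sub>R profile f u) = profile f"
    by (auto simp: profile_def indicator_def)
  finally show "profile f \<in> borel_measurable borel" .
  have "bounded (h ` {-1..1})"
    using h by (intro compact_imp_bounded compact_continuous_image) auto
  then obtain B where B: "0 < B" "\<And>t. t \<in> {-1..1} \<Longrightarrow> \<bar>h t\<bar> \<le> B"
    by (auto simp: bounded_pos)
  define m where "m = nat \<lceil>s\<rceil>"
  have m: "0 < m" "s \<le> real m"
    using s by (auto simp: m_def)
  have "\<bar>profile f u\<bar> \<le> B * inverse (1 - u) ^ m" if u: "0 \<le> u" "u < 1" for u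
  proof -
    let ?t = "2 * u - 1"
    have t: "?t \<in> {-1..<1}"
      using u by auto
    have pos: "0 < (2 * (1 - u)) powr s"
      using u by simp
    have "\<bar>f ?t\<bar> * (2 * (1 - u)) powr s = \<bar>h ?t\<bar>"
      using eq [OF t] u by (simp add: abs_mult algebra_simps)
    also have "\<dots> \<le> B"
      using t by (intro B) auto
    finally have "\<bar>f ?t\<bar> \<le> B / (2 * (1 - u)) powr s"
      using pos by (simp add: pos_le_divide_eq)
    also have "\<dots> \<le> B / (1 - u) ^ m"
    proof (rule divide_left_mono)
      have "(1 - u) ^ m = (1 - u) powr m"
        using u by (simp add: powr_realpow)
      also have "\<dots> \<le> (1 - u) powr s"
        using u m by (intro powr_mono') auto
      also have "\<dots> \<le> (2 * (1 - u)) powr s"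
        using u s by (intro powr_mono2) auto
      finally show "(1 - u) ^ m \<le> (2 * (1 - u)) powr s" .
    qed (use B u pos in auto)
    finally show ?thesis
      using u by (simp add: profile_def divide_inverse power_inverse)
  qed
  then show "\<exists>C m. 0 < C \<and> 0 < m \<and> (\<forall>u. 0 \<le> u \<longrightarrow> u < 1 \<longrightarrow> \<bar>profile f u\<bar> \<le> C * inverse (1 - u) ^ m)"
    using B m by blast
qed

lemma kernel_profile:
  "overlap d L M < 1 \<Longrightarrow> kernel d f L M = ereal (profile f (overlap d L M))"
  by (simp add: kernel_overlap ext_one_def profile_def)

lemma kernel_cases:
  "kernel d f L M = (if overlap d L M = 1 then value_at_one f else ereal (profile f (overlap d L M)))"
proof -
  have "overlap d L M = 1 \<or> overlap d L M < 1"
    by (metis order_le_less overlap_le_1)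
  then show ?thesis
    by (auto simp: kernel_overlap ext_one_def profile_def)
qed

lemma measurable_kernel [measurable]:
  assumes [measurable]: "profile f \<in> borel_measurable borel"
  shows "(\<lambda>(L, M). kernel d f L M) \<in>
    borel_measurable (proj_borel d \<Otimes>\<^sub>M proj_borel d :: ((nat \<Rightarrow> 'a::scalar) set \<times> _) measure)"
proof -
  let ?u = "\<lambda>(L, M). overlap d L M :: real"
  have "(\<lambda>z. if ?u z = 1 then value_at_one f else ereal (profile f (?u z))) \<in>
      borel_measurable (proj_borel d \<Otimes>\<^sub>M proj_borel d :: ((nat \<Rightarrow> 'a) set \<times> _) measure)"
    by measurable
  then show ?thesis
    by (simp add: kernel_cases split_beta')
qed

text \<open>
  The setting for testing positive definiteness in dimension \<open>2 * M\<close>: bounds for the profile, the length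
  \<open>\<kappa>\<close> of the arcs with its constant \<open>K\<close>, and enough coordinates to absorb the singularity.
\<close>

locale torus_test =
  fixes f :: "real \<Rightarrow> real" and C :: real and m :: nat and \<kappa> K :: real and M :: nat
  assumes profile_measurable [measurable]: "profile f \<in> borel_measurable borel"
    and profile_cont: "continuous_on {0..<1} (profile f)"
    and profile_bound: "\<And>u. 0 \<le> u \<Longrightarrow> u < 1 \<Longrightarrow> \<bar>profile f u\<bar> \<le> C * inverse (1 - u) ^ m"
    and C: "0 < C" and m: "0 < m"
    and \<kappa>: "0 < \<kappa>" "\<kappa> \<le> 1"
    and K: "0 \<le> K"
      "\<And>b. b \<in> arc_support \<kappa> \<Longrightarrow> (\<integral>\<^sup>+t. ennreal (\<bar>sin (t - b)\<bar> powr (- 1 / 2)) \<partial>arc_measure \<kappa>) \<le> ennreal K"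
    and M: "4 * m \<le> M"
begin

lemma M_pos: "0 < M"
  using M m by simp

sublocale co: coordinate "arc_measure \<kappa> \<Otimes>\<^sub>M arc_measure \<kappa>" pair_cos pair_sign "arc_mean \<kappa>" K
  by (rule coordinate_arc [OF \<kappa> K])

sublocale A: prob_space "arc_measure \<kappa>"
  by (rule prob_space_arc)

sublocale AP: product_prob_space "\<lambda>_::nat. arc_measure \<kappa>"
  by unfold_locales

abbreviation "P \<equiv> PiM {..<M} (\<lambda>_. arc_measure \<kappa>)"

sublocale P: prob_space P
  by (rule prob_space_PiM) unfold_locales

lemma measurable_torus_line_P: "torus_line M \<in> measurable P (proj_borel (2 * M) :: (nat \<Rightarrow> 'a::scalar) set measure)"
proof -
  have "sets P = sets (PiM {..<M} (\<lambda>_. borel))"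
    by (intro sets_PiM_cong) auto
  then show ?thesis
    using measurable_torus_line [OF M_pos] by (simp cong: measurable_cong_sets)
qed

lemma AE_P_support: "AE \<psi> in P. \<forall>k<M. \<psi> k \<in> arc_support \<kappa>"
proof -
  have "AE t in arc_measure \<kappa>. t \<in> arc_support \<kappa>"
    using \<kappa> by (intro AE_arc_support) simp
  then have "AE \<psi> in P. \<psi> k \<in> arc_support \<kappa>" if "k < M" for k
    using that A.prob_space_axioms by (intro AE_PiM_component) auto
  then have "AE \<psi> in P. \<forall>k\<in>{..<M}. \<psi> k \<in> arc_support \<kappa>"
    by (intro AE_finite_allI) auto
  then show ?thesis
    by eventually_elim auto
qed

text \<open>
  The bound for a fixed line of the torus does not depend on that line.
\<close>

lemma nn_integral_singular_point:
  assumes b: "\<And>k. k < M \<Longrightarrow> b k \<in> arc_support \<kappa>"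
  shows "(\<integral>\<^sup>+\<psi>. inverse (ennreal (1 - overlap (2 * M) (torus_line M \<psi> :: (nat \<Rightarrow> 'a::scalar) set) (torus_line M b))) ^ m \<partial>P)
    \<le> ennreal ((1 + 4 * real m / M * K) ^ M)"
proof -
  let ?s = "\<lambda>k t. \<bar>sin (t - b k)\<bar> powr (- 1 / 2)"
  let ?u = "\<lambda>\<psi>. overlap (2 * M) (torus_line M \<psi> :: (nat \<Rightarrow> 'a) set) (torus_line M b)"
  let ?c = "4 * real m / M"
  have "(\<integral>\<^sup>+\<psi>. inverse (ennreal (1 - ?u \<psi>)) ^ m \<partial>P)
      \<le> (\<integral>\<^sup>+\<psi>. (\<Prod>k<M. co.H m M (\<psi> k, b k)) \<partial>P)"
  proof (rule nn_integral_mono)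
    fix \<psi>
    have "inverse (ennreal (1 - ?u \<psi>)) ^ m
        \<le> inverse (ennreal ((\<Sum>k<M. (sin (\<psi> k - b k))\<^sup>2) / M)) ^ m"
      by (intro power_mono inverse_ennreal_antimono overlap_torus_line_le M_pos) simp
    also have "(\<Sum>k<M. (sin (\<psi> k - b k))\<^sup>2) = (\<Sum>k<M. 1 - (pair_cos (\<psi> k, b k))\<^sup>2)"
      by (simp add: pair_cos_def sin_squared_eq)
    also have "inverse (ennreal ((\<Sum>k<M. 1 - (pair_cos (\<psi> k, b k))\<^sup>2) / M)) ^ m \<le> (\<Prod>k<M. co.H m M (\<psi> k, b k))"
      by (rule co.inverse_mean_le_prod_H [OF M M_pos])
    finally show "inverse (ennreal (1 - ?u \<psi>)) ^ m
        \<le> (\<Prod>k<M. co.H m M (\<psi> k, b k))" .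
  qed
  also have "\<dots> = (\<Prod>k<M. \<integral>\<^sup>+t. co.H m M (t, b k) \<partial>arc_measure \<kappa>)"
    by (rule AP.product_nn_integral_prod) (auto intro: measurable_Pair1 [OF co.measurable_H])
  also have "\<dots> \<le> (\<Prod>k<M. ennreal (1 + ?c * K))"
  proof (rule prod_mono_ennreal)
    fix k
    assume "k \<in> {..<M}"
    then have bk: "b k \<in> arc_support \<kappa>"
      using b by simp
    have "(\<integral>\<^sup>+t. co.H m M (t, b k) \<partial>arc_measure \<kappa>) \<le>
        (\<integral>\<^sup>+t. 1 + ennreal ?c * ennreal (?s k t) \<partial>arc_measure \<kappa>)"
    proof (rule nn_integral_mono_AE, use AE_arc_sin_nonzero [OF \<kappa> bk] in eventually_elim)
      fix t
      assume nz: "sin (t - b k) \<noteq> 0"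
      have sin2: "1 - (pair_cos (t, b k))\<^sup>2 = (sin (t - b k))\<^sup>2"
        by (simp add: pair_cos_def sin_squared_eq)
      have "0 < (sin (t - b k))\<^sup>2"
        using nz by simp
      then have less: "(pair_cos (t, b k))\<^sup>2 < 1"
        using sin2 by linarith
      have sq: "(sin (t - b k))\<^sup>2 = \<bar>sin (t - b k)\<bar> powr 2"
        using nz by (simp add: powr_numeral)
      have "(1 - (pair_cos (t, b k))\<^sup>2) powr (- 1 / 4) = ?s k t"
        unfolding sin2 sq powr_powr by simp
      with less show "co.H m M (t, b k) \<le> 1 + ennreal ?c * ennreal (?s k t)"
        by (simp add: co.H_def flip: ennreal_mult' ennreal_1)
    qed
    also have "\<dots> = 1 + ennreal ?c * (\<integral>\<^sup>+t. ennreal (?s k t) \<partial>arc_measure \<kappa>)"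
      using A.emeasure_space_1 by (simp add: nn_integral_add nn_integral_cmult)
    also have "\<dots> \<le> 1 + ennreal ?c * ennreal K"
      by (intro add_left_mono mult_left_mono K bk) simp
    also have "\<dots> = ennreal (1 + ?c * K)"
      using K(1) by (simp flip: ennreal_mult' ennreal_1)
    finally show "(\<integral>\<^sup>+t. co.H m M (t, b k) \<partial>arc_measure \<kappa>) \<le> ennreal (1 + ?c * K)" .
  qed
  also have "\<dots> = ennreal ((1 + ?c * K) ^ M)"
    unfolding prod_constant card_lessThan by (rule ennreal_power) (use K(1) in simp)
  finally show ?thesis .
qed

lemma measurable_overlap_point:
  fixes N :: "(nat \<Rightarrow> 'a::scalar) set"
  assumes "N \<in> proj_space (2 * M)"
  shows "(\<lambda>\<psi>. overlap (2 * M) (torus_line M \<psi>) N) \<in> borel_measurable P"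
proof -
  have "(\<lambda>\<psi>. (torus_line M \<psi>, N)) \<in> measurable P (proj_borel (2 * M) \<Otimes>\<^sub>M proj_borel (2 * M))"
    using assms measurable_torus_line_P by (intro measurable_Pair measurable_const) auto
  from measurable_compose [OF this measurable_overlap] show ?thesis
    by simp
qed

text \<open>
  Either \<open>N\<close> keeps a positive distance from the torus, and the integrand is bounded; or \<open>N\<close> is a
  limit of lines of the torus, for which the integrals are uniformly bounded, and Fatou's lemma
  applies.
\<close>

lemma nn_integral_singular_point_finite:
  fixes N :: "(nat \<Rightarrow> 'a::scalar) set"
  assumes N: "N \<in> proj_space (2 * M)"
  shows "(\<integral>\<^sup>+\<psi>. inverse (ennreal (1 - overlap (2 * M) (torus_line M \<psi>) N)) ^ m \<partial>P) < \<infinity>"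
proof -
  let ?X = "torus_line M :: _ \<Rightarrow> (nat \<Rightarrow> 'a) set"
  let ?u = "overlap (2 * M)"
  have X: "?X \<psi> \<in> proj_space (2 * M)" for \<psi>
    by (rule torus_line_in_proj_space [OF M_pos])
  show ?thesis
  proof (cases "\<exists>\<delta>>0. \<forall>\<psi>. (\<forall>k<M. \<psi> k \<in> arc_support \<kappa>) \<longrightarrow> \<delta> \<le> 1 - ?u (?X \<psi>) N")
    case True
    then obtain \<delta> where \<delta>: "0 < \<delta>" "\<And>\<psi>. (\<forall>k<M. \<psi> k \<in> arc_support \<kappa>) \<Longrightarrow> \<delta> \<le> 1 - ?u (?X \<psi>) N"
      by blast
    have "(\<integral>\<^sup>+\<psi>. inverse (ennreal (1 - ?u (?X \<psi>) N)) ^ m \<partial>P) \<le> (\<integral>\<^sup>+\<psi>. inverse (ennreal \<delta>) ^ m \<partial>P)"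
    proof (rule nn_integral_mono_AE, use AE_P_support in eventually_elim)
      fix \<psi>
      assume "\<forall>k<M. \<psi> k \<in> arc_support \<kappa>"
      then show "inverse (ennreal (1 - ?u (?X \<psi>) N)) ^ m \<le> inverse (ennreal \<delta>) ^ m"
        by (intro power_mono inverse_ennreal_antimono \<delta>) auto
    qed
    also have "\<dots> < \<infinity>"
      using \<delta>(1) P.emeasure_space_1 by (simp add: inverse_ennreal ennreal_power)
    finally show ?thesis .
  next
    case False
    then have "\<forall>n. \<exists>\<psi>. (\<forall>k<M. \<psi> k \<in> arc_support \<kappa>) \<and> 1 - ?u (?X \<psi>) N < inverse (real (Suc n))"
      by (metis inverse_positive_iff_positive not_le of_nat_0_less_iff zero_less_Suc)
    then obtain b where b: "\<And>n k. k < M \<Longrightarrow> b n k \<in> arc_support \<kappa>"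
        "\<And>n. 1 - ?u (?X (b n)) N < inverse (real (Suc n))"
      by metis
    have "(\<lambda>n. 1 - ?u (?X (b n)) N) \<longlonglongrightarrow> 0"
      by (rule tendsto_sandwich [OF _ _ tendsto_const LIMSEQ_inverse_real_of_nat])
        (auto intro!: always_eventually less_imp_le b(2) simp del: of_nat_Suc)
    then have "(\<lambda>n. 1 - (1 - ?u (?X (b n)) N)) \<longlonglongrightarrow> 1 - 0"
      by (intro tendsto_intros)
    then have lim: "(\<lambda>n. ?u (?X (b n)) N) \<longlonglongrightarrow> 1"
      by simp
    have pointwise: "(\<lambda>n. inverse (ennreal (1 - ?u (?X \<psi>) (?X (b n)))) ^ m) \<longlonglongrightarrow>
        inverse (ennreal (1 - ?u (?X \<psi>) N)) ^ m" for \<psi>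
    proof -
      have "(\<lambda>n. (1 - ?u (?X \<psi>) (?X (b n))) ^ m) \<longlonglongrightarrow> (1 - ?u (?X \<psi>) N) ^ m"
        by (intro tendsto_intros overlap_tendsto [OF X N X lim])
      then have "(\<lambda>n. ennreal ((1 - ?u (?X \<psi>) (?X (b n))) ^ m)) \<longlonglongrightarrow> ennreal ((1 - ?u (?X \<psi>) N) ^ m)"
        by (rule tendsto_ennrealI)
      then have "(\<lambda>n. inverse (ennreal ((1 - ?u (?X \<psi>) (?X (b n))) ^ m))) \<longlonglongrightarrow> inverse (ennreal ((1 - ?u (?X \<psi>) N) ^ m))"
        by (rule continuous_on_tendsto_compose [OF continuous_on_inverse_ennreal [OF continuous_on_id [of UNIV]]]) auto
      then show ?thesis
        by (simp add: ennreal_inverse_power flip: ennreal_power)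
    qed
    have "(\<integral>\<^sup>+\<psi>. inverse (ennreal (1 - ?u (?X \<psi>) N)) ^ m \<partial>P) =
        (\<integral>\<^sup>+\<psi>. liminf (\<lambda>n. inverse (ennreal (1 - ?u (?X \<psi>) (?X (b n)))) ^ m) \<partial>P)"
      by (simp add: lim_imp_Liminf [OF _ pointwise])
    also have "\<dots> \<le> liminf (\<lambda>n. \<integral>\<^sup>+\<psi>. inverse (ennreal (1 - ?u (?X \<psi>) (?X (b n)))) ^ m \<partial>P)"
    proof (rule nn_integral_liminf)
      fix n
      have [measurable]: "(\<lambda>\<psi>. ?u (?X \<psi>) (?X (b n))) \<in> borel_measurable P"
        by (rule measurable_overlap_point [OF X])
      show "(\<lambda>\<psi>. inverse (ennreal (1 - ?u (?X \<psi>) (?X (b n)))) ^ m) \<in> borel_measurable P"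
        by measurable
    qed
    also have "\<dots> \<le> liminf (\<lambda>n::nat. ennreal ((1 + 4 * real m / M * K) ^ M))"
      by (intro Liminf_mono always_eventually allI nn_integral_singular_point b)
    also have "\<dots> = ennreal ((1 + 4 * real m / M * K) ^ M)"
      by (simp add: Liminf_const)
    also have "\<dots> < \<infinity>"
      by simp
    finally show ?thesis .
  qed
qed

lemma in_L1_kernel:
  fixes N :: "(nat \<Rightarrow> 'a::scalar) set"
  assumes N: "N \<in> proj_space (2 * M)"
  shows "in_L1 (distr P (proj_borel (2 * M)) (torus_line M)) (\<lambda>L. kernel (2 * M) f L N)"
proof -
  let ?X = "torus_line M :: _ \<Rightarrow> (nat \<Rightarrow> 'a) set"
  have "(\<lambda>L. (L, N)) \<in> measurable (proj_borel (2 * M)) (proj_borel (2 * M) \<Otimes>\<^sub>M proj_borel (2 * M))"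
    using N by (intro measurable_Pair measurable_const) auto
  from measurable_compose [OF this measurable_kernel [OF profile_measurable]]
  have meas: "(\<lambda>L. kernel (2 * M) f L N) \<in> borel_measurable (proj_borel (2 * M))"
    by simp
  have [measurable]: "(\<lambda>\<psi>. overlap (2 * M) (?X \<psi>) N) \<in> borel_measurable P"
    by (rule measurable_overlap_point [OF N])
  have "(\<integral>\<^sup>+L. e2ennreal \<bar>kernel (2 * M) f L N\<bar> \<partial>distr P (proj_borel (2 * M)) ?X) =
      (\<integral>\<^sup>+\<psi>. e2ennreal \<bar>kernel (2 * M) f (?X \<psi>) N\<bar> \<partial>P)"
    using measurable_torus_line_P meas by (intro nn_integral_distr) auto
  also have "\<dots> \<le> (\<integral>\<^sup>+\<psi>. ennreal C * inverse (ennreal (1 - overlap (2 * M) (?X \<psi>) N)) ^ m \<partial>P)"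
  proof (rule nn_integral_mono)
    fix \<psi>
    let ?u = "overlap (2 * M) (?X \<psi>) N"
    show "e2ennreal \<bar>kernel (2 * M) f (?X \<psi>) N\<bar> \<le> ennreal C * inverse (ennreal (1 - ?u)) ^ m"
    proof (cases "?u < 1")
      case True
      have "ennreal \<bar>profile f ?u\<bar> \<le> ennreal C * inverse (ennreal (1 - ?u)) ^ m"
        by (rule singular_bound_ennreal [OF profile_bound C m]) auto
      then show ?thesis
        using True by (simp add: kernel_profile)
    next
      case False
      then show ?thesis
        using C m by (simp add: ennreal_mult_top power_0_left ennreal_top_mult top_power_ennreal ennreal_neg)
    qed
  qed
  also have "\<dots> = ennreal C * (\<integral>\<^sup>+\<psi>. inverse (ennreal (1 - overlap (2 * M) (?X \<psi>) N)) ^ m \<partial>P)"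
    by (rule nn_integral_cmult) measurable
  also have "\<dots> < \<infinity>"
    using nn_integral_singular_point_finite [OF N] by (simp add: ennreal_mult_less_top)
  finally show ?thesis
    using meas by (simp add: in_L1_def)
qed

abbreviation "Q \<equiv> co.Q M"

lemma zip_P: "distr (P \<Otimes>\<^sub>M P) Q (zip_fun M) = Q"
  unfolding co.Q_def by (rule A.distr_zip_fun)

lemma measurable_zip_P [measurable]: "zip_fun M \<in> measurable (P \<Otimes>\<^sub>M P) Q"
  unfolding co.Q_def by (rule measurable_zip_fun)

lemma overlap_zip:
  "overlap (2 * M) (torus_line M \<psi> :: (nat \<Rightarrow> 'a::scalar) set) (torus_line M \<psi>') = (co.X M (zip_fun M (\<psi>, \<psi>')))\<^sup>2"
  by (simp add: overlap_torus_line M_pos co.X_def zip_fun_def pair_cos_def)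

lemma AE_X_less: "AE \<omega> in Q. (co.X M \<omega>)\<^sup>2 < 1"
proof -
  have "(\<integral>\<^sup>+\<omega>. inverse (ennreal (1 - (co.X M \<omega>)\<^sup>2)) ^ 1 \<partial>Q) \<le> ennreal (exp (8 * real 1 * K))"
    using co.nn_integral_singular [of 0 1 M] M m by (simp add: co.W_def)
  then have "(\<integral>\<^sup>+\<omega>. inverse (ennreal (1 - (co.X M \<omega>)\<^sup>2)) \<partial>Q) \<noteq> \<infinity>"
    by (auto simp: top_unique)
  then have "AE \<omega> in Q. inverse (ennreal (1 - (co.X M \<omega>)\<^sup>2)) \<noteq> \<infinity>"
    by (intro nn_integral_noteq_infinite) auto
  then show ?thesis
    by eventually_elim (auto simp: ennreal_eq_0_iff)
qed

lemma integrable_profile_X: "integrable Q (\<lambda>\<omega>. profile f ((co.X M \<omega>)\<^sup>2))"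
  using co.integrable_weighted [OF profile_measurable profile_cont profile_bound C m, of 0 M] M M_pos
  by (simp add: co.W_def)

text \<open>
  The signed measure has density \<open>h\<close> with respect to the law of the random line. A line determines the
  signs of the coordinates only up to a common factor, so \<open>h\<close> is written in terms of \<open>sgn (cos (\<psi> k) * cos (\<psi> 0))\<close>; for even
  \<open>card S\<close> the factors \<open>sgn (cos (\<psi> 0))\<close> cancel and \<open>h\<close> becomes the product of the signs
  in \<open>S\<close>.
\<close>

lemma test_coefficient_nonneg:
  assumes pd: "positive_definite TYPE('a::scalar) (2 * M) f" and S: "S \<subseteq> {..<M}" "even (card S)"
  shows "0 \<le> (\<integral>\<omega>. (\<Prod>k\<in>S. pair_sign (\<omega> k)) * profile f ((co.X M \<omega>)\<^sup>2) \<partial>Q)"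
proof -
  let ?B = "proj_borel (2 * M) :: (nat \<Rightarrow> 'a) set measure"
  let ?X = "torus_line M :: _ \<Rightarrow> (nat \<Rightarrow> 'a) set"
  define \<nu> where "\<nu> = distr P ?B ?X"
  define h where "h L = (\<Prod>k\<in>S. sgn (inner (moment (2 * M) L (2 * k) 0) 1))" for L :: "(nat \<Rightarrow> 'a) set"
  note X [measurable] = measurable_torus_line_P [where 'a = 'a]
  have prob_\<nu>: "prob_space \<nu>"
    unfolding \<nu>_def by (rule P.prob_space_distr) (rule X)
  have h_meas: "h \<in> borel_measurable ?B"
    unfolding h_def
  proof (rule borel_measurable_prod)
    fix k
    assume "k \<in> S"
    then have [measurable]: "(\<lambda>L. inner (moment (2 * M) L (2 * k) 0) (1 :: 'a)) \<in> borel_measurable ?B"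
      using S M_pos by (intro measurable_moment) auto
    show "(\<lambda>L. sgn (inner (moment (2 * M) L (2 * k) 0) (1 :: 'a))) \<in> borel_measurable ?B"
      by measurable
  qed
  have h_le: "\<bar>h L\<bar> \<le> 1" for L
    unfolding h_def abs_prod by (rule prod_le_1) (auto simp: sgn_if)
  interpret sd: signed_density ?B \<nu> h
  proof (rule signed_density.intro)
    show "finite_measure \<nu>"
      using prob_\<nu> by (simp add: prob_space_def)
    show "sets \<nu> = sets ?B"
      by (simp add: \<nu>_def)
  qed (fact h_meas h_le)+
  let ?PP = "P \<Otimes>\<^sub>M P" and ?BB = "?B \<Otimes>\<^sub>M ?B"
  let ?XX = "\<lambda>(\<psi>, \<psi>'). (?X \<psi>, ?X \<psi>')"
  let ?k = "\<lambda>L N. profile f (overlap (2 * M) L N) :: real"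
  have XX [measurable]: "?XX \<in> measurable ?PP ?BB"
    by measurable
  have \<nu>\<nu>: "\<nu> \<Otimes>\<^sub>M \<nu> = distr ?PP ?BB ?XX"
    unfolding \<nu>_def using prob_\<nu> unfolding \<nu>_def
    by (intro pair_measure_distr X prob_space_imp_sigma_finite)
  have k_meas: "(\<lambda>(L, N). ?k L N) \<in> borel_measurable ?BB"
  proof -
    have "(\<lambda>z. profile f ((\<lambda>(L, N). overlap (2 * M) L N) z)) \<in> borel_measurable ?BB"
      by measurable
    then show ?thesis
      by (simp add: split_beta')
  qed
  have less: "AE p in ?PP. overlap (2 * M) (?X (fst p)) (?X (snd p)) < 1"
  proof -
    have "AE \<omega> in distr ?PP Q (zip_fun M). (co.X M \<omega>)\<^sup>2 < 1"
      unfolding zip_P by (rule AE_X_less)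
    then have "AE p in ?PP. (co.X M (zip_fun M p))\<^sup>2 < 1"
      by (rule AE_distrD [OF measurable_zip_P])
    then show ?thesis
      by eventually_elim (simp add: overlap_zip)
  qed
  have eq: "AE (L, N) in \<nu> \<Otimes>\<^sub>M \<nu>. kernel (2 * M) f L N = ereal (?k L N)"
  proof -
    let ?u = "\<lambda>(L :: (nat \<Rightarrow> 'a) set, N). overlap (2 * M) L N"
    have "{z \<in> space ?BB. ?u z < 1} \<in> sets ?BB"
      by measurable
    then have "AE z in \<nu> \<Otimes>\<^sub>M \<nu>. ?u z < 1"
      unfolding \<nu>\<nu> using less by (subst AE_distr_iff [OF XX]) (auto simp: split_beta')
    then show ?thesis
      by eventually_elim (auto simp: kernel_profile)
  qed
  have int_PP: "integrable ?PP (\<lambda>p. profile f ((co.X M (zip_fun M p))\<^sup>2))"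
    using integrable_distr [OF measurable_zip_P, of "\<lambda>\<omega>. profile f ((co.X M \<omega>)\<^sup>2)"] integrable_profile_X
    by (simp add: zip_P)
  have int: "integrable (\<nu> \<Otimes>\<^sub>M \<nu>) (\<lambda>(L, N). ?k L N)"
    unfolding \<nu>\<nu> using int_PP by (subst integrable_distr_eq [OF XX k_meas]) (simp add: split_beta' overlap_zip)
  have F_meas: "(\<lambda>\<omega>. (\<Prod>k\<in>S. pair_sign (\<omega> k)) * profile f ((co.X M \<omega>)\<^sup>2)) \<in> borel_measurable Q"
  proof -
    have "(\<lambda>\<omega>. \<Prod>k\<in>S. pair_sign (\<omega> k)) \<in> borel_measurable Q"
    proof (rule borel_measurable_prod)
      fix k
      assume "k \<in> S"
      then have "(\<lambda>\<omega>. \<omega> k) \<in> measurable Q (arc_measure \<kappa> \<Otimes>\<^sub>M arc_measure \<kappa>)"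
        unfolding co.Q_def using S(1) by (intro measurable_component_singleton) auto
      from measurable_compose [OF this co.measurable_\<tau>]
      show "(\<lambda>\<omega>. pair_sign (\<omega> k)) \<in> borel_measurable Q" .
    qed
    then show ?thesis
      by measurable
  qed
  have "0 \<le> dbl_integral ?B sd.charge (kernel (2 * M) f)"
    using pd sd.signed_charge in_L1_kernel [where 'a = 'a, folded \<nu>_def] sd.in_L1_charge
    unfolding positive_definite_def by blast
  also have "\<dots> = ereal (\<integral>(L, N). h L * h N * ?k L N \<partial>(\<nu> \<Otimes>\<^sub>M \<nu>))"
    by (rule sd.dbl_integral_charge [OF measurable_kernel [OF profile_measurable] k_meas eq int])
  finally have "0 \<le> (\<integral>(L, N). h L * h N * ?k L N \<partial>(\<nu> \<Otimes>\<^sub>M \<nu>))"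
    by simp
  also have "\<dots> = (\<integral>p. (\<lambda>(L, N). h L * h N * ?k L N) (?XX p) \<partial>?PP)"
  proof -
    have "(\<lambda>z. h (fst z) * h (snd z) * (\<lambda>(L, N). ?k L N) z) \<in> borel_measurable ?BB"
      using h_meas k_meas by measurable
    then show ?thesis
      unfolding \<nu>\<nu> by (intro integral_distr XX) (simp add: split_beta')
  qed
  also have "\<dots> = (\<integral>p. (\<Prod>k\<in>S. pair_sign (zip_fun M p k)) * profile f ((co.X M (zip_fun M p))\<^sup>2) \<partial>?PP)"
  proof (rule integral_cong_AE)
    have h_X: "h (?X \<psi>) = (\<Prod>k\<in>S. sgn (cos (\<psi> k)))" if "cos (\<psi> 0) \<noteq> 0" for \<psi>
    proof -
      have "h (?X \<psi>) = (\<Prod>k\<in>S. sgn (cos (\<psi> k)) * sgn (cos (\<psi> 0)))"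
        unfolding h_def
      proof (rule prod.cong)
        fix k
        assume "k \<in> S"
        then show "sgn (inner (moment (2 * M) (?X \<psi>) (2 * k) 0) 1) = sgn (cos (\<psi> k)) * sgn (cos (\<psi> 0))"
          using S inner_moment_torus_line [of k M 0 \<psi>, where 'a = 'a] M_pos
          by (auto simp: sgn_mult sgn_divide)
      qed simp
      also have "\<dots> = (\<Prod>k\<in>S. sgn (cos (\<psi> k))) * sgn (cos (\<psi> 0)) ^ card S"
        by (simp add: prod.distrib)
      also have "sgn (cos (\<psi> 0)) ^ card S = 1"
        using S(2) that by (auto simp: sgn_if)
      finally show ?thesis
        by simp
    qed
    have AE_P: "AE \<psi> in P. cos (\<psi> 0) \<noteq> 0"
      using AE_P_support
    proof eventually_elim
      case (elim \<psi>)
      then have "\<psi> 0 \<in> arc_support \<kappa>"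
        using M_pos by simp
      then show ?case
        using cos_arc_support [of \<kappa> "\<psi> 0"] \<kappa> by auto
    qed
    interpret PP: pair_prob_space P P ..
    have [measurable]: "(\<lambda>\<psi>. \<psi> 0) \<in> borel_measurable P"
      using measurable_component_singleton [of 0 "{..<M}" "\<lambda>_. arc_measure \<kappa>"] M_pos by simp
    have "{p \<in> space ?PP. cos (fst p 0) \<noteq> 0 \<and> cos (snd p 0) \<noteq> 0} \<in> sets ?PP"
      by measurable
    moreover have "AE \<psi> in P. AE \<psi>' in P. cos (\<psi> 0) \<noteq> 0 \<and> cos (\<psi>' 0) \<noteq> 0"
      using AE_P
    proof eventually_elim
      case (elim \<psi>)
      show ?case
        using AE_P by eventually_elim (simp add: elim)
    qed
    ultimately have "AE p in ?PP. cos (fst p 0) \<noteq> 0 \<and> cos (snd p 0) \<noteq> 0"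
      by (intro PP.AE_pair_measure) auto
    then show "AE p in ?PP. (\<lambda>(L, N). h L * h N * ?k L N) (?XX p) =
        (\<Prod>k\<in>S. pair_sign (zip_fun M p k)) * profile f ((co.X M (zip_fun M p))\<^sup>2)"
    proof eventually_elim
      case (elim p)
      have "(\<Prod>k\<in>S. pair_sign (zip_fun M p k)) = (\<Prod>k\<in>S. sgn (cos (fst p k)) * sgn (cos (snd p k)))"
        using S by (intro prod.cong) (auto simp: pair_sign_def zip_fun_def)
      then show ?case
        using elim by (simp add: split_beta' overlap_zip h_X prod.distrib)
    qed
    have "(\<lambda>z. h (fst z) * h (snd z) * (\<lambda>(L, N). ?k L N) z) \<in> borel_measurable ?BB"
      using h_meas k_meas by measurable
    from measurable_compose [OF XX this]
    show "(\<lambda>p. (\<lambda>(L, N). h L * h N * ?k L N) (?XX p)) \<in> borel_measurable ?PP"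
      by (simp add: split_beta')
    show "(\<lambda>p. (\<Prod>k\<in>S. pair_sign (zip_fun M p k)) * profile f ((co.X M (zip_fun M p))\<^sup>2)) \<in> borel_measurable ?PP"
      using measurable_compose [OF measurable_zip_P F_meas] .
  qed
  also have "\<dots> = (\<integral>\<omega>. (\<Prod>k\<in>S. pair_sign (\<omega> k)) * profile f ((co.X M \<omega>)\<^sup>2) \<partial>distr ?PP Q (zip_fun M))"
    by (rule integral_distr [OF measurable_zip_P F_meas, symmetric])
  finally show ?thesis
    by (simp add: zip_P)
qed

end

section \<open>The characterization\<close>

text \<open>
  For fixed arcs: let the number of coordinates tend to infinity, with \<open>\<rho> = sqrt v\<close>.
\<close>

lemma profile_dilated_power_series:
  assumes f: "f \<in> C_sing" and pd: "\<And>d. d0 \<le> d \<Longrightarrow> positive_definite TYPE('a::scalar) d f"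
    and \<kappa>: "0 < \<kappa>" "\<kappa> \<le> 1"
  shows "\<exists>a. (\<forall>j. 0 \<le> a j) \<and>
    (\<forall>v. 0 \<le> v \<longrightarrow> v < 1 \<longrightarrow> (\<lambda>j. a j * v ^ j) sums profile f ((arc_mean \<kappa>)\<^sup>2 * v))"
proof -
  obtain C m where C: "0 < C" and m: "0 < m"
    and bound: "\<And>u. 0 \<le> u \<Longrightarrow> u < 1 \<Longrightarrow> \<bar>profile f u\<bar> \<le> C * inverse (1 - u) ^ m"
    using profile_C_sing(3) [OF f] by blast
  note cont = profile_C_sing(1) [OF f] and meas = profile_C_sing(2) [OF f]
  obtain K where K: "0 \<le> K"
    "\<And>b. b \<in> arc_support \<kappa> \<Longrightarrow> (\<integral>\<^sup>+t. ennreal (\<bar>sin (t - b)\<bar> powr (- 1 / 2)) \<partial>arc_measure \<kappa>) \<le> ennreal K"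
    by (rule nn_integral_arc_sin [OF \<kappa>]) blast
  interpret co: coordinate "arc_measure \<kappa> \<Otimes>\<^sub>M arc_measure \<kappa>" pair_cos pair_sign "arc_mean \<kappa>" K
    by (rule coordinate_arc [OF \<kappa> K])
  let ?c = "arc_mean \<kappa>" and ?g = "profile f"
  \<comment> \<open>the number of coordinates: large enough for \<open>torus_test\<close> and, as a dimension, for \<open>pd\<close>\<close>
  let ?M = "\<lambda>k. k + (4 * m + d0)"
  let ?I = "\<lambda>\<rho> M. \<integral>\<omega>. co.W \<rho> M \<omega> * ?g ((co.X M \<omega>)\<^sup>2) \<partial>co.Q M"
  have test: "torus_test f C m \<kappa> K (?M k)" for k
    by (intro torus_test.intro meas cont bound C m \<kappa> K) auto
  show ?thesis
  proof (rule nonneg_power_series_limit [of "\<lambda>k j. co.coefficient ?g (?M k) j" "\<lambda>v. ?g (?c\<^sup>2 * v)"])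
    fix k j
    have "0 \<le> co.sign_moment ?g (?M k) S" if "S \<in> Pow {..<?M k}" "card S = 2 * j" for S
      unfolding co.sign_moment_def
      by (rule torus_test.test_coefficient_nonneg [OF test, where 'a = 'a]) (use that pd in auto)
    then show "0 \<le> co.coefficient ?g (?M k) j"
      unfolding co.coefficient_def by (intro sum_nonneg) auto
  next
    fix v :: real
    assume v: "0 \<le> v" "v < 1"
    define \<rho> where "\<rho> = sqrt v"
    have \<rho>: "\<bar>\<rho>\<bar> \<le> 1" "\<bar>- \<rho>\<bar> \<le> 1" "\<rho>\<^sup>2 = v"
      using v by (auto simp: \<rho>_def)
    have less: "(?c * \<rho>)\<^sup>2 < 1"
    proof -
      have "?c\<^sup>2 * v \<le> 1 * v"
        using co.abs_c_le v by (intro mult_right_mono) (auto simp: abs_square_le_1)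
      then show ?thesis
        using v \<rho> by (simp add: power_mult_distrib)
    qed
    have lim: "(\<lambda>k. ?I r (?M k)) \<longlonglongrightarrow> ?g ((?c * r)\<^sup>2)" if "\<bar>r\<bar> \<le> 1" "(?c * r)\<^sup>2 < 1" for r
      using LIMSEQ_ignore_initial_segment [OF co.weighted_mean_tendsto [OF meas cont bound C m that]] .
    have "(\<lambda>k. (?I \<rho> (?M k) + ?I (- \<rho>) (?M k)) / 2) \<longlonglongrightarrow> (?g ((?c * \<rho>)\<^sup>2) + ?g ((?c * - \<rho>)\<^sup>2)) / 2"
      using less \<rho> by (intro tendsto_intros lim) auto
    then have "(\<lambda>k. (?I \<rho> (?M k) + ?I (- \<rho>) (?M k)) / 2) \<longlonglongrightarrow> ?g (?c\<^sup>2 * v)"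
      using \<rho> by (simp add: power_mult_distrib)
    moreover have "(\<lambda>j. co.coefficient ?g (?M k) j * v ^ j) sums ((?I \<rho> (?M k) + ?I (- \<rho>) (?M k)) / 2)" for k
      using co.coefficient_sums [OF meas torus_test.integrable_profile_X [OF test], of k \<rho>] \<rho>(3) by simp
    ultimately show "\<exists>q. (\<forall>\<^sub>F k in sequentially. (\<lambda>j. co.coefficient ?g (?M k) j * v ^ j) sums q k) \<and>
        q \<longlonglongrightarrow> ?g (?c\<^sup>2 * v)"
      by (intro exI [of _ "\<lambda>k. (?I \<rho> (?M k) + ?I (- \<rho>) (?M k)) / 2"]) simp
  next
    fix a
    assume "\<And>j. 0 \<le> a j" "\<And>v. 0 \<le> v \<Longrightarrow> v < 1 \<Longrightarrow> (\<lambda>j. a j * v ^ j) sums ?g (?c\<^sup>2 * v)"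
    then show ?thesis
      by blast
  qed
qed

text \<open>
  Let the arcs shrink. For \<open>v < c n\<close> the rescaled series at \<open>v\<close> has the value \<open>profile f v\<close>
  already, so \<open>nonneg_power_series_limit\<close> applies to sequences that are eventually constant.
\<close>

lemma profile_power_series:
  assumes f: "f \<in> C_sing" and pd: "\<And>d. d0 \<le> d \<Longrightarrow> positive_definite TYPE('a::scalar) d f"
  obtains a where "\<And>j. 0 \<le> a j" "\<And>v. 0 \<le> v \<Longrightarrow> v < 1 \<Longrightarrow> (\<lambda>j. a j * v ^ j) sums profile f v"
proof -
  define \<kappa> where "\<kappa> n = inverse (real (Suc n))" for n
  have \<kappa>: "0 < \<kappa> n" "\<kappa> n \<le> 1" for n
    by (simp_all add: \<kappa>_def inverse_le_1_iff)
  define c where "c n = (arc_mean (\<kappa> n))\<^sup>2" for n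
  have c_bounds: "(cos (\<kappa> n)) ^ 4 \<le> c n" "c n \<le> 1" for n
  proof -
    obtain K where K: "0 \<le> K"
      "\<And>b. b \<in> arc_support (\<kappa> n) \<Longrightarrow> (\<integral>\<^sup>+t. ennreal (\<bar>sin (t - b)\<bar> powr (- 1 / 2)) \<partial>arc_measure (\<kappa> n)) \<le> ennreal K"
      by (rule nn_integral_arc_sin [OF \<kappa>]) blast
    have "\<bar>arc_mean (\<kappa> n)\<bar> \<le> 1"
      by (rule coordinate.abs_c_le [OF coordinate_arc [OF \<kappa> K]])
    then show "c n \<le> 1"
      by (simp add: c_def abs_square_le_1)
    have "((cos (\<kappa> n))\<^sup>2)\<^sup>2 \<le> (arc_mean (\<kappa> n))\<^sup>2"
      using arc_mean_ge [OF \<kappa>] by (intro power_mono) auto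
    then show "(cos (\<kappa> n)) ^ 4 \<le> c n"
      by (simp add: c_def flip: power_mult)
  qed
  have "(\<lambda>n. (cos (\<kappa> n)) ^ 4) \<longlonglongrightarrow> (cos 0) ^ 4"
    unfolding \<kappa>_def by (intro tendsto_intros LIMSEQ_inverse_real_of_nat)
  then have cos_lim: "(\<lambda>n. (cos (\<kappa> n)) ^ 4) \<longlonglongrightarrow> 1"
    by simp
  have c_lim: "c \<longlonglongrightarrow> 1"
    by (rule tendsto_sandwich [OF always_eventually always_eventually cos_lim tendsto_const])
      (simp_all add: c_bounds)
  have c_pos: "0 < c n" for n
  proof -
    have "0 < cos (\<kappa> n)"
      by (rule cos_arc_support [of "\<kappa> n" 0]) (use \<kappa> [of n] in \<open>auto simp: arc_support_def\<close>)
    then show ?thesis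
      using c_bounds(1) [of n] by (meson less_le_trans zero_less_power)
  qed
  obtain b where b: "\<And>n j. 0 \<le> b n j"
    "\<And>n v. 0 \<le> v \<Longrightarrow> v < 1 \<Longrightarrow> (\<lambda>j. b n j * v ^ j) sums profile f (c n * v)"
    using profile_dilated_power_series [OF f pd \<kappa>] unfolding c_def by metis
  show thesis
  proof (rule nonneg_power_series_limit [of "\<lambda>n j. b n j / c n ^ j" "profile f"])
    show "0 \<le> b n j / c n ^ j" for n j
      using b(1) c_pos [of n] by simp
  next
    fix v :: real
    assume v: "0 \<le> v" "v < 1"
    have "\<forall>\<^sub>F n in sequentially. v < c n"
      using c_lim v(2) by (rule order_tendstoD)
    then have "\<forall>\<^sub>F n in sequentially. (\<lambda>j. b n j / c n ^ j * v ^ j) sums profile f v"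
    proof eventually_elim
      case (elim n)
      then have "(\<lambda>j. b n j * (v / c n) ^ j) sums profile f (c n * (v / c n))"
        using v c_pos [of n] by (intro b(2)) auto
      then show ?case
        using c_pos [of n] by (simp add: power_divide)
    qed
    then show "\<exists>q. (\<forall>\<^sub>F n in sequentially. (\<lambda>j. b n j / c n ^ j * v ^ j) sums q n) \<and> q \<longlonglongrightarrow> profile f v"
      by (intro exI [of _ "\<lambda>_. profile f v"]) simp
  qed (use that in blast)
qed

text \<open>
  The weight \<open>(1 - t) powr \<alpha>\<close> absorbs the singularity once \<open>\<alpha> \<ge> m\<close>, and
  \<open>(1 + t) powr \<beta>\<close> is integrable because \<open>\<beta> > - 1\<close>.
\<close>

lemma C_sing_integrable:
  assumes f: "f \<in> C_sing"
  obtains d0 where "2 \<le> d0"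
    "\<And>d. d0 \<le> d \<Longrightarrow> integrable (jacobi_measure (proj_alpha TYPE('a::scalar) d) (proj_beta TYPE('a))) f"
proof -
  obtain C m where C: "0 < C" and m: "0 < m"
    and bound: "\<And>u. 0 \<le> u \<Longrightarrow> u < 1 \<Longrightarrow> \<bar>profile f u\<bar> \<le> C * inverse (1 - u) ^ m"
    using profile_C_sing(3) [OF f] by blast
  note [measurable] = profile_C_sing(2) [OF f]
  have int: "integrable (jacobi_measure \<alpha> \<beta>) f" if \<alpha>: "real m \<le> \<alpha>" and \<beta>: "-1 < \<beta>" for \<alpha> \<beta>
  proof -
    let ?L = "restrict_space lborel {-1..1::real}"
    let ?w = "\<lambda>t. (1 - t) powr \<alpha> * (1 + t) powr \<beta>"
    have f_eq: "f t = (if t = 1 then f 1 else profile f ((1 + t) / 2))" if "t \<in> {-1..1}" for t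
      using that by (auto simp: profile_def add_divide_distrib)
    have "(\<lambda>t. if t = 1 then f 1 else profile f ((1 + t) / 2)) \<in> borel_measurable borel"
      by measurable
    then have "(\<lambda>t. if t = 1 then f 1 else profile f ((1 + t) / 2)) \<in> borel_measurable ?L"
      by (intro measurable_restrict_space1) simp
    then have f_meas [measurable]: "f \<in> borel_measurable ?L"
      by (rule measurable_cong [THEN iffD1, rotated]) (auto simp: space_restrict_space f_eq [symmetric])
    have w_meas [measurable]: "?w \<in> borel_measurable ?L"
      by (intro measurable_restrict_space1) measurable
    have f_le: "\<bar>f t\<bar> * ?w t \<le> C * 2 powr \<alpha> * (1 + t) powr \<beta>" if t: "t \<in> {-1..1}" for t
    proof (cases "t = 1")
      case True
      then show ?thesis
        using C by simp
    next
      case False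
      then have t': "-1 \<le> t" "t < 1"
        using t by auto
      have "\<bar>profile f ((1 + t) / 2)\<bar> \<le> C * inverse (1 - (1 + t) / 2) ^ m"
        using t' by (intro bound) auto
      moreover have "1 - (1 + t) / 2 = (1 - t) / 2"
        by (simp add: field_simps)
      moreover have "f t = profile f ((1 + t) / 2)"
        using f_eq [OF t] False by simp
      ultimately have "\<bar>f t\<bar> \<le> C * inverse ((1 - t) / 2) ^ m"
        by (simp only:)
      also have "\<dots> = C * ((1 - t) / 2) powr (- real m)"
        unfolding power_inverse powr_minus using t' by (subst powr_realpow) auto
      finally have "\<bar>f t\<bar> * (1 - t) powr \<alpha> \<le> C * ((1 - t) / 2) powr (- real m) * (1 - t) powr \<alpha>"
        by (rule mult_right_mono) simp
      also have "\<dots> = C * 2 powr \<alpha> * (((1 - t) / 2) powr (- real m) * ((1 - t) / 2) powr \<alpha>)"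
        using t' by (simp add: powr_divide)
      also have "\<dots> = C * 2 powr \<alpha> * ((1 - t) / 2) powr (\<alpha> - real m)"
        by (simp add: powr_add [symmetric])
      also have "\<dots> \<le> C * 2 powr \<alpha> * 1"
      proof (rule mult_left_mono)
        have "((1 - t) / 2) powr (\<alpha> - real m) \<le> 1 powr (\<alpha> - real m)"
          using \<alpha> t' by (intro powr_mono2) auto
        then show "((1 - t) / 2) powr (\<alpha> - real m) \<le> 1"
          by simp
      qed (use C in simp)
      finally have "\<bar>f t\<bar> * (1 - t) powr \<alpha> \<le> C * 2 powr \<alpha>"
        by simp
      from mult_right_mono [OF this, of "(1 + t) powr \<beta>"] show ?thesis
        by (simp add: mult.assoc)
    qed
    have fin_\<beta>: "(\<integral>\<^sup>+t. ennreal ((1 + t) powr \<beta>) * indicator {-1..1} t \<partial>lborel) < \<infinity>"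
    proof -
      let ?h = "\<lambda>x :: real. ennreal (x powr \<beta>) * indicator {0..2} x"
      have "(\<integral>\<^sup>+t. ennreal ((1 + t) powr \<beta>) * indicator {-1..1} t \<partial>lborel) = (\<integral>\<^sup>+t. ?h (1 + 1 * t) \<partial>lborel)"
        by (intro nn_integral_cong) (auto split: split_indicator)
      also have "\<dots> = integral\<^sup>N lborel ?h"
        using nn_integral_real_affine [of ?h 1 1] by simp
      also have "\<dots> = ennreal (2 powr (\<beta> + 1) / (\<beta> + 1))"
        by (rule nn_integral_has_integral_lebesgue') (use has_integral_powr_from_0 [OF \<beta>, of 2] in auto)
      finally show ?thesis
        by simp
    qed
    let ?J = "jacobi_weight \<alpha> \<beta>"
    let ?Z = "emeasure ?J {-1..1}"
    have f_meas_J: "f \<in> borel_measurable ?J"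
      unfolding jacobi_weight_def using f_meas by simp
    have "(\<integral>\<^sup>+t. ennreal \<bar>f t\<bar> \<partial>?J) = (\<integral>\<^sup>+t. ennreal (?w t) * ennreal \<bar>f t\<bar> \<partial>?L)"
      unfolding jacobi_weight_def by (rule nn_integral_density) measurable
    also have "\<dots> = (\<integral>\<^sup>+t. ennreal (?w t) * ennreal \<bar>f t\<bar> * indicator {-1..1} t \<partial>lborel)"
      by (rule nn_integral_restrict_space) simp
    also have "\<dots> \<le> (\<integral>\<^sup>+t. ennreal (C * 2 powr \<alpha>) * (ennreal ((1 + t) powr \<beta>) * indicator {-1..1} t) \<partial>lborel)"
    proof (rule nn_integral_mono)
      fix t
      show "ennreal (?w t) * ennreal \<bar>f t\<bar> * indicator {-1..1} t \<le>
          ennreal (C * 2 powr \<alpha>) * (ennreal ((1 + t) powr \<beta>) * indicator {-1..1} t)"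
      proof (cases "t \<in> {-1..1}")
        case True
        have "ennreal (?w t) * ennreal \<bar>f t\<bar> = ennreal (\<bar>f t\<bar> * ?w t)"
          by (subst ennreal_mult [symmetric]) (auto simp: mult.commute)
        also have "\<dots> \<le> ennreal (C * 2 powr \<alpha> * (1 + t) powr \<beta>)"
          using f_le [OF True] by (rule ennreal_leI)
        also have "\<dots> = ennreal (C * 2 powr \<alpha>) * ennreal ((1 + t) powr \<beta>)"
          using C by (intro ennreal_mult) auto
        finally show ?thesis
          using True by simp
      qed simp
    qed
    also have "\<dots> = ennreal (C * 2 powr \<alpha>) * (\<integral>\<^sup>+t. ennreal ((1 + t) powr \<beta>) * indicator {-1..1} t \<partial>lborel)"
      by (rule nn_integral_cmult) measurable
    also have "\<dots> < \<infinity>"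
      using fin_\<beta> by (simp add: ennreal_mult_less_top)
    finally have fin: "(\<integral>\<^sup>+t. ennreal \<bar>f t\<bar> \<partial>?J) < \<infinity>" .
    have space_J: "space ?J = {-1..1}"
      by (simp add: jacobi_weight_def space_restrict_space)
    \<comment> \<open>if the weight had mass 0, the scaling factor would be infinite, but then the integral vanishes\<close>
    have "inverse ?Z * (\<integral>\<^sup>+t. ennreal \<bar>f t\<bar> \<partial>?J) < \<infinity>"
    proof (cases "?Z = 0")
      case True
      then have "(\<integral>\<^sup>+t. ennreal \<bar>f t\<bar> \<partial>?J) = (\<integral>\<^sup>+t. 0 \<partial>?J)"
        by (intro nn_integral_cong_AE emeasure_0_AE) (simp add: space_J)
      then show ?thesis
        by simp
    next
      case False
      then have "inverse ?Z < top"
        by (simp add: less_top [symmetric])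
      then show ?thesis
        using fin by (simp add: ennreal_mult_less_top)
    qed
    then show ?thesis
      using f_meas_J unfolding jacobi_measure_def
      by (intro integrableI_bounded) (auto simp: nn_integral_scale_measure)
  qed
  show thesis
  \<comment> \<open>from \<open>m \<le> (d - 1) / 2 - 1\<close>, the case of the smallest field dimension 1\<close>
  proof (rule that [of "2 * m + 3"])
    fix d
    assume d: "2 * m + 3 \<le> d"
    have DIM: "1 \<le> real DIM('a)"
      using DIM_positive [where 'a = 'a] by linarith
    have "real m + 1 \<le> (real d - 1) / 2 * 1"
      using d by simp
    also have "\<dots> \<le> (real d - 1) / 2 * real DIM('a)"
      using d DIM by (intro mult_left_mono) auto
    finally have "real m \<le> proj_alpha TYPE('a) d"
      by (simp add: proj_alpha_def)
    moreover have "-1 < proj_beta TYPE('a)"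
      using DIM by (simp add: proj_beta_def)
    ultimately show "integrable (jacobi_measure (proj_alpha TYPE('a) d) (proj_beta TYPE('a))) f"
      by (rule int)
  qed simp
qed

lemma positive_definite_all_iff:
  assumes f: "f \<in> C_sing"
  shows "positive_definite_all TYPE('a::scalar) f \<longleftrightarrow>
    (\<exists>a :: nat \<Rightarrow> real. (\<forall>n. 0 \<le> a n) \<and>
      (\<forall>\<theta>\<in>{0<..pi / 2}. (\<lambda>n. a n * cos \<theta> ^ (2 * n)) sums f (cos (2 * \<theta>))))"
  unfolding cosine_series_iff
proof
  assume pd: "positive_definite_all TYPE('a) f"
  obtain d0 where d0: "2 \<le> d0"
    "\<And>d. d0 \<le> d \<Longrightarrow> integrable (jacobi_measure (proj_alpha TYPE('a) d) (proj_beta TYPE('a))) f"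
    by (rule C_sing_integrable [OF f, where 'a = 'a]) blast
  have "positive_definite TYPE('a) d f" if "d0 \<le> d" for d
    using pd d0 that unfolding positive_definite_all_def by auto
  then obtain a where "\<And>j. 0 \<le> a j" "\<And>v. 0 \<le> v \<Longrightarrow> v < 1 \<Longrightarrow> (\<lambda>j. a j * v ^ j) sums profile f v"
    by (rule profile_power_series [OF f]) blast+
  then show "\<exists>a :: nat \<Rightarrow> real. (\<forall>n. 0 \<le> a n) \<and> (\<forall>u. 0 \<le> u \<longrightarrow> u < 1 \<longrightarrow> (\<lambda>n. a n * u ^ n) sums f (2 * u - 1))"
    by (intro exI [of _ a]) (simp add: profile_def)
next
  assume "\<exists>a :: nat \<Rightarrow> real. (\<forall>n. 0 \<le> a n) \<and> (\<forall>u. 0 \<le> u \<longrightarrow> u < 1 \<longrightarrow> (\<lambda>n. a n * u ^ n) sums f (2 * u - 1))"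
  then obtain a :: "nat \<Rightarrow> real" where "\<And>n. 0 \<le> a n"
    "\<And>u. 0 \<le> u \<Longrightarrow> u < 1 \<Longrightarrow> (\<lambda>n. a n * u ^ n) sums f (2 * u - 1)"
    by blast
  then show "positive_definite_all TYPE('a) f"
    unfolding positive_definite_all_def by (intro allI impI power_series_positive_definite)
qed

theorem theorem7:
  fixes f :: "real \<Rightarrow> real"
  assumes "f \<in> C_sing"
  shows
   "(positive_definite_all TYPE(real) f \<longleftrightarrow>
      (\<exists>a :: nat \<Rightarrow> real. (\<forall>n. 0 \<le> a n) \<and>
        (\<forall>\<theta>\<in>{0<..pi / 2}. (\<lambda>n. a n * cos \<theta> ^ (2 * n)) sums f (cos (2 * \<theta>))))) \<and>
    (positive_definite_all TYPE(complex) f \<longleftrightarrow>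
      (\<exists>a :: nat \<Rightarrow> real. (\<forall>n. 0 \<le> a n) \<and>
        (\<forall>\<theta>\<in>{0<..pi / 2}. (\<lambda>n. a n * cos \<theta> ^ (2 * n)) sums f (cos (2 * \<theta>))))) \<and>
    (positive_definite_all TYPE(quat) f \<longleftrightarrow>
      (\<exists>a :: nat \<Rightarrow> real. (\<forall>n. 0 \<le> a n) \<and>
        (\<forall>\<theta>\<in>{0<..pi / 2}. (\<lambda>n. a n * cos \<theta> ^ (2 * n)) sums f (cos (2 * \<theta>)))))"
  by (intro conjI positive_definite_all_iff assms)

end
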